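(* Every non-tubular constant Gauss curvature $K\neq0$ surface of elliptic rotation in $\mathbb{H}^3\subset\mathbb{R}^{3,1}$ is given in an orthonormal basis by $$(s,\theta)\mapsto\left(\sqrt{1+r^2(s)}\,\cosh\psi(s),\ \sqrt{1+r^2(s)}\,\sinh\psi(s),\ r(s)\cos\theta,\ r(s)\sin\theta\right),$$ where $r,\psi$ are one of the following pairs of functions (with a parameter $p$ and an auxiliary constant $\Xi$): Case $K<0$: (i) $r(s)=\sqrt{\tfrac{p^2}{1-K-p^2}}\ \mathrm{cn}_p(\Xi s)$, $\psi(s)=\tfrac{K}{\Xi}\Pi\!\left(\tfrac{p^2}{1-K};\Xi s\,|\,p\right)-Ks$, $\Xi=\sqrt{\tfrac{(-K)(1-K)}{1-K-p^2}}$, $p\in[0,1]$; (ii) $r(s)=\sqrt{\tfrac{1}{(1-K)p^2-1}}\ \mathrm{dn}_p(\Xi s)$, $\psi(s)=\tfrac{K}{\Xi}\Pi\!\left(\tfrac{1}{1-K};\Xi s\,|\,p\right)-Ks$, $\Xi=\sqrt{\tfrac{(-K)(1-K)}{(1-K)p^2-1}}$, $p\in\left[\sqrt{\tfrac{1}{1-K}},1\right]$. Case $K\in(0,1)$: (i) $r(s)=\sqrt{\tfrac{1-p^2}{K-1+p^2}}\ \mathrm{nc}_p(\Xi s)$, $\psi(s)=\tfrac{\Xi(1-p^2)}{K}\Pi\!\left(\tfrac{1-K}{\Xi^2};\Xi s\,|\,p\right)-\tfrac{\Xi^2p^2}{1-K}s$, $\Xi=\sqrt{\tfrac{K(1-K)}{K-1+p^2}}$,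 $p\in[\sqrt{1-K},1]$; (ii) $r(s)=\sqrt{\tfrac{1-p^2}{1+p^2(K-1)}}\ \mathrm{sc}_p(\Xi s)$, $\psi(s)=\tfrac{\Xi(1-p^2)}{K}\Pi\!\left(\tfrac{\Xi^2p^2}{1-K};\Xi s\,|\,p\right)-s$, $\Xi=\sqrt{\tfrac{K(1-K)}{1+p^2(K-1)}}$, $p\in[0,1]$; (iii) $r(s)=\sqrt{\tfrac{1-p^2}{1-Kp^2}}\ \mathrm{sc}_p(\Xi s)$, $\psi(s)=\tfrac{\Xi(1-p^2)}{K-1}\Pi\!\left(\tfrac{\Xi^2p^2}{K};\Xi s\,|\,p\right)$, $\Xi=\sqrt{\tfrac{K(1-K)}{1-Kp^2}}$, $p\in[0,1]$; (iv) $r(s)=\sqrt{\tfrac{1-p^2}{p^2-K}}\ \mathrm{nc}_p(\Xi s)$, $\psi(s)=\tfrac{\Xi(1-p^2)}{K-1}\Pi\!\left(\tfrac{K}{\Xi^2};\Xi s\,|\,p\right)+\tfrac{\Xi^2(1-p^2)}{1-K}s$, $\Xi=\sqrt{\tfrac{K(1-K)}{p^2-K}}$, $p\in[\sqrt{K},1]$. Case $K=1$: (i) (snowman fronts) $r(s)=\sqrt{\tfrac{1-p^2}{p^2}}\,\cosh\left(\tfrac{s}{p}\right)$, $\psi(s)=s-\operatorname{artanh}\left(p\tanh\left(\tfrac{s}{p}\right)\right)$, $p\in(0,1)$; (ii) (hourglass fronts) $r(s)=\sqrt{1-p^2}\,\sinh(ps)$, $\psi(s)=s-\operatorname{artanh}\left(p\tanh(ps)\right)$,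 $p\in(0,1)$. Case $K>1$: (i) $r(s)=\sqrt{\tfrac{p^2}{K-p^2}}\ \mathrm{cn}_p(\Xi s)$, $\psi(s)=\tfrac{K-1}{\Xi}\Pi\!\left(\tfrac{p^2}{K};\Xi s\,|\,p\right)-Ks$, $\Xi=\sqrt{\tfrac{K(K-1)}{K-p^2}}$, $p\in[0,1]$; (ii) $r(s)=\sqrt{\tfrac{1}{Kp^2-1}}\ \mathrm{dn}_p(\Xi s)$, $\psi(s)=\tfrac{K-1}{\Xi}\Pi\!\left(\tfrac{1}{K};\Xi s\,|\,p\right)-Ks$, $\Xi=\sqrt{\tfrac{K(K-1)}{Kp^2-1}}$, $p\in\left[\sqrt{\tfrac1K},1\right]$.
   Context: $\mathbb{H}^3$ is the upper sheet of the two-sheeted hyperboloid $\{x:(x,x)=-1\}$ in Minkowski space $\mathbb{R}^{3,1}$; in an orthonormal basis $(x,y)=-x_0y_0+x_1y_1+x_2y_2+x_3y_3$. $K=k_1k_2$ denotes the extrinsic Gauss curvature (product of principal curvatures in $\mathbb{H}^3$); the intrinsic Gauss curvature is $K-1$. A surface of elliptic rotation is a surface invariant under a $1$-parameter group of isometries acting as rotations in a fixed spacelike (signature $(++)$) $2$-plane of $\mathbb{R}^{3,1}$ and as the identity on its orthogonal complement. "Given by" is understood up to isometries of $\mathbb{H}^3$ and reparametrisation; at endpoints of parameter intervals where the expressions have poles or degenerate they are to be disregarded. A surface is tubular if one of its principal curvatures is constant. $\mathrm{sn}_p,\mathrm{cn}_p,\mathrm{dn}_p$ denote the Jacobi elliptic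 functions of modulus $p$ (so that $\mathrm{sn}_p^2+\mathrm{cn}_p^2=\mathrm{dn}_p^2+p^2\mathrm{sn}_p^2=1$), and $\mathrm{nc}_p=1/\mathrm{cn}_p$, $\mathrm{sc}_p=\mathrm{sn}_p/\mathrm{cn}_p$. Further, $\Pi(k;s\,|\,p)=\int_0^s\frac{du}{1-k\,\mathrm{sn}_p^2(u)}$ (incomplete elliptic integral of the third kind).
   Formalization: For 0<K<1 the printed list omits one non-tubular surface, r=1/(√K sinh(√(1-K)s)), ψ=s-artanh(√(1-K)tanh(√(1-K)s)), since the printed pairs degenerate to r=0 at p=1; the formal theorem adds this pair as an extra alternative. *)

theory Defs
  imports "HOL-Analysis.Analysis"
begin

section \<open>Minkowski space and hyperbolic space\<close>

text \<open>The index type \<^typ>\<open>4\<close> has the elements 0, 1, 2, 3; index 0 is the timelike one.\<close>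

definition mink :: "real^4 \<Rightarrow> real^4 \<Rightarrow> real" where
  "mink x y = - x$0 * y$0 + x$1 * y$1 + x$2 * y$2 + x$3 * y$3"

definition hyp3 :: "(real^4) set" where
  "hyp3 = {x. mink x x = -1 \<and> x$0 > 0}"

definition orthonormal_basis :: "(4 \<Rightarrow> real^4) \<Rightarrow> bool" where
  "orthonormal_basis e \<longleftrightarrow>
     (\<forall>i j. mink (e i) (e j) = (if i \<noteq> j then 0 else if i = 0 then -1 else 1))"


section \<open>Parametrised surfaces\<close>

text \<open>Meant for open \<open>D\<close>, since derivatives are taken at points.\<close>

primrec Ck_on :: "nat \<Rightarrow> ('a::euclidean_space \<Rightarrow> 'b::real_normed_vector) \<Rightarrow> 'a set \<Rightarrow> bool" where
  "Ck_on 0 f D \<longleftrightarrow> continuous_on D f"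
| "Ck_on (Suc k) f D \<longleftrightarrow> (\<forall>x\<in>D. f differentiable (at x)) \<and>
     (\<forall>b\<in>Basis. Ck_on k (\<lambda>x. frechet_derivative f (at x) b) D)"

definition smooth_on :: "('a::euclidean_space \<Rightarrow> 'b::real_normed_vector) \<Rightarrow> 'a set \<Rightarrow> bool" where
  "smooth_on f D \<longleftrightarrow> (\<forall>k. Ck_on k f D)"

definition surface_in_hyp3 :: "(real \<times> real) set \<Rightarrow> (real \<times> real \<Rightarrow> real^4) \<Rightarrow> bool" where
  "surface_in_hyp3 D f \<longleftrightarrow> D \<noteq> {} \<and> open D \<and> connected D \<and> smooth_on f D \<and> f ` D \<subseteq> hyp3 \<and>
     (\<forall>u\<in>D. inj (frechet_derivative f (at u)))"

text \<open>Since the tangent space of \<^const>\<open>hyp3\<close> at \<open>f u\<close> is the orthogonal complement of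
  \<open>f u\<close>, the following is a unit normal field of \<open>f\<close> within \<^const>\<open>hyp3\<close>.\<close>

definition unit_normal_field ::
    "(real \<times> real) set \<Rightarrow> (real \<times> real \<Rightarrow> real^4) \<Rightarrow> (real \<times> real \<Rightarrow> real^4) \<Rightarrow> bool" where
  "unit_normal_field D f n \<longleftrightarrow> smooth_on n D \<and>
     (\<forall>u\<in>D. mink (n u) (n u) = 1 \<and> mink (n u) (f u) = 0 \<and>
        (\<forall>v. mink (n u) (frechet_derivative f (at u) v) = 0))"

text \<open>\<open>k1\<close> and \<open>k2\<close> are the eigenvalues, with multiplicity, of the shape operator \<open>S\<close>
  determined by \<open>df \<circ> S = - dn\<close>.\<close>

definition principal_curvatures ::
    "(real \<times> real \<Rightarrow> real^4) \<Rightarrow> (real \<times> real \<Rightarrow> real^4) \<Rightarrow> real \<times> real \<Rightarrow> real \<Rightarrow> real \<Rightarrow> bool" where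
  "principal_curvatures f n u k1 k2 \<longleftrightarrow>
     (\<exists>v1 v2. v1 \<noteq> v2 \<and> independent {v1, v2} \<and>
        frechet_derivative n (at u) v1 = - k1 *\<^sub>R frechet_derivative f (at u) v1 \<and>
        frechet_derivative n (at u) v2 = - k2 *\<^sub>R frechet_derivative f (at u) v2)"

text \<open>The Gauss curvature is the extrinsic one; it does not depend on the sign of \<open>n\<close>.\<close>

definition constant_Gauss_curvature ::
    "(real \<times> real) set \<Rightarrow> (real \<times> real \<Rightarrow> real^4) \<Rightarrow> real \<Rightarrow> bool" where
  "constant_Gauss_curvature D f K \<longleftrightarrow>
     (\<exists>n. unit_normal_field D f n \<and>
        (\<forall>u\<in>D. \<exists>k1 k2. principal_curvatures f n u k1 k2 \<and> k1 * k2 = K))"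

definition tubular :: "(real \<times> real) set \<Rightarrow> (real \<times> real \<Rightarrow> real^4) \<Rightarrow> bool" where
  "tubular D f \<longleftrightarrow>
     (\<exists>n c. unit_normal_field D f n \<and> (\<forall>u\<in>D. \<exists>k. principal_curvatures f n u c k))"


section \<open>Surfaces of elliptic rotation\<close>

definition elliptic_rotation_group :: "(real \<Rightarrow> real^4 \<Rightarrow> real^4) \<Rightarrow> bool" where
  "elliptic_rotation_group R \<longleftrightarrow>
     (\<exists>a b. mink a a = 1 \<and> mink b b = 1 \<and> mink a b = 0 \<and>
        (\<forall>t. linear (R t) \<and>
           R t a = cos t *\<^sub>R a + sin t *\<^sub>R b \<and>
           R t b = - sin t *\<^sub>R a + cos t *\<^sub>R b \<and>
           (\<forall>w. mink w a = 0 \<and> mink w b = 0 \<longrightarrow> R t w = w)))"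

text \<open>Invariance of the parametrised surface \<open>f\<close>: the group acts on the parameter domain by
  translations of the second parameter and \<open>f\<close> is equivariant. The curves \<open>s \<mapsto> f (s, \<theta>)\<close>
  are arbitrary: they need neither be planar nor orthogonal to the orbits.\<close>

definition elliptic_rotation_surface :: "real set \<Rightarrow> (real \<times> real \<Rightarrow> real^4) \<Rightarrow> bool" where
  "elliptic_rotation_surface I f \<longleftrightarrow> surface_in_hyp3 (I \<times> UNIV) f \<and>
     (\<exists>R. elliptic_rotation_group R \<and> (\<forall>s\<in>I. \<forall>\<theta> t. f (s, \<theta> + t) = R t (f (s, \<theta>))))"

definition rotation_param ::
    "(4 \<Rightarrow> real^4) \<Rightarrow> (real \<Rightarrow> real) \<Rightarrow> (real \<Rightarrow> real) \<Rightarrow> real \<times> real \<Rightarrow> real^4" where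
  "rotation_param e r \<psi> = (\<lambda>(s, \<theta>).
       (sqrt (1 + (r s)\<^sup>2) * cosh (\<psi> s)) *\<^sub>R e 0
     + (sqrt (1 + (r s)\<^sup>2) * sinh (\<psi> s)) *\<^sub>R e 1
     + (r s * cos \<theta>) *\<^sub>R e 2
     + (r s * sin \<theta>) *\<^sub>R e 3)"

definition reparametrisation ::
    "(real \<times> real \<Rightarrow> real \<times> real) \<Rightarrow> (real \<times> real) set \<Rightarrow> (real \<times> real) set \<Rightarrow> bool" where
  "reparametrisation \<Phi> D D' \<longleftrightarrow> bij_betw \<Phi> D D' \<and> smooth_on \<Phi> D \<and>
     (\<forall>u\<in>D. inj (frechet_derivative \<Phi> (at u)))"

text \<open>The freedom of an ambient isometry is the choice of the orthonormal basis \<open>e\<close>. If \<open>f\<close> is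
  an immersion, then no pole of \<open>r\<close> or \<open>\<psi>\<close> can lie in the interval \<open>J\<close>, and a degenerate pair
  (such as \<open>r = 0\<close>) cannot occur, because \<^term>\<open>rotation_param e r \<psi>\<close> has to be an immersion on
  \<open>J \<times> UNIV\<close>.\<close>

definition given_by ::
    "real set \<Rightarrow> (real \<times> real \<Rightarrow> real^4) \<Rightarrow> (real \<Rightarrow> real) \<Rightarrow> (real \<Rightarrow> real) \<Rightarrow> bool" where
  "given_by I f r \<psi> \<longleftrightarrow>
     (\<exists>e J \<Phi>. orthonormal_basis e \<and> open J \<and> is_interval J \<and>
        reparametrisation \<Phi> (I \<times> UNIV) (J \<times> UNIV) \<and>
        (\<forall>u\<in>I \<times> UNIV. f u = rotation_param e r \<psi> (\<Phi> u)))"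


section \<open>Jacobi elliptic functions of modulus \<open>p \<in> [0,1]\<close>\<close>

text \<open>The amplitude inverts the elliptic integral of the first kind. The first condition is void
  for \<open>p < 1\<close>; for \<open>p = 1\<close>, where the integrand is singular at odd multiples of \<open>pi/2\<close>, it
  restricts \<open>\<phi>\<close> to \<open>(-pi/2, pi/2)\<close>.\<close>

definition jacobi_am :: "real \<Rightarrow> real \<Rightarrow> real" where
  "jacobi_am p u = (THE \<phi>. (\<forall>t\<in>closed_segment 0 \<phi>. p\<^sup>2 * (sin t)\<^sup>2 < 1) \<and>
     (LBINT t=0..ereal \<phi>. 1 / sqrt (1 - p\<^sup>2 * (sin t)\<^sup>2)) = u)"

definition jacobi_sn :: "real \<Rightarrow> real \<Rightarrow> real" where
  "jacobi_sn p u = sin (jacobi_am p u)"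

definition jacobi_cn :: "real \<Rightarrow> real \<Rightarrow> real" where
  "jacobi_cn p u = cos (jacobi_am p u)"

definition jacobi_dn :: "real \<Rightarrow> real \<Rightarrow> real" where
  "jacobi_dn p u = sqrt (1 - p\<^sup>2 * (jacobi_sn p u)\<^sup>2)"

definition jacobi_nc :: "real \<Rightarrow> real \<Rightarrow> real" where
  "jacobi_nc p u = 1 / jacobi_cn p u"

definition jacobi_sc :: "real \<Rightarrow> real \<Rightarrow> real" where
  "jacobi_sc p u = jacobi_sn p u / jacobi_cn p u"

text \<open>\<open>ellipticPi k s p\<close> is the integral usually written \<open>\<Pi>(k; s | p)\<close>.\<close>

definition ellipticPi :: "real \<Rightarrow> real \<Rightarrow> real \<Rightarrow> real" where
  "ellipticPi k s p = (LBINT u=0..ereal s. 1 / (1 - k * (jacobi_sn p u)\<^sup>2))"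


section \<open>The pairs \<open>(r, \<psi>)\<close>\<close>

inductive cgc_profile :: "real \<Rightarrow> (real \<Rightarrow> real) \<Rightarrow> (real \<Rightarrow> real) \<Rightarrow> bool" for K :: real where
  neg_i:
    "\<lbrakk>K < 0; p \<in> {0..1};
      \<Xi> = sqrt ((- K) * (1 - K) / (1 - K - p\<^sup>2));
      r = (\<lambda>s. sqrt (p\<^sup>2 / (1 - K - p\<^sup>2)) * jacobi_cn p (\<Xi> * s));
      \<psi> = (\<lambda>s. K / \<Xi> * ellipticPi (p\<^sup>2 / (1 - K)) (\<Xi> * s) p - K * s)\<rbrakk>
     \<Longrightarrow> cgc_profile K r \<psi>"
| neg_ii:
    "\<lbrakk>K < 0; p \<in> {sqrt (1 / (1 - K))..1};
      \<Xi> = sqrt ((- K) * (1 - K) / ((1 - K) * p\<^sup>2 - 1));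
      r = (\<lambda>s. sqrt (1 / ((1 - K) * p\<^sup>2 - 1)) * jacobi_dn p (\<Xi> * s));
      \<psi> = (\<lambda>s. K / \<Xi> * ellipticPi (1 / (1 - K)) (\<Xi> * s) p - K * s)\<rbrakk>
     \<Longrightarrow> cgc_profile K r \<psi>"
| between_i:
    "\<lbrakk>0 < K; K < 1; p \<in> {sqrt (1 - K)..1};
      \<Xi> = sqrt (K * (1 - K) / (K - 1 + p\<^sup>2));
      r = (\<lambda>s. sqrt ((1 - p\<^sup>2) / (K - 1 + p\<^sup>2)) * jacobi_nc p (\<Xi> * s));
      \<psi> = (\<lambda>s. \<Xi> * (1 - p\<^sup>2) / K * ellipticPi ((1 - K) / \<Xi>\<^sup>2) (\<Xi> * s) p
                - \<Xi>\<^sup>2 * p\<^sup>2 / (1 - K) * s)\<rbrakk>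
     \<Longrightarrow> cgc_profile K r \<psi>"
| between_ii:
    "\<lbrakk>0 < K; K < 1; p \<in> {0..1};
      \<Xi> = sqrt (K * (1 - K) / (1 + p\<^sup>2 * (K - 1)));
      r = (\<lambda>s. sqrt ((1 - p\<^sup>2) / (1 + p\<^sup>2 * (K - 1))) * jacobi_sc p (\<Xi> * s));
      \<psi> = (\<lambda>s. \<Xi> * (1 - p\<^sup>2) / K * ellipticPi (\<Xi>\<^sup>2 * p\<^sup>2 / (1 - K)) (\<Xi> * s) p - s)\<rbrakk>
     \<Longrightarrow> cgc_profile K r \<psi>"
| between_iii:
    "\<lbrakk>0 < K; K < 1; p \<in> {0..1};
      \<Xi> = sqrt (K * (1 - K) / (1 - K * p\<^sup>2));
      r = (\<lambda>s. sqrt ((1 - p\<^sup>2) / (1 - K * p\<^sup>2)) * jacobi_sc p (\<Xi> * s));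
      \<psi> = (\<lambda>s. \<Xi> * (1 - p\<^sup>2) / (K - 1) * ellipticPi (\<Xi>\<^sup>2 * p\<^sup>2 / K) (\<Xi> * s) p)\<rbrakk>
     \<Longrightarrow> cgc_profile K r \<psi>"
| between_iv:
    "\<lbrakk>0 < K; K < 1; p \<in> {sqrt K..1};
      \<Xi> = sqrt (K * (1 - K) / (p\<^sup>2 - K));
      r = (\<lambda>s. sqrt ((1 - p\<^sup>2) / (p\<^sup>2 - K)) * jacobi_nc p (\<Xi> * s));
      \<psi> = (\<lambda>s. \<Xi> * (1 - p\<^sup>2) / (K - 1) * ellipticPi (K / \<Xi>\<^sup>2) (\<Xi> * s) p
                + \<Xi>\<^sup>2 * (1 - p\<^sup>2) / (1 - K) * s)\<rbrakk>
     \<Longrightarrow> cgc_profile K r \<psi>"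
| one_i_snowman:
    "\<lbrakk>K = 1; p \<in> {0<..<1};
      r = (\<lambda>s. sqrt ((1 - p\<^sup>2) / p\<^sup>2) * cosh (s / p));
      \<psi> = (\<lambda>s. s - artanh (p * tanh (s / p)))\<rbrakk>
     \<Longrightarrow> cgc_profile K r \<psi>"
| one_ii_hourglass:
    "\<lbrakk>K = 1; p \<in> {0<..<1};
      r = (\<lambda>s. sqrt (1 - p\<^sup>2) * sinh (p * s));
      \<psi> = (\<lambda>s. s - artanh (p * tanh (p * s)))\<rbrakk>
     \<Longrightarrow> cgc_profile K r \<psi>"
| above_i:
    "\<lbrakk>K > 1; p \<in> {0..1};
      \<Xi> = sqrt (K * (K - 1) / (K - p\<^sup>2));
      r = (\<lambda>s. sqrt (p\<^sup>2 / (K - p\<^sup>2)) * jacobi_cn p (\<Xi> * s));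
      \<psi> = (\<lambda>s. (K - 1) / \<Xi> * ellipticPi (p\<^sup>2 / K) (\<Xi> * s) p - K * s)\<rbrakk>
     \<Longrightarrow> cgc_profile K r \<psi>"
| above_ii:
    "\<lbrakk>K > 1; p \<in> {sqrt (1 / K)..1};
      \<Xi> = sqrt (K * (K - 1) / (K * p\<^sup>2 - 1));
      r = (\<lambda>s. sqrt (1 / (K * p\<^sup>2 - 1)) * jacobi_dn p (\<Xi> * s));
      \<psi> = (\<lambda>s. (K - 1) / \<Xi> * ellipticPi (1 / K) (\<Xi> * s) p - K * s)\<rbrakk>
     \<Longrightarrow> cgc_profile K r \<psi>"

text \<open>Up to isometry and reparametrisation there is exactly one further surface for each
  \<open>0 < K < 1\<close>. In terms of the arc length \<open>\<sigma>\<close> of the profile curve, constant Gauss curvature \<open>K\<close>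
  means that \<open>(dr/d\<sigma>)\<^sup>2 = (1 - K) * r\<^sup>2 + C\<close>, and the principal curvature along the
  circles of rotation is \<open>sqrt (K + (1 - C) / r\<^sup>2)\<close> up to sign. For \<open>0 < K < 1\<close> the pairs above realise all
  \<open>C \<noteq> 0, 1\<close>. The surfaces with \<open>C = 1\<close> are tubular, but those with \<open>C = 0\<close> are not: they are
  the following ones, the limit for \<open>p \<rightarrow> 1\<close> of \<open>between_i\<close> and \<open>between_ii\<close> after a
  shift of \<open>s\<close> by a quarter period, whereas these expressions themselves become \<open>r = 0\<close> at \<open>p = 1\<close>.\<close>

inductive limit_profile :: "real \<Rightarrow> (real \<Rightarrow> real) \<Rightarrow> (real \<Rightarrow> real) \<Rightarrow> bool" for K :: real where
  between_limit:
    "\<lbrakk>0 < K; K < 1;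
      r = (\<lambda>s. 1 / (sqrt K * sinh (sqrt (1 - K) * s)));
      \<psi> = (\<lambda>s. s - artanh (sqrt (1 - K) * tanh (sqrt (1 - K) * s)))\<rbrakk>
     \<Longrightarrow> limit_profile K r \<psi>"

end

theory Submission
  imports Defs
begin

text \<open>
  After an isometry and a shear of the angle, a surface of elliptic rotation is the rotation of a
  profile curve with polar coordinates \<open>(\<rho>, h)\<close> (\<open>elliptic_rotation_normal_form\<close>). Let \<open>\<sigma>\<close> be the
  arc length of this curve, \<open>q = d\<rho>/d\<sigma>\<close> and \<open>g = (1 + \<rho>\<^sup>2) dh/d\<sigma>\<close>, so that \<open>g\<^sup>2 + q\<^sup>2 = 1 + \<rho>\<^sup>2\<close>. The
  principal curvature along the circles of rotation is \<open>g / \<rho>\<close> up to sign, and curvature \<open>K\<close> means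
  \<open>dq/d\<sigma> = (1 - K) \<rho>\<close> (\<open>rotational_curvature\<close>). Hence there is a constant \<open>C\<close> with
  \<open>q\<^sup>2 = P(\<rho>) = (1 - K) \<rho>\<^sup>2 + C\<close> and \<open>g\<^sup>2 = Q(\<rho>) = K \<rho>\<^sup>2 + 1 - C\<close>. The values \<open>C = 1\<close>, and \<open>C = 0\<close> for
  \<open>K = 1\<close>, give tubular surfaces. Since \<open>K \<noteq> 0\<close>, no principal curvature vanishes, so \<open>g\<close> has no zeros
  and \<open>h\<close> is strictly monotone.

  All the explicit pairs \<open>(r, \<psi>)\<close> use the same parameter \<open>s\<close>, namely \<open>ds = d\<sigma> / \<bar>g\<bar>\<close> up to sign:
  they satisfy \<open>(dr/ds)\<^sup>2 = P(r) Q(r)\<close> and \<open>d\<psi>/ds = Q(r) / (1 + r\<^sup>2)\<close> up to sign. It therefore suffices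
  to find a function \<open>\<tau>\<close> of the parameter of the given curve with \<open>\<tau>'\<^sup>2 = v\<^sup>2 / Q(\<rho>)\<close>, where \<open>v\<close> is the
  speed, and \<open>r \<circ> \<tau> = \<rho>\<close>. Then \<open>h\<close> and \<open>\<psi> \<circ> \<tau>\<close> have the same derivative up to a constant sign, and
  this sign and the constant of integration are absorbed by a reflection and a boost
  (\<open>given_by_profile\<close>).

  To find \<open>\<tau>\<close>, write \<open>\<tau> = F(\<phi>) / \<Xi>\<close> with the elliptic integral \<open>F\<close> of the first kind. The amplitude
  inverts \<open>F\<close>, so the Jacobi functions at \<open>\<Xi> \<tau>\<close> are trigonometric functions of \<open>\<phi>\<close>, and \<open>\<phi>\<close> can be read
  off from \<open>\<rho>\<close>, or from \<open>q\<close> where \<open>\<rho>\<close> may have a turning point (\<open>given_by_jacobi_profile\<close>). In this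
  way the equations for \<open>r\<close> and \<open>\<psi>\<close> become rational identities. The position of \<open>C\<close> relative to \<open>0\<close>, \<open>1 - K\<close> and \<open>1\<close> selects the family.
\<close>

section \<open>Smooth functions of one real variable\<close>

text \<open>The one-dimensional counterpart of \<^const>\<open>Ck_on\<close>. With an existentially quantified derivative the
  closure properties are inductions on the order that never mention a chosen derivative operator.\<close>

primrec Cn_on :: "nat \<Rightarrow> (real \<Rightarrow> real) \<Rightarrow> real set \<Rightarrow> bool" where
  "Cn_on 0 g I \<longleftrightarrow> continuous_on I g"
| "Cn_on (Suc k) g I \<longleftrightarrow>
     (\<exists>g'. (\<forall>x\<in>I. (g has_real_derivative g' x) (at x)) \<and> Cn_on k g' I)"

definition Cinf_on :: "(real \<Rightarrow> real) \<Rightarrow> real set \<Rightarrow> bool" where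
  "Cinf_on g I \<longleftrightarrow> (\<forall>k. Cn_on k g I)"

lemma Cn_on_lower: "Cn_on (Suc k) g I \<Longrightarrow> Cn_on k g I"
proof (induction k arbitrary: g)
  case 0
  then obtain g' where "\<forall>x\<in>I. (g has_real_derivative g' x) (at x)" by auto
  then have "\<forall>x\<in>I. isCont g x" using DERIV_isCont by blast
  then show ?case by (simp add: continuous_at_imp_continuous_on)
next
  case (Suc k)
  from Suc.prems obtain g' where "\<forall>x\<in>I. (g has_real_derivative g' x) (at x)"
    "Cn_on (Suc k) g' I"
    unfolding Cn_on.simps(2)[of "Suc k"] by blast
  then show ?case using Suc.IH[of g'] unfolding Cn_on.simps(2)[of k g] by blast
qed

lemma Cn_on_SucI:
  "\<forall>x\<in>I. (g has_real_derivative g' x) (at x) \<Longrightarrow> Cn_on k g' I \<Longrightarrow> Cn_on (Suc k) g I"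
  by auto

lemma Cn_on_cong:
  assumes "Cn_on k g I" "open I" "\<And>x. x \<in> I \<Longrightarrow> f x = g x"
  shows "Cn_on k f I"
proof (cases k)
  case 0
  then show ?thesis using assms by (simp cong: continuous_on_cong)
next
  case (Suc n)
  then obtain g' where g': "\<forall>x\<in>I. (g has_real_derivative g' x) (at x)" "Cn_on n g' I"
    using assms(1) by auto
  have "(f has_real_derivative g' x) (at x)" if "x \<in> I" for x
    by (rule has_field_derivative_transform_within_open[OF _ \<open>open I\<close> that])
      (use g' that assms(3) in auto)
  then show ?thesis using g' Suc by auto
qed

lemma Cn_on_const: "Cn_on k (\<lambda>x. c) I"
proof (induction k arbitrary: c)
  case (Suc k)
  then show ?case by (auto intro!: exI[of _ "\<lambda>_. 0"])
qed simp

lemma Cn_on_ident: "Cn_on k (\<lambda>x. x) I"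
  by (cases k) (auto intro!: exI[of _ "\<lambda>_. 1"] Cn_on_const derivative_eq_intros)

lemma Cn_on_add: "Cn_on k f I \<Longrightarrow> Cn_on k g I \<Longrightarrow> Cn_on k (\<lambda>x. f x + g x) I"
proof (induction k arbitrary: f g)
  case 0
  then show ?case by (auto intro!: continuous_intros)
next
  case (Suc k)
  then obtain f' g' where "\<forall>x\<in>I. (f has_real_derivative f' x) (at x)" "Cn_on k f' I"
    "\<forall>x\<in>I. (g has_real_derivative g' x) (at x)" "Cn_on k g' I" by auto
  then show ?case using Suc.IH[of f' g']
    by (auto intro!: exI[of _ "\<lambda>x. f' x + g' x"] derivative_eq_intros)
qed

lemma Cn_on_mult: "Cn_on k f I \<Longrightarrow> Cn_on k g I \<Longrightarrow> Cn_on k (\<lambda>x. f x * g x) I"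
proof (induction k arbitrary: f g)
  case 0
  then show ?case by (auto intro!: continuous_intros)
next
  case (Suc k)
  then obtain f' g' where *: "\<forall>x\<in>I. (f has_real_derivative f' x) (at x)" "Cn_on k f' I"
    "\<forall>x\<in>I. (g has_real_derivative g' x) (at x)" "Cn_on k g' I" by auto
  have "Cn_on k (\<lambda>x. f' x * g x + g' x * f x) I"
    by (intro Cn_on_add Suc.IH * Suc.prems[THEN Cn_on_lower])
  moreover have "\<forall>x\<in>I. ((\<lambda>x. f x * g x) has_real_derivative f' x * g x + g' x * f x) (at x)"
    using * by (auto intro!: DERIV_mult)
  ultimately show ?case by auto
qed

lemma Cn_on_compose:
  "Cn_on k f J \<Longrightarrow> Cn_on k g I \<Longrightarrow> g ` I \<subseteq> J \<Longrightarrow> Cn_on k (\<lambda>x. f (g x)) I"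
proof (induction k arbitrary: f g)
  case 0
  then show ?case using continuous_on_compose2 by auto
next
  case (Suc k)
  then obtain f' g' where *: "\<forall>x\<in>J. (f has_real_derivative f' x) (at x)" "Cn_on k f' J"
    "\<forall>x\<in>I. (g has_real_derivative g' x) (at x)" "Cn_on k g' I" by auto
  have "Cn_on k (\<lambda>x. f' (g x) * g' x) I"
    by (rule Cn_on_mult[OF Suc.IH[OF *(2) Suc.prems(2)[THEN Cn_on_lower] Suc.prems(3)] *(4)])
  moreover have "\<forall>x\<in>I. ((\<lambda>x. f (g x)) has_real_derivative f' (g x) * g' x) (at x)"
    using * Suc.prems(3) by (auto intro!: DERIV_chain2[of f])
  ultimately show ?case by auto
qed

lemma Cn_on_inverse: "Cn_on k inverse (- {0})"
proof (induction k)
  case 0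
  then show ?case by (auto intro!: continuous_intros)
next
  case (Suc k)
  have "Cn_on k (\<lambda>x. - 1 * (inverse x * inverse x)) (- {0})"
    by (intro Cn_on_mult Cn_on_const Suc)
  moreover have "\<forall>x\<in>- {0}. (inverse has_real_derivative - 1 * (inverse x * inverse x)) (at x)"
    by (auto intro!: derivative_eq_intros simp: power2_eq_square)
  ultimately show ?case by (rule Cn_on_SucI[rotated])
qed

lemma Cn_on_sqrt: "Cn_on k sqrt {0<..}"
proof (induction k)
  case 0
  then show ?case by (auto intro!: continuous_intros)
next
  case (Suc k)
  have "Cn_on k (\<lambda>x. inverse (sqrt x) * (1/2)) {0<..}"
    by (rule Cn_on_mult[OF Cn_on_compose[OF Cn_on_inverse Suc] Cn_on_const]) auto
  moreover have "\<forall>x\<in>{0<..}. (sqrt has_real_derivative inverse (sqrt x) * (1/2)) (at x)"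
    by (auto intro!: derivative_eq_intros)
  ultimately show ?case by (rule Cn_on_SucI[rotated])
qed

lemma Cinf_on_continuous: "Cinf_on g I \<Longrightarrow> continuous_on I g"
  by (metis Cinf_on_def Cn_on.simps(1))

lemma Cinf_on_const: "Cinf_on (\<lambda>x. c) I"
  by (simp add: Cinf_on_def Cn_on_const)

lemma Cinf_on_add: "Cinf_on f I \<Longrightarrow> Cinf_on g I \<Longrightarrow> Cinf_on (\<lambda>x. f x + g x) I"
  by (simp add: Cinf_on_def Cn_on_add)

lemma Cinf_on_mult: "Cinf_on f I \<Longrightarrow> Cinf_on g I \<Longrightarrow> Cinf_on (\<lambda>x. f x * g x) I"
  by (simp add: Cinf_on_def Cn_on_mult)

lemma Cinf_on_power2: "Cinf_on f I \<Longrightarrow> Cinf_on (\<lambda>x. (f x)\<^sup>2) I"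
  by (simp add: Cinf_on_mult power2_eq_square)

lemma Cinf_on_diff: "Cinf_on f I \<Longrightarrow> Cinf_on g I \<Longrightarrow> Cinf_on (\<lambda>x. f x - g x) I"
  using Cinf_on_add[OF _ Cinf_on_mult[OF Cinf_on_const[of "-1"]], of f I g] by simp

lemma Cinf_on_compose:
  "Cinf_on f J \<Longrightarrow> Cinf_on g I \<Longrightarrow> (\<And>x. x \<in> I \<Longrightarrow> g x \<in> J) \<Longrightarrow> Cinf_on (\<lambda>x. f (g x)) I"
  unfolding Cinf_on_def by (metis Cn_on_compose image_subsetI)

lemma Cinf_on_divide:
  assumes "Cinf_on f I" "Cinf_on g I" "\<And>x. x \<in> I \<Longrightarrow> g x \<noteq> 0"
  shows "Cinf_on (\<lambda>x. f x / g x) I"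
  unfolding divide_inverse
  by (rule Cinf_on_mult[OF assms(1) Cinf_on_compose[of inverse "- {0}"]])
    (use assms in \<open>auto simp: Cinf_on_def Cn_on_inverse\<close>)

lemma Cinf_on_sqrt:
  assumes "Cinf_on g I" "\<And>x. x \<in> I \<Longrightarrow> g x > 0"
  shows "Cinf_on (\<lambda>x. sqrt (g x)) I"
  by (rule Cinf_on_compose[of sqrt "{0<..}"]) (use assms in \<open>auto simp: Cinf_on_def Cn_on_sqrt\<close>)

text \<open>Functions known only through an integral or an inverse, such as polar angles and the change
  of parameter, get their smoothness from this.\<close>

lemma Cinf_on_antiderivative:
  assumes "\<And>x. x \<in> I \<Longrightarrow> (g has_real_derivative g' x) (at x)" "Cinf_on g' I"
  shows "Cinf_on g I"
  unfolding Cinf_on_def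
proof
  fix k
  have "Cn_on (Suc k) g I" using assms by (auto simp: Cinf_on_def)
  then show "Cn_on k g I" by (rule Cn_on_lower)
qed

lemma Cinf_on_derivative:
  assumes "Cinf_on g I" "open I"
  obtains g' where "\<And>x. x \<in> I \<Longrightarrow> (g has_real_derivative g' x) (at x)" "Cinf_on g' I"
proof
  have ex: "\<exists>h. (\<forall>x\<in>I. (g has_real_derivative h x) (at x)) \<and> Cn_on k h I" for k
    using assms by (metis Cinf_on_def Cn_on.simps(2))
  show d: "(g has_real_derivative deriv g x) (at x)" if "x \<in> I" for x
    using ex[of 0] that by (metis DERIV_imp_deriv)
  show "Cinf_on (deriv g) I"
    unfolding Cinf_on_def
  proof
    fix k
    obtain h where h: "\<forall>x\<in>I. (g has_real_derivative h x) (at x)" "Cn_on k h I" using ex by blast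
    show "Cn_on k (deriv g) I"
      by (rule Cn_on_cong[OF h(2) assms(2)]) (use h(1) in \<open>auto intro: DERIV_imp_deriv\<close>)
  qed
qed

lemma Cinf_on_arsinh:
  assumes "Cinf_on g I"
  shows "Cinf_on (\<lambda>x. arsinh (g x)) I"
proof (rule Cinf_on_compose[of arsinh UNIV])
  show "Cinf_on (arsinh :: real \<Rightarrow> real) UNIV"
  proof (rule Cinf_on_antiderivative)
    show "(arsinh has_real_derivative 1 / sqrt (x\<^sup>2 + 1)) (at x)" for x :: real
      by (rule arsinh_real_has_field_derivative)
    show "Cinf_on (\<lambda>x. 1 / sqrt (x\<^sup>2 + 1)) UNIV"
      by (intro Cinf_on_divide Cinf_on_const Cinf_on_sqrt Cinf_on_add Cinf_on_power2)
        (auto simp: Cinf_on_def Cn_on_ident add_nonneg_eq_0_iff add_nonneg_pos)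
  qed
qed (use assms in auto)

section \<open>Functions on an interval\<close>

lemma interval_integral_has_derivative:
  fixes g :: "real \<Rightarrow> real"
  assumes "open I" "is_interval I" "c \<in> I" "x \<in> I" "continuous_on I g"
  shows "((\<lambda>u. LBINT t=ereal c..ereal u. g t) has_real_derivative g x) (at x)"
proof -
  obtain e where e: "e > 0" "cball c e \<subseteq> I"
    using assms(1,3) open_contains_cball by metis
  obtain d where d: "d > 0" "cball x d \<subseteq> I"
    using assms(1,4) open_contains_cball by metis
  define a where "a = min (c - e) (x - d)"
  define b where "b = max (c + e) (x + d)"
  have "c - e \<in> I" "c + e \<in> I" "x - d \<in> I" "x + d \<in> I"
    using e d by (auto simp: subset_iff dist_real_def)
  then have "a \<in> I" "b \<in> I" by (auto simp: a_def b_def min_def max_def)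
  then have sub: "{a..b} \<subseteq> I"
    by (meson assms(2) atLeastAtMost_iff mem_is_interval_1_I subsetI)
  have "((\<lambda>u. LBINT t=ereal c..ereal u. g t) has_vector_derivative g x) (at x within {a..b})"
    using e d continuous_on_subset[OF assms(5) sub]
    by (intro interval_integral_FTC2) (auto simp: a_def b_def)
  moreover have "x \<in> interior {a..b}"
    using e d by (auto simp: a_def b_def)
  ultimately show ?thesis
    unfolding has_real_derivative_iff_has_vector_derivative by (metis at_within_interior)
qed

text \<open>The normal field, the profile and its parameter are each determined only up to a sign at
  every point; the quotient of the two functions is continuous with values \<open>1\<close> and \<open>-1\<close>, hence constant
  on a connected set.\<close>

lemma equal_squares_imp_constant_sign:
  fixes g k :: "'a::topological_space \<Rightarrow> real"
  assumes "connected I" "continuous_on I g" "continuous_on I k"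
    and "\<And>x. x \<in> I \<Longrightarrow> (g x)\<^sup>2 = (k x)\<^sup>2" "\<And>x. x \<in> I \<Longrightarrow> k x \<noteq> 0"
  obtains \<epsilon> :: real where "\<epsilon>\<^sup>2 = 1" "\<And>x. x \<in> I \<Longrightarrow> g x = \<epsilon> * k x"
proof -
  have sq: "(g x / k x)\<^sup>2 = 1" if "x \<in> I" for x
    using assms(4,5)[OF that] by (simp add: power_divide)
  have "(\<lambda>x. g x / k x) constant_on I"
  proof (rule continuous_finite_range_constant[OF assms(1)])
    show "continuous_on I (\<lambda>x. g x / k x)"
      using assms by (auto intro!: continuous_intros)
    have "(\<lambda>x. g x / k x) ` I \<subseteq> {1, -1}"
      using sq unfolding power2_eq_1_iff by blast
    then show "finite ((\<lambda>x. g x / k x) ` I)" by (rule finite_subset) simp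
  qed
  then obtain \<delta> where \<delta>: "\<And>x. x \<in> I \<Longrightarrow> g x / k x = \<delta>"
    by (auto simp: constant_on_def)
  show ?thesis
  proof (cases "I = {}")
    case True
    then show ?thesis using that[of 1] by simp
  next
    case False
    then obtain y where "y \<in> I" by blast
    then have "\<delta>\<^sup>2 = 1" using \<delta> sq by metis
    moreover have "g x = \<delta> * k x" if "x \<in> I" for x
      using \<delta>[OF that] assms(5)[OF that] by (simp add: field_simps)
    ultimately show ?thesis by (rule that)
  qed
qed

lemma zero_derivative_imp_constant:
  fixes g :: "real \<Rightarrow> real"
  assumes "is_interval I" "\<And>x. x \<in> I \<Longrightarrow> (g has_real_derivative 0) (at x)"
  obtains c where "\<And>x. x \<in> I \<Longrightarrow> g x = c"
proof -
  have "\<exists>c. \<forall>x\<in>I. g x = c"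
    by (rule has_field_derivative_zero_constant)
      (use assms in \<open>simp_all add: is_interval_convex_1 has_field_derivative_at_within\<close>)
  then show ?thesis using that by blast
qed

text \<open>The sign \<open>\<epsilon>\<close> is kept apart because changes of parameter reverse the orientation in some cases.\<close>

lemma interval_reparametrisation:
  fixes \<tau> :: "real \<Rightarrow> real"
  assumes "open I" "is_interval I"
    and "\<And>x. x \<in> I \<Longrightarrow> (\<tau> has_real_derivative \<epsilon> * k x) (at x)"
    and "\<epsilon>\<^sup>2 = 1" "\<And>x. x \<in> I \<Longrightarrow> k x > 0"
  shows "inj_on \<tau> I" "open (\<tau> ` I)" "is_interval (\<tau> ` I)"
proof -
  have cont: "continuous_on I \<tau>"
    using assms(3) by (meson continuous_at_imp_continuous_on DERIV_isCont)
  have "\<tau> x \<noteq> \<tau> y" if "x \<in> I" "y \<in> I" "x < y" for x y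
  proof -
    have sub: "z \<in> I" if "x \<le> z" "z \<le> y" for z
      using mem_is_interval_1_I[OF assms(2) \<open>x \<in> I\<close> \<open>y \<in> I\<close> that] .
    obtain z where z: "x < z" "z < y" "\<tau> y - \<tau> x = (y - x) * (\<epsilon> * k z)"
      using MVT2[OF \<open>x < y\<close>, of \<tau> "\<lambda>z. \<epsilon> * k z"] assms(3) sub by metis
    have "k z > 0" "\<epsilon> \<noteq> 0" using assms(4,5) sub[of z] z by auto
    then show ?thesis using z by auto
  qed
  then show inj: "inj_on \<tau> I"
    by (metis inj_onI linorder_neqE_linordered_idom)
  show "open (\<tau> ` I)"
    using injective_eq_1d_open_map_UNIV[OF cont assms(2)] inj assms(1) by blast
  show "is_interval (\<tau> ` I)"
    using connected_continuous_image[OF cont] assms(2) by (simp add: is_interval_connected_1)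
qed


section \<open>Smooth maps of the parameter strip\<close>

lemma Ck_on_cong:
  "Ck_on k g D \<Longrightarrow> open D \<Longrightarrow> (\<And>x. x \<in> D \<Longrightarrow> f x = g x) \<Longrightarrow> Ck_on k f D"
proof (induction k arbitrary: f g)
  case 0
  then show ?case by (simp cong: continuous_on_cong)
next
  case (Suc k)
  have d: "(f has_derivative frechet_derivative g (at x)) (at x)" if "x \<in> D" for x
  proof (rule has_derivative_transform_within_open[OF _ \<open>open D\<close> that])
    show "(g has_derivative frechet_derivative g (at x)) (at x)"
      using Suc.prems(1) that by (simp add: frechet_derivative_works)
  qed (use Suc.prems(3) in simp)
  have "frechet_derivative f (at x) = frechet_derivative g (at x)" if "x \<in> D" for x
    by (rule frechet_derivative_at[OF d[OF that], symmetric])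
  moreover have "\<forall>x\<in>D. f differentiable (at x)"
    using d unfolding differentiable_def by blast
  ultimately show ?case
    using Suc.IH[of "\<lambda>x. frechet_derivative g (at x) b" "\<lambda>x. frechet_derivative f (at x) b" for b]
      Suc.prems(1,2) by simp
qed

lemma Ck_on_imp_Cn_on_slice:
  assumes "bounded_linear L"
  shows "Ck_on k f (I \<times> UNIV) \<Longrightarrow> Cn_on k (\<lambda>x. L (f (x, 0 :: real))) I"
proof (induction k arbitrary: f)
  case 0
  have "continuous_on I (\<lambda>x. f (x, 0))"
    by (rule continuous_on_compose2[of "I \<times> UNIV" f]) (use 0 in \<open>auto intro!: continuous_intros\<close>)
  then show ?case
    using bounded_linear.continuous_on[OF assms] by simp
next
  case (Suc k)
  have "((\<lambda>x. L (f (x, 0))) has_real_derivative L (frechet_derivative f (at (x, 0)) (1, 0))) (at x)"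
    if "x \<in> I" for x
  proof -
    let ?D = "frechet_derivative f (at (x, 0))"
    have f: "(f has_derivative ?D) (at (x, 0))"
      using Suc.prems that by (simp add: frechet_derivative_works)
    have "((\<lambda>x. (x, 0::real)) has_derivative (\<lambda>h. (h, 0))) (at x)"
      by (auto intro!: derivative_eq_intros)
    from bounded_linear.has_derivative[OF assms has_derivative_compose[OF this f]]
    have "((\<lambda>x. L (f (x, 0))) has_derivative (\<lambda>h. L (?D (h, 0)))) (at x)" .
    then show ?thesis
    proof (rule has_derivative_imp_has_field_derivative)
      fix h
      have "?D (h, 0) = h *\<^sub>R ?D (1, 0)"
        using linear_cmul[OF has_derivative_linear[OF f], of h "(1, 0)"] by simp
      then show "h * L (?D (1, 0)) = L (?D (h, 0))"
        by (simp add: linear_cmul[OF bounded_linear.linear[OF assms]])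
    qed
  qed
  moreover have "Cn_on k (\<lambda>x. L (frechet_derivative f (at (x, 0)) (1, 0))) I"
    by (rule Suc.IH) (use Suc.prems in \<open>simp add: Basis_prod_def\<close>)
  ultimately show ?case by (intro Cn_on_SucI ballI)
qed

lemma has_derivative_first_coordinate:
  fixes u :: "real \<times> real"
  assumes "(g has_real_derivative g') (at (fst u))"
  shows "((\<lambda>u. g (fst u)) has_derivative (\<lambda>h. g' * fst h)) (at u)"
  using has_derivative_compose[of fst fst u UNIV g "\<lambda>h. g' * h"] assms
  by (simp add: has_field_derivative_def has_derivative_fst[OF has_derivative_ident])

lemma has_derivative_shear:
  fixes u :: "real \<times> real"
  assumes "(a has_real_derivative a') (at (fst u))" "(b has_real_derivative b') (at (fst u))"
  shows "((\<lambda>(x, \<theta>). (a x, c * \<theta> + b x)) has_derivative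
    (\<lambda>h. (a' * fst h, c * snd h + b' * fst h))) (at u)"
proof -
  show ?thesis
    unfolding case_prod_beta
    by (rule has_derivative_Pair has_derivative_add has_derivative_first_coordinate[OF assms(1)]
        has_derivative_first_coordinate[OF assms(2)]
        has_derivative_mult_right has_derivative_snd has_derivative_ident)+
qed

text \<open>The factor \<open>c\<close> is what makes the induction work: both partial derivatives of such a map are
  again of this form, with \<open>c\<close> replaced by \<open>0\<close>.\<close>

lemma Ck_on_shear:
  "open I \<Longrightarrow> Cn_on k a I \<Longrightarrow> Cn_on k b I \<Longrightarrow>
    Ck_on k (\<lambda>(x, \<theta>). (a x, c * \<theta> + b x)) (I \<times> UNIV)"
proof (induction k arbitrary: a b c)
  case 0
  have "continuous_on (I \<times> (UNIV::real set)) (\<lambda>u. g (fst u))" if "continuous_on I g" for g :: "real \<Rightarrow> real"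
    by (rule continuous_on_compose2[OF that]) (auto intro!: continuous_intros)
  with 0 show ?case by (auto simp: case_prod_beta intro!: continuous_intros)
next
  case (Suc k)
  let ?f = "\<lambda>(x, \<theta>). (a x, c * \<theta> + b x)"
  obtain a' b' where *: "\<forall>x\<in>I. (a has_real_derivative a' x) (at x)" "Cn_on k a' I"
    "\<forall>x\<in>I. (b has_real_derivative b' x) (at x)" "Cn_on k b' I" using Suc.prems by auto
  have d: "(?f has_derivative (\<lambda>h. (a' (fst u) * fst h, c * snd h + b' (fst u) * fst h))) (at u)"
    if "u \<in> I \<times> UNIV" for u :: "real \<times> real"
    by (rule has_derivative_shear) (use * that in auto)
  have fd: "frechet_derivative ?f (at u) = (\<lambda>h. (a' (fst u) * fst h, c * snd h + b' (fst u) * fst h))"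
    if "u \<in> I \<times> UNIV" for u :: "real \<times> real"
    by (rule frechet_derivative_at[OF d[OF that], symmetric])
  have op: "open (I \<times> (UNIV :: real set))" using Suc.prems(1) by (simp add: open_Times)
  have "Ck_on k (\<lambda>u. frechet_derivative ?f (at u) (1, 0)) (I \<times> UNIV)"
    by (rule Ck_on_cong[OF Suc.IH[OF Suc.prems(1) *(2) *(4), of 0] op]) (auto simp: fd)
  moreover have "Ck_on k (\<lambda>u. frechet_derivative ?f (at u) (0, 1)) (I \<times> UNIV)"
    by (rule Ck_on_cong[OF Suc.IH[OF Suc.prems(1) Cn_on_const[of k 0] Cn_on_const[of k c], of 0] op])
      (auto simp: fd)
  ultimately show ?case
    using d unfolding Ck_on.simps differentiable_def by (auto simp: Basis_prod_def)
qed

lemma reparametrisation_shear: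
  assumes "open I" "Cinf_on \<tau> I" "Cinf_on b I" "inj_on \<tau> I"
    and "\<And>x. x \<in> I \<Longrightarrow> (\<tau> has_real_derivative \<tau>' x) (at x)" "\<And>x. x \<in> I \<Longrightarrow> \<tau>' x \<noteq> 0"
  shows "reparametrisation (\<lambda>(x, \<theta>). (\<tau> x, \<theta> + b x)) (I \<times> UNIV) (\<tau> ` I \<times> UNIV)"
    (is "reparametrisation ?\<Phi> _ _")
  unfolding reparametrisation_def
proof (intro conjI ballI)
  have "(\<lambda>(x, \<theta>). (\<tau> x, 1 * \<theta> + b x)) = ?\<Phi>" by (simp add: fun_eq_iff)
  note shear = Ck_on_shear[where c = 1 and a = \<tau> and b = b, unfolded this]
    has_derivative_shear[where c = 1 and a = \<tau> and b = b, unfolded this]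
  show "smooth_on ?\<Phi> (I \<times> UNIV)"
    unfolding smooth_on_def using shear(1) assms(1-3) by (auto simp: Cinf_on_def)
  show "bij_betw ?\<Phi> (I \<times> UNIV) (\<tau> ` I \<times> UNIV)"
    unfolding bij_betw_def
  proof
    show "inj_on ?\<Phi> (I \<times> UNIV)"
      using assms(4) by (auto simp: inj_on_def)
    have "(\<tau> x, t) \<in> ?\<Phi> ` (I \<times> UNIV)" if "x \<in> I" for x t
      using that by (intro image_eqI[of _ _ "(x, t - b x)"]) auto
    then show "?\<Phi> ` (I \<times> UNIV) = \<tau> ` I \<times> UNIV" by auto
  qed
  fix u :: "real \<times> real" assume u: "u \<in> I \<times> UNIV"
  obtain b' where b': "\<And>x. x \<in> I \<Longrightarrow> (b has_real_derivative b' x) (at x)"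
    using Cinf_on_derivative[OF assms(3,1)] by metis
  have fd: "frechet_derivative ?\<Phi> (at u) = (\<lambda>h. (\<tau>' (fst u) * fst h, 1 * snd h + b' (fst u) * fst h))"
    by (rule frechet_derivative_at[symmetric], rule shear(2)) (use u assms(5) b' in auto)
  show "inj (frechet_derivative ?\<Phi> (at u))"
    unfolding fd using assms(6)[of "fst u"] u by (auto simp: inj_on_def prod_eq_iff)
qed

section \<open>Lorentzian linear algebra\<close>

lemma mink_simps:
  "mink (x + y) z = mink x z + mink y z" "mink z (x + y) = mink z x + mink z y"
  "mink (x - y) z = mink x z - mink y z" "mink z (x - y) = mink z x - mink z y"
  "mink (c *\<^sub>R x) z = c * mink x z" "mink z (c *\<^sub>R x) = c * mink z x"
  "mink (- x) z = - mink x z" "mink z (- x) = - mink z x"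
  by (simp_all add: mink_def algebra_simps)

lemma mink_commute: "mink x y = mink y x"
  by (simp add: mink_def algebra_simps)

lemma bounded_linear_mink: "bounded_linear (\<lambda>x. mink x y)"
  by (simp add: linear_conv_bounded_linear[symmetric] linear_iff mink_simps)

lemma forall_index4: "(\<forall>i::4. P i) \<longleftrightarrow> P 0 \<and> P 1 \<and> P 2 \<and> P 3"
proof -
  have "(4::4) = 0" by simp
  show ?thesis unfolding forall_4 \<open>4 = 0\<close> by blast
qed

lemma sum_index4: "sum f (UNIV :: 4 set) = f 0 + f 1 + f 2 + f 3"
proof -
  have "(4::4) = 0" by simp
  show ?thesis unfolding sum_4 \<open>4 = 0\<close> by (simp only: add_ac)
qed

lemma vec_eq_index4: "x = y \<longleftrightarrow> x$0 = y$0 \<and> x$1 = y$1 \<and> x$2 = y$2 \<and> x$3 = y$3" for x y :: "real^4"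
  by (simp add: vec_eq_iff forall_index4)

lemma spatial_Cauchy_Schwarz:
  "(x$1 * y$1 + x$2 * y$2 + x$3 * y$3)\<^sup>2 \<le>
    ((x$1)\<^sup>2 + (x$2)\<^sup>2 + (x$3)\<^sup>2) * ((y$1)\<^sup>2 + (y$2)\<^sup>2 + (y$3)\<^sup>2)" for x y :: "real^4"
proof -
  have "((x$1)\<^sup>2 + (x$2)\<^sup>2 + (x$3)\<^sup>2) * ((y$1)\<^sup>2 + (y$2)\<^sup>2 + (y$3)\<^sup>2)
      - (x$1 * y$1 + x$2 * y$2 + x$3 * y$3)\<^sup>2
    = (x$1 * y$2 - x$2 * y$1)\<^sup>2 + (x$1 * y$3 - x$3 * y$1)\<^sup>2 + (x$2 * y$3 - x$3 * y$2)\<^sup>2"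
    by (simp add: power2_eq_square algebra_simps)
  moreover have "\<dots> \<ge> 0" by simp
  ultimately show ?thesis by linarith
qed

text \<open>If \<open>x\<close> were not spacelike, the Cauchy-Schwarz inequality for the spatial parts would force its
  time component, and then all of \<open>x\<close>, to vanish.\<close>

lemma timelike_orthogonal_imp_spacelike:
  assumes "mink y y = -1" "mink x y = 0" "x \<noteq> 0"
  shows "mink x x > 0"
proof (rule ccontr)
  assume n: "\<not> mink x x > 0"
  define X where "X = (x$1)\<^sup>2 + (x$2)\<^sup>2 + (x$3)\<^sup>2"
  define Y where "Y = (y$1)\<^sup>2 + (y$2)\<^sup>2 + (y$3)\<^sup>2"
  have X: "X \<le> (x$0)\<^sup>2" "X \<ge> 0" using n by (simp_all add: mink_def X_def power2_eq_square)
  have Y: "(y$0)\<^sup>2 = 1 + Y" "Y \<ge> 0"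
    using assms(1) by (simp_all add: mink_def Y_def power2_eq_square)
  have "x$0 * y$0 = x$1 * y$1 + x$2 * y$2 + x$3 * y$3"
    using assms(2) by (simp add: mink_def)
  then have "(x$0)\<^sup>2 * (y$0)\<^sup>2 \<le> X * Y"
    using spatial_Cauchy_Schwarz[of x y] by (metis X_def Y_def power_mult_distrib)
  also have "\<dots> \<le> (x$0)\<^sup>2 * Y" using X Y by (simp add: mult_right_mono)
  finally have "(x$0)\<^sup>2 \<le> 0" using Y by (simp add: algebra_simps)
  then have "x$0 = 0" by simp
  with X have "X = 0" by simp
  then have "x$1 = 0" "x$2 = 0" "x$3 = 0"
    unfolding X_def by (simp_all add: add_nonneg_eq_0_iff)
  with \<open>x$0 = 0\<close> assms(3) show False by (simp add: vec_eq_index4)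
qed

text \<open>By Cauchy-Schwarz the time components dominate the product of two timelike unit vectors.\<close>

lemma mink_timelike_neg_iff:
  assumes "mink x x = -1" "mink y y = -1"
  shows "mink x y < 0 \<longleftrightarrow> x$0 * y$0 > 0"
proof -
  define X where "X = (x$1)\<^sup>2 + (x$2)\<^sup>2 + (x$3)\<^sup>2"
  define Y where "Y = (y$1)\<^sup>2 + (y$2)\<^sup>2 + (y$3)\<^sup>2"
  define s where "s = x$1 * y$1 + x$2 * y$2 + x$3 * y$3"
  have X: "(x$0)\<^sup>2 = 1 + X" "X \<ge> 0" "(y$0)\<^sup>2 = 1 + Y" "Y \<ge> 0"
    using assms by (simp_all add: mink_def X_def Y_def power2_eq_square)
  have "s\<^sup>2 \<le> X * Y" using spatial_Cauchy_Schwarz[of x y] by (simp add: X_def Y_def s_def)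
  also have "\<dots> < (1 + X) * (1 + Y)" using X by (simp add: algebra_simps)
  also have "\<dots> = (x$0 * y$0)\<^sup>2" using X by (simp add: power_mult_distrib)
  finally have "\<bar>s\<bar> < \<bar>x$0 * y$0\<bar>"
    by (metis abs_le_square_iff linorder_not_le)
  moreover have "mink x y = s - x$0 * y$0" by (simp add: mink_def s_def)
  ultimately show ?thesis by linarith
qed

lemma orthonormal_basis_iff:
  "orthonormal_basis e \<longleftrightarrow>
    mink (e 0) (e 0) = -1 \<and> mink (e 1) (e 1) = 1 \<and> mink (e 2) (e 2) = 1 \<and> mink (e 3) (e 3) = 1 \<and>
    mink (e 0) (e 1) = 0 \<and> mink (e 0) (e 2) = 0 \<and> mink (e 0) (e 3) = 0 \<and>
    mink (e 1) (e 2) = 0 \<and> mink (e 1) (e 3) = 0 \<and> mink (e 2) (e 3) = 0"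
  unfolding orthonormal_basis_def forall_index4 using mink_commute by auto

text \<open>Orthonormality says that the matrix of the basis has a right inverse; for a square matrix this
  is also a left inverse, which is the expansion formula.\<close>

lemma orthonormal_expansion:
  assumes "orthonormal_basis e"
  shows "w = - mink w (e 0) *\<^sub>R e 0 + mink w (e 1) *\<^sub>R e 1 + mink w (e 2) *\<^sub>R e 2 + mink w (e 3) *\<^sub>R e 3"
proof -
  define J :: "4 \<Rightarrow> real" where "J i = (if i = 0 then -1 else 1)" for i
  have mink: "mink x y = (\<Sum>k\<in>UNIV. J k * x$k * y$k)" for x y
    by (simp add: mink_def sum_index4 J_def)
  define A :: "real^4^4" where "A = (\<chi> i j. e i $ j)"
  define B :: "real^4^4" where "B = (\<chi> j i. J j * e i $ j * J i)"
  have "(A ** B) $ i $ l = mat 1 $ i $ l" for i l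
  proof -
    have "(A ** B) $ i $ l = (\<Sum>j\<in>UNIV. e i $ j * (J j * e l $ j * J l))"
      by (simp add: matrix_matrix_mult_def A_def B_def)
    also have "\<dots> = mink (e i) (e l) * J l"
      by (simp add: mink sum_distrib_left mult_ac)
    also have "\<dots> = mat 1 $ i $ l"
      using assms by (auto simp: orthonormal_basis_def J_def mat_def)
    finally show ?thesis .
  qed
  then have "A ** B = mat 1" by (simp add: vec_eq_iff)
  then have "B ** A = mat 1" by (simp add: matrix_left_right_inverse)
  then have BA: "(\<Sum>i\<in>UNIV. J j * e i $ j * J i * e i $ k) = (if j = k then 1 else 0)" for j k
    by (simp add: vec_eq_iff matrix_matrix_mult_def A_def B_def mat_def)
  have "w $ k = (\<Sum>i\<in>UNIV. J i * mink w (e i) * e i $ k)" for k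
  proof -
    have "w $ k = (\<Sum>j\<in>UNIV. w $ j * (\<Sum>i\<in>UNIV. J j * e i $ j * J i * e i $ k))"
      by (simp add: BA if_distrib cong: if_cong)
    also have "\<dots> = (\<Sum>i\<in>UNIV. \<Sum>j\<in>UNIV. w $ j * (J j * e i $ j * J i * e i $ k))"
      by (simp add: sum_distrib_left, rule sum.swap)
    also have "\<dots> = (\<Sum>i\<in>UNIV. J i * mink w (e i) * e i $ k)"
      by (simp add: mink sum_distrib_left sum_distrib_right mult_ac)
    finally show ?thesis .
  qed
  then show ?thesis by (simp add: vec_eq_iff sum_index4 J_def)
qed

text \<open>The point \<open>y\<close> of hyperbolic space provides the timelike direction: its projection away from
  \<open>a\<close> and \<open>b\<close> remains timelike. The last vector exists for dimension reasons.\<close>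

lemma extend_to_orthonormal_basis:
  assumes "mink a a = 1" "mink b b = 1" "mink a b = 0" "y \<in> hyp3"
  obtains e where "orthonormal_basis e" "e 2 = a" "e 3 = b" "e 0 $ 0 > 0"
proof -
  define \<alpha> where "\<alpha> = mink y a"
  define \<beta> where "\<beta> = mink y b"
  define n where "n = sqrt (1 + \<alpha>\<^sup>2 + \<beta>\<^sup>2)"
  have n: "n > 0" "n * n = 1 + \<alpha>\<^sup>2 + \<beta>\<^sup>2"
    by (simp_all add: n_def add_pos_nonneg)
  have y: "mink y y = -1" "y $ 0 > 0" using assms(4) by (auto simp: hyp3_def)
  define e0 where "e0 = (1 / n) *\<^sub>R (y - \<alpha> *\<^sub>R a - \<beta> *\<^sub>R b)"
  have c: "mink b a = 0" "mink a y = \<alpha>" "mink b y = \<beta>"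
    using assms(3) mink_commute by (auto simp: \<alpha>_def \<beta>_def)
  have e0: "mink e0 a = 0" "mink e0 b = 0"
    unfolding e0_def by (simp_all add: mink_simps assms c \<alpha>_def \<beta>_def)
  have "mink (y - \<alpha> *\<^sub>R a - \<beta> *\<^sub>R b) (y - \<alpha> *\<^sub>R a - \<beta> *\<^sub>R b) = - (n * n)"
    by (simp add: mink_simps assms c y n power2_eq_square flip: \<alpha>_def \<beta>_def)
  then have e00: "mink e0 e0 = -1"
    using n(1) unfolding e0_def mink_simps(5,6) by simp
  have "mink y (y - \<alpha> *\<^sub>R a - \<beta> *\<^sub>R b) = - (1 + \<alpha>\<^sup>2 + \<beta>\<^sup>2)"
    by (simp add: mink_simps y power2_eq_square flip: \<alpha>_def \<beta>_def)
  then have "mink y e0 = - (1 + \<alpha>\<^sup>2 + \<beta>\<^sup>2) / n"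
    unfolding e0_def mink_simps(6) by simp
  also have "\<dots> < 0" using n by (metis divide_less_0_iff mult_pos_pos neg_less_0_iff_less)
  finally have pos: "e0 $ 0 > 0"
    using mink_timelike_neg_iff[OF y(1) e00] y(2) by (simp add: zero_less_mult_iff)
  define j :: "real^4 \<Rightarrow> real^4" where "j x = (\<chi> i. if i = 0 then - x $ 0 else x $ i)" for x
  have j: "x \<bullet> j y = mink x y" for x y
    by (simp add: inner_vec_def sum_index4 j_def mink_def)
  have "dim {j e0, j a, j b} \<le> card {j e0, j a, j b}" by (rule dim_le_card') simp
  also have "\<dots> \<le> 3" by (simp add: card_insert_if)
  finally have "dim {j e0, j a, j b} < DIM(real^4)" by simp
  then obtain x where x: "x \<noteq> 0" "\<And>y. y \<in> span {j e0, j a, j b} \<Longrightarrow> orthogonal x y"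
    using orthogonal_to_subspace_exists by metis
  have xo: "mink x e0 = 0" "mink x a = 0" "mink x b = 0"
    using x(2)[OF span_base] by (auto simp: orthogonal_def simp flip: j)
  have xx: "mink x x > 0" by (rule timelike_orthogonal_imp_spacelike[OF e00 xo(1) x(1)])
  define e1 where "e1 = (1 / sqrt (mink x x)) *\<^sub>R x"
  have e1: "mink e1 e1 = 1" "mink e0 e1 = 0" "mink e1 a = 0" "mink e1 b = 0"
    using xx xo mink_commute[of e0 x] by (simp_all add: e1_def mink_simps)
  define e where "e i = (if i = 0 then e0 else if i = 1 then e1 else if i = 2 then a else b)" for i :: 4
  have "orthonormal_basis e"
    unfolding orthonormal_basis_iff e_def by (simp add: assms e0 e00 e1)
  then show ?thesis using pos by (intro that[of e]) (simp_all add: e_def)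
qed

text \<open>Adding a constant to \<open>h\<close> is a boost of the plane of \<open>e 0\<close> and \<open>e 1\<close>, changing its sign a
  reflection of \<open>e 1\<close>.\<close>

lemma rotation_param_boost:
  fixes \<epsilon> :: real
  assumes "orthonormal_basis e" "\<epsilon>\<^sup>2 = 1"
  obtains e' where "orthonormal_basis e'"
    "\<And>\<rho> h r \<psi> x y \<theta>. \<rho> x = r y \<Longrightarrow> h x = \<epsilon> * \<psi> y + c \<Longrightarrow>
      rotation_param e \<rho> h (x, \<theta>) = rotation_param e' r \<psi> (y, \<theta>)"
proof
  define e' :: "4 \<Rightarrow> real^4" where "e' i = (if i = 0 then cosh c *\<^sub>R e 0 + sinh c *\<^sub>R e 1
    else if i = 1 then \<epsilon> *\<^sub>R (sinh c *\<^sub>R e 0 + cosh c *\<^sub>R e 1) else e i)" for i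
  have [simp]: "e' 0 = cosh c *\<^sub>R e 0 + sinh c *\<^sub>R e 1"
    "e' 1 = \<epsilon> *\<^sub>R (sinh c *\<^sub>R e 0 + cosh c *\<^sub>R e 1)" "e' 2 = e 2" "e' 3 = e 3"
    by (simp_all add: e'_def)
  have ch: "cosh c * cosh c = 1 + sinh c * sinh c"
    using cosh_square_eq[of c] by (simp add: power2_eq_square)
  have ee: "\<epsilon> * \<epsilon> = 1" using assms(2) by (simp add: power2_eq_square)
  have o: "mink (e 0) (e 0) = -1" "mink (e 1) (e 1) = 1" "mink (e 2) (e 2) = 1" "mink (e 3) (e 3) = 1"
    "mink (e 0) (e 1) = 0" "mink (e 0) (e 2) = 0" "mink (e 0) (e 3) = 0"
    "mink (e 1) (e 2) = 0" "mink (e 1) (e 3) = 0" "mink (e 2) (e 3) = 0" "mink (e 1) (e 0) = 0"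
    using assms(1) mink_commute[of "e 1" "e 0"] unfolding orthonormal_basis_iff by auto
  have "\<epsilon> * (\<epsilon> * z) = z" for z using ee by (simp flip: mult.assoc)
  then show "orthonormal_basis e'"
    unfolding orthonormal_basis_iff by (simp add: mink_simps o ch ee algebra_simps)
  fix \<rho> h r \<psi> :: "real \<Rightarrow> real" and x y \<theta> :: real
  assume *: "\<rho> x = r y" "h x = \<epsilon> * \<psi> y + c"
  have "\<epsilon> = 1 \<or> \<epsilon> = -1" using assms(2) by (simp add: power2_eq_1_iff)
  then have h: "cosh (h x) = cosh (\<psi> y) * cosh c + \<epsilon> * sinh (\<psi> y) * sinh c"
    "sinh (h x) = \<epsilon> * sinh (\<psi> y) * cosh c + cosh (\<psi> y) * sinh c"
    by (auto simp: * cosh_add sinh_add)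
  show "rotation_param e \<rho> h (x, \<theta>) = rotation_param e' r \<psi> (y, \<theta>)"
    unfolding rotation_param_def case_prod_conv *(1)
    by (simp add: h algebra_simps)
qed


section \<open>Jacobi elliptic functions through the elliptic integral of the first kind\<close>

text \<open>The interval around \<open>0\<close> on which the integrand of the elliptic integral of the first kind is
  regular. For \<open>p = 1\<close> it ends at the poles of the integrand.\<close>

definition amplitude_domain :: "real \<Rightarrow> real set" where
  "amplitude_domain p = (if p < 1 then UNIV else {- (pi/2)<..<pi/2})"

definition ellipticF :: "real \<Rightarrow> real \<Rightarrow> real" where
  "ellipticF p \<phi> = (LBINT t=0..ereal \<phi>. 1 / sqrt (1 - p\<^sup>2 * (sin t)\<^sup>2))"

lemma amplitude_domain_props:
  "open (amplitude_domain p)" "is_interval (amplitude_domain p)" "0 \<in> amplitude_domain p"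
  by (auto simp: amplitude_domain_def is_interval_convex_1 convex_real_interval)

lemma amplitude_domain_pos:
  assumes "0 \<le> p" "p \<le> 1" "\<phi> \<in> amplitude_domain p"
  shows "p\<^sup>2 * (sin \<phi>)\<^sup>2 < 1"
proof (cases "p < 1")
  case True
  have "p\<^sup>2 * (sin \<phi>)\<^sup>2 \<le> p\<^sup>2 * 1"
    by (intro mult_left_mono) (auto simp: abs_square_le_1)
  also have "\<dots> < 1" using True assms(1) by (simp add: abs_square_less_1)
  finally show ?thesis .
next
  case False
  then have "cos \<phi> > 0" using assms by (auto simp: amplitude_domain_def intro: cos_gt_zero_pi)
  then have "(cos \<phi>)\<^sup>2 > 0" by simp
  then have "(sin \<phi>)\<^sup>2 < 1" using sin_cos_squared_add[of \<phi>] by linarith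
  then show ?thesis using assms False by simp
qed

text \<open>Thus the side condition in the definition of \<^const>\<open>jacobi_am\<close> describes this interval.\<close>

lemma amplitude_domain_iff:
  assumes "0 \<le> p" "p \<le> 1"
  shows "(\<forall>t\<in>closed_segment 0 \<phi>. p\<^sup>2 * (sin t)\<^sup>2 < 1) \<longleftrightarrow> \<phi> \<in> amplitude_domain p"
proof
  assume "\<phi> \<in> amplitude_domain p"
  then have "closed_segment 0 \<phi> \<subseteq> amplitude_domain p"
    using amplitude_domain_props[of p]
    by (simp add: closed_segment_subset is_interval_convex_1)
  then show "\<forall>t\<in>closed_segment 0 \<phi>. p\<^sup>2 * (sin t)\<^sup>2 < 1"
    using amplitude_domain_pos[OF assms] by blast
next
  assume *: "\<forall>t\<in>closed_segment 0 \<phi>. p\<^sup>2 * (sin t)\<^sup>2 < 1"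
  show "\<phi> \<in> amplitude_domain p"
  proof (rule ccontr)
    assume n: "\<phi> \<notin> amplitude_domain p"
    then have p: "p = 1" using assms by (auto simp: amplitude_domain_def split: if_splits)
    have "\<phi> \<ge> pi/2 \<or> \<phi> \<le> - (pi/2)"
      using n p by (auto simp: amplitude_domain_def)
    then have "pi/2 \<in> closed_segment 0 \<phi> \<or> - (pi/2) \<in> closed_segment 0 \<phi>"
      using pi_gt_zero by (auto simp: closed_segment_eq_real_ivl)
    then show False using * p by auto
  qed
qed

lemma ellipticF_0 [simp]: "ellipticF p 0 = 0"
  unfolding ellipticF_def zero_ereal_def by simp

lemma ellipticF_has_derivative:
  assumes "0 \<le> p" "p \<le> 1" "\<phi> \<in> amplitude_domain p"
  shows "(ellipticF p has_real_derivative 1 / sqrt (1 - p\<^sup>2 * (sin \<phi>)\<^sup>2)) (at \<phi>)"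
  unfolding ellipticF_def zero_ereal_def
proof (rule interval_integral_has_derivative[OF amplitude_domain_props assms(3)])
  show "continuous_on (amplitude_domain p) (\<lambda>t. 1 / sqrt (1 - p\<^sup>2 * (sin t)\<^sup>2))"
    using amplitude_domain_pos[OF assms(1,2)] by (fastforce intro!: continuous_intros)
qed

lemma ellipticF_image:
  assumes "0 \<le> p" "p \<le> 1"
  shows "inj_on (ellipticF p) (amplitude_domain p)"
    "open (ellipticF p ` amplitude_domain p)" "is_interval (ellipticF p ` amplitude_domain p)"
proof -
  have d: "(ellipticF p has_real_derivative 1 * (1 / sqrt (1 - p\<^sup>2 * (sin \<phi>)\<^sup>2))) (at \<phi>)"
    if "\<phi> \<in> amplitude_domain p" for \<phi>
    using ellipticF_has_derivative[OF assms that] by simp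
  have pos: "1 / sqrt (1 - p\<^sup>2 * (sin \<phi>)\<^sup>2) > 0" if "\<phi> \<in> amplitude_domain p" for \<phi>
    using amplitude_domain_pos[OF assms that] by simp
  have one: "(1::real)\<^sup>2 = 1" by simp
  show "inj_on (ellipticF p) (amplitude_domain p)"
    "open (ellipticF p ` amplitude_domain p)" "is_interval (ellipticF p ` amplitude_domain p)"
    by (rule interval_reparametrisation[OF amplitude_domain_props(1,2) d one pos]; assumption)+
qed

text \<open>Injectivity of the integral makes the description in \<^const>\<open>jacobi_am\<close> unique; existence is
  clear at arguments of this form, which are those met by the profile curves below.\<close>

lemma jacobi_am_ellipticF:
  assumes "0 \<le> p" "p \<le> 1" "\<phi> \<in> amplitude_domain p"
  shows "jacobi_am p (ellipticF p \<phi>) = \<phi>"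
  unfolding jacobi_am_def amplitude_domain_iff[OF assms(1,2)] ellipticF_def[symmetric]
  using inj_onD[OF ellipticF_image(1)[OF assms(1,2)]] assms(3) by (intro the_equality) auto

lemma jacobi_functions_ellipticF:
  assumes "0 \<le> p" "p \<le> 1" "\<phi> \<in> amplitude_domain p"
  shows "jacobi_sn p (ellipticF p \<phi>) = sin \<phi>" "jacobi_cn p (ellipticF p \<phi>) = cos \<phi>"
    "jacobi_dn p (ellipticF p \<phi>) = sqrt (1 - p\<^sup>2 * (sin \<phi>)\<^sup>2)"
    "jacobi_nc p (ellipticF p \<phi>) = 1 / cos \<phi>" "jacobi_sc p (ellipticF p \<phi>) = tan \<phi>"
  by (simp_all add: jacobi_sn_def jacobi_cn_def jacobi_dn_def jacobi_nc_def jacobi_sc_def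
      jacobi_am_ellipticF[OF assms] tan_def)

lemma continuous_on_jacobi_am:
  assumes "0 \<le> p" "p \<le> 1"
  shows "continuous_on (ellipticF p ` amplitude_domain p) (jacobi_am p)"
proof (rule continuous_at_imp_continuous_on, safe)
  fix \<phi> assume \<phi>: "\<phi> \<in> amplitude_domain p"
  have "continuous_on (amplitude_domain p) (ellipticF p)"
    using ellipticF_has_derivative[OF assms] by (meson continuous_at_imp_continuous_on DERIV_isCont)
  moreover have "((\<lambda>h. 1 / sqrt (1 - p\<^sup>2 * (sin \<phi>)\<^sup>2) * h) \<circ> (\<lambda>h. sqrt (1 - p\<^sup>2 * (sin \<phi>)\<^sup>2) * h)) = id"
    using amplitude_domain_pos[OF assms \<phi>] by (simp add: fun_eq_iff)
  moreover note ellipticF_has_derivative[OF assms \<phi>, unfolded has_field_derivative_def]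
  ultimately have "(jacobi_am p has_derivative (\<lambda>h. sqrt (1 - p\<^sup>2 * (sin \<phi>)\<^sup>2) * h)) (at (ellipticF p \<phi>))"
    using has_derivative_inverse_strong[OF amplitude_domain_props(1) \<phi>] jacobi_am_ellipticF[OF assms]
    by blast
  then show "isCont (jacobi_am p) (ellipticF p \<phi>)" by (rule has_derivative_continuous)
qed

lemma one_minus_sin_squared_pos: "k < 1 \<Longrightarrow> 1 - k * (sin \<phi>)\<^sup>2 > 0" for k \<phi> :: real
proof -
  assume "k < 1"
  have s: "0 \<le> (sin \<phi>)\<^sup>2" "(sin \<phi>)\<^sup>2 \<le> 1" by (auto simp: abs_square_le_1)
  show ?thesis
  proof (cases "k \<le> 0")
    case True
    then have "k * (sin \<phi>)\<^sup>2 \<le> 0" using s by (simp add: mult_nonpos_nonneg)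
    then show ?thesis by simp
  next
    case False
    then have "k * (sin \<phi>)\<^sup>2 \<le> k * 1" using s by (intro mult_left_mono) auto
    then show ?thesis using \<open>k < 1\<close> by simp
  qed
qed

text \<open>The segment from \<open>0\<close> to the endpoint stays in the image of the elliptic integral of the first
  kind, because this image is an interval, so the integrand is continuous along it.\<close>

lemma ellipticPi_has_derivative:
  assumes "0 \<le> p" "p \<le> 1" "\<phi> \<in> amplitude_domain p" "k < 1"
  shows "((\<lambda>s. ellipticPi k s p) has_real_derivative 1 / (1 - k * (sin \<phi>)\<^sup>2)) (at (ellipticF p \<phi>))"
proof -
  have "continuous_on (ellipticF p ` amplitude_domain p) (\<lambda>u. 1 / (1 - k * (jacobi_sn p u)\<^sup>2))"
    unfolding jacobi_sn_def
    using one_minus_sin_squared_pos[OF assms(4)] order_less_imp_not_eq2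
    by (intro continuous_intros continuous_on_jacobi_am assms) blast
  moreover have "0 \<in> ellipticF p ` amplitude_domain p"
    using amplitude_domain_props(3) by (metis ellipticF_0 image_eqI)
  moreover have "ellipticF p \<phi> \<in> ellipticF p ` amplitude_domain p" using assms(3) by blast
  ultimately have "((\<lambda>s. LBINT u=ereal 0..ereal s. 1 / (1 - k * (jacobi_sn p u)\<^sup>2))
      has_real_derivative 1 / (1 - k * (jacobi_sn p (ellipticF p \<phi>))\<^sup>2)) (at (ellipticF p \<phi>))"
    using interval_integral_has_derivative[OF ellipticF_image(2,3)[OF assms(1,2)]] by blast
  then show ?thesis
    unfolding ellipticPi_def zero_ereal_def by (simp add: jacobi_functions_ellipticF[OF assms(1-3)])
qed

section \<open>Matching a profile curve\<close>

text \<open>A rotational surface with profile curve \<open>(\<rho>, h)\<close> of speed \<open>v\<close>; \<open>q\<close> is the arc length derivative of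
  \<open>\<rho>\<close> and \<open>g\<close> is \<open>1 + \<rho>\<^sup>2\<close> times that of \<open>h\<close>. The last two assumptions are the first integral of the
  curvature equation, with constant of integration \<open>C\<close>.\<close>

locale rotational_cgc =
  fixes I :: "real set" and f :: "real \<times> real \<Rightarrow> real^4" and e :: "4 \<Rightarrow> real^4"
    and \<rho> h \<phi>0 q g v :: "real \<Rightarrow> real" and K C :: real
  assumes open_I: "open I" and interval_I: "is_interval I" and nonempty_I: "I \<noteq> {}"
    and basis: "orthonormal_basis e"
    and f_eq: "\<And>x \<theta>. x \<in> I \<Longrightarrow> f (x, \<theta>) = rotation_param e \<rho> h (x, \<theta> + \<phi>0 x)"
    and smooth_\<rho>: "Cinf_on \<rho> I" and smooth_v: "Cinf_on v I" and smooth_\<phi>0: "Cinf_on \<phi>0 I"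
    and \<rho>_pos: "\<And>x. x \<in> I \<Longrightarrow> \<rho> x > 0" and v_pos: "\<And>x. x \<in> I \<Longrightarrow> v x > 0"
    and \<rho>_deriv: "\<And>x. x \<in> I \<Longrightarrow> (\<rho> has_real_derivative q x * v x) (at x)"
    and q_deriv: "\<And>x. x \<in> I \<Longrightarrow> (q has_real_derivative (1 - K) * \<rho> x * v x) (at x)"
    and h_deriv: "\<And>x. x \<in> I \<Longrightarrow> (h has_real_derivative g x * v x / (1 + (\<rho> x)\<^sup>2)) (at x)"
    and g_cont: "continuous_on I g" and g_nz: "\<And>x. x \<in> I \<Longrightarrow> g x \<noteq> 0"
    and q_sq: "\<And>x. x \<in> I \<Longrightarrow> (q x)\<^sup>2 = (1 - K) * (\<rho> x)\<^sup>2 + C"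
    and g_sq: "\<And>x. x \<in> I \<Longrightarrow> (g x)\<^sup>2 = K * (\<rho> x)\<^sup>2 + 1 - C"
begin

abbreviation Q :: "real \<Rightarrow> real" where
  "Q x \<equiv> K * (\<rho> x)\<^sup>2 + 1 - C"

lemma continuous_\<rho>: "continuous_on I \<rho>" and continuous_v: "continuous_on I v"
  and continuous_q: "continuous_on I q"
  using smooth_\<rho> smooth_v Cinf_on_continuous q_deriv
  by (blast, blast, meson continuous_at_imp_continuous_on DERIV_isCont)

lemma Q_pos: "x \<in> I \<Longrightarrow> Q x > 0"
  using g_nz g_sq by (metis zero_less_power2)

text \<open>The functions \<open>h\<close> and \<open>\<psi> \<circ> \<tau>\<close> have derivatives with equal squares and without zeros. They
  therefore agree up to a sign and an additive constant, which the choice of the orthonormal basis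
  absorbs. The shear by \<open>\<phi>0\<close> makes up for meridians that are not planar.\<close>

lemma given_by_profile:
  fixes \<tau> \<tau>' r \<psi> :: "real \<Rightarrow> real"
  assumes \<tau>: "\<And>x. x \<in> I \<Longrightarrow> (\<tau> has_real_derivative \<tau>' x) (at x)" "continuous_on I \<tau>'"
    and \<tau>'_sq: "\<And>x. x \<in> I \<Longrightarrow> (\<tau>' x)\<^sup>2 * Q x = (v x)\<^sup>2"
    and r: "\<And>x. x \<in> I \<Longrightarrow> r (\<tau> x) = \<rho> x"
    and \<psi>: "\<And>x. x \<in> I \<Longrightarrow>
      (\<psi> has_real_derivative \<kappa> * (Q x / (1 + (\<rho> x)\<^sup>2))) (at (\<tau> x))"
    and \<kappa>: "\<kappa>\<^sup>2 = 1"
  shows "given_by I f r \<psi>"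
proof -
  define G where "G x = Q x" for x
  have G: "G x > 0" if "x \<in> I" for x using Q_pos[OF that] by (simp add: G_def)
  have conn: "connected I" using interval_I by (simp add: is_interval_connected_1)
  have smooth_speed: "Cinf_on (\<lambda>x. v x / sqrt (G x)) I"
    unfolding G_def
    by (intro Cinf_on_divide Cinf_on_sqrt Cinf_on_add Cinf_on_diff Cinf_on_mult Cinf_on_const
        Cinf_on_power2 smooth_v smooth_\<rho>) (use Q_pos in force)+
  have "(\<tau>' x)\<^sup>2 = (v x / sqrt (G x))\<^sup>2" "v x / sqrt (G x) \<noteq> 0" if "x \<in> I" for x
    using \<tau>'_sq[OF that] G[OF that] v_pos[OF that] by (simp_all add: power_divide eq_divide_eq flip: G_def)
  from equal_squares_imp_constant_sign[OF conn \<tau>(2) Cinf_on_continuous[OF smooth_speed] this]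
  obtain \<epsilon> where \<epsilon>: "\<epsilon>\<^sup>2 = 1" "\<And>x. x \<in> I \<Longrightarrow> \<tau>' x = \<epsilon> * (v x / sqrt (G x))" by blast
  have \<tau>_deriv: "(\<tau> has_real_derivative \<epsilon> * (v x / sqrt (G x))) (at x)" if "x \<in> I" for x
    using \<tau>(1)[OF that] \<epsilon>(2)[OF that] by simp
  have pos: "v x / sqrt (G x) > 0" if "x \<in> I" for x using v_pos G that by simp
  note J = interval_reparametrisation[OF open_I interval_I \<tau>_deriv \<epsilon>(1) pos]
  have smooth_\<tau>: "Cinf_on \<tau> I"
    by (rule Cinf_on_antiderivative[OF \<tau>_deriv Cinf_on_mult[OF Cinf_on_const smooth_speed]])
  define a where "a x = \<kappa> * (G x / (1 + (\<rho> x)\<^sup>2)) * (\<epsilon> * (v x / sqrt (G x)))" for x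
  have \<psi>\<tau>: "((\<lambda>x. \<psi> (\<tau> x)) has_real_derivative a x) (at x)" if "x \<in> I" for x
    unfolding a_def G_def by (rule DERIV_chain2[OF \<psi>[OF that] \<tau>_deriv[OF that, unfolded G_def]])
  have w: "1 + (\<rho> x)\<^sup>2 > 0" for x by (simp add: add_pos_nonneg)
  have "\<exists>\<delta>. \<delta>\<^sup>2 = 1 \<and> (\<forall>x\<in>I. g x * v x / (1 + (\<rho> x)\<^sup>2) = \<delta> * a x)"
  proof (rule equal_squares_imp_constant_sign[OF conn])
    show "continuous_on I (\<lambda>x. g x * v x / (1 + (\<rho> x)\<^sup>2))"
      using w by (intro continuous_intros g_cont continuous_v continuous_\<rho>) (metis less_irrefl)
    show "continuous_on I a"
      unfolding a_def G_def
      using w[THEN less_imp_neq] Q_pos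
      by (intro continuous_intros continuous_v continuous_\<rho>) (force dest!: Q_pos)+
    fix x assume x: "x \<in> I"
    have "(a x)\<^sup>2 = \<kappa>\<^sup>2 * \<epsilon>\<^sup>2 * (G x / (1 + (\<rho> x)\<^sup>2))\<^sup>2 * ((v x)\<^sup>2 / (sqrt (G x))\<^sup>2)"
      by (simp add: a_def power_mult_distrib power_divide)
    also have "\<dots> = (g x)\<^sup>2 * (v x)\<^sup>2 / (1 + (\<rho> x)\<^sup>2)\<^sup>2"
      unfolding \<kappa> \<epsilon>(1) g_sq[OF x, folded G_def] power_divide
      using G[OF x] by (simp add: power2_eq_square)
    finally show "(g x * v x / (1 + (\<rho> x)\<^sup>2))\<^sup>2 = (a x)\<^sup>2"
      by (simp add: power_mult_distrib power_divide)
    show "a x \<noteq> 0"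
      using G[OF x] v_pos[OF x] w[of x] \<kappa> \<epsilon>(1) by (auto simp: a_def)
  qed blast
  then obtain \<delta> where \<delta>: "\<delta>\<^sup>2 = 1" "\<And>x. x \<in> I \<Longrightarrow> g x * v x / (1 + (\<rho> x)\<^sup>2) = \<delta> * a x" by blast
  have "((\<lambda>x. h x - \<delta> * \<psi> (\<tau> x)) has_real_derivative 0) (at x)" if "x \<in> I" for x
    using DERIV_diff[OF h_deriv[OF that] DERIV_cmult[OF \<psi>\<tau>[OF that], of \<delta>]] \<delta>(2)[OF that] by simp
  from zero_derivative_imp_constant[OF interval_I this]
  obtain c where c: "\<And>x. x \<in> I \<Longrightarrow> h x - \<delta> * \<psi> (\<tau> x) = c" by blast
  obtain e' where e': "orthonormal_basis e'"
    "\<And>\<rho> h r \<psi> x y \<theta>. \<rho> x = r y \<Longrightarrow> h x = \<delta> * \<psi> y + c \<Longrightarrow>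
      rotation_param e \<rho> h (x, \<theta>) = rotation_param e' r \<psi> (y, \<theta>)"
    using rotation_param_boost[OF basis \<delta>(1)] by blast
  have rp: "rotation_param e \<rho> h (x, \<theta>) = rotation_param e' r \<psi> (\<tau> x, \<theta>)" if "x \<in> I" for x \<theta>
    using r[OF that] c[OF that] by (intro e'(2)) auto
  have "reparametrisation (\<lambda>(x, \<theta>). (\<tau> x, \<theta> + \<phi>0 x)) (I \<times> UNIV) (\<tau> ` I \<times> UNIV)"
    by (rule reparametrisation_shear[OF open_I smooth_\<tau> smooth_\<phi>0 J(1) \<tau>_deriv])
      (use pos \<epsilon>(1) in force)+
  moreover have "\<forall>u\<in>I \<times> UNIV. f u = rotation_param e' r \<psi> ((\<lambda>(x, \<theta>). (\<tau> x, \<theta> + \<phi>0 x)) u)"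
    by (auto simp: f_eq rp)
  ultimately show ?thesis
    unfolding given_by_def using e'(1) J(2,3) by blast
qed

text \<open>The change of parameter is \<open>\<tau> = F(\<phi>) / \<Xi>\<close>. As \<open>F' = 1 / sqrt (1 - p\<^sup>2 sin\<^sup>2 \<phi>)\<close> and the integrand of
  the integral of the third kind becomes \<open>1 / (1 - k sin\<^sup>2 \<phi>)\<close>, the differential equations for \<open>\<tau>\<close> and \<open>\<psi>\<close>
  turn into algebraic conditions on \<open>\<phi>\<close>.\<close>

lemma given_by_jacobi_profile:
  fixes \<phi> \<phi>' r \<psi> :: "real \<Rightarrow> real"
  assumes p: "0 \<le> p" "p \<le> 1" and \<Xi>: "\<Xi> > 0" and k: "k < 1"
    and \<phi>: "\<And>x. x \<in> I \<Longrightarrow> \<phi> x \<in> amplitude_domain p"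
      "\<And>x. x \<in> I \<Longrightarrow> (\<phi> has_real_derivative \<phi>' x) (at x)" "continuous_on I \<phi>'"
    and \<phi>'_sq: "\<And>x. x \<in> I \<Longrightarrow> (\<phi>' x)\<^sup>2 * Q x
      = \<Xi>\<^sup>2 * (1 - p\<^sup>2 * (sin (\<phi> x))\<^sup>2) * (v x)\<^sup>2"
    and \<psi>: "\<psi> = (\<lambda>s. a * ellipticPi k (\<Xi> * s) p + b * s)"
    and ab: "\<And>x. x \<in> I \<Longrightarrow> a * \<Xi> / (1 - k * (sin (\<phi> x))\<^sup>2) + b = - (Q x / (1 + (\<rho> x)\<^sup>2))"
    and r: "\<And>x. x \<in> I \<Longrightarrow> r (ellipticF p (\<phi> x) / \<Xi>) = \<rho> x"
  shows "given_by I f r \<psi>"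
proof (rule given_by_profile[where \<tau> = "\<lambda>x. ellipticF p (\<phi> x) / \<Xi>" and \<kappa> = "-1"
      and \<tau>' = "\<lambda>x. 1 / sqrt (1 - p\<^sup>2 * (sin (\<phi> x))\<^sup>2) * \<phi>' x / \<Xi>"])
  have \<phi>_cont: "continuous_on I \<phi>"
    using \<phi>(2) by (meson continuous_at_imp_continuous_on DERIV_isCont)
  note pos = amplitude_domain_pos[OF p \<phi>(1)]
  show "continuous_on I (\<lambda>x. 1 / sqrt (1 - p\<^sup>2 * (sin (\<phi> x))\<^sup>2) * \<phi>' x / \<Xi>)"
    by (intro continuous_intros \<phi>_cont \<phi>(3)) (use pos \<Xi> in force)+
  fix x assume x: "x \<in> I"
  show "((\<lambda>x. ellipticF p (\<phi> x) / \<Xi>) has_real_derivative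
      1 / sqrt (1 - p\<^sup>2 * (sin (\<phi> x))\<^sup>2) * \<phi>' x / \<Xi>) (at x)"
    by (intro DERIV_cdivide DERIV_chain2[OF ellipticF_has_derivative[OF p \<phi>(1)[OF x]] \<phi>(2)[OF x]])
  show "(1 / sqrt (1 - p\<^sup>2 * (sin (\<phi> x))\<^sup>2) * \<phi>' x / \<Xi>)\<^sup>2 * Q x = (v x)\<^sup>2"
    using \<phi>'_sq[OF x] pos[OF x] \<Xi> by (simp add: power_mult_distrib power_divide field_simps)
  have "((\<lambda>s. ellipticPi k s p) has_real_derivative 1 / (1 - k * (sin (\<phi> x))\<^sup>2))
      (at (\<Xi> * (ellipticF p (\<phi> x) / \<Xi>)))"
    using ellipticPi_has_derivative[OF p \<phi>(1)[OF x] k] \<Xi> by simp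
  moreover have "((\<lambda>s. \<Xi> * s) has_real_derivative \<Xi>) (at (ellipticF p (\<phi> x) / \<Xi>))"
    by (auto intro!: derivative_eq_intros)
  ultimately have "((\<lambda>s. ellipticPi k (\<Xi> * s) p) has_real_derivative 1 / (1 - k * (sin (\<phi> x))\<^sup>2) * \<Xi>)
      (at (ellipticF p (\<phi> x) / \<Xi>))"
    by (rule DERIV_chain2)
  moreover have "((\<lambda>s. b * s) has_real_derivative b) (at (ellipticF p (\<phi> x) / \<Xi>))"
    by (auto intro!: derivative_eq_intros)
  ultimately have "((\<lambda>s. a * ellipticPi k (\<Xi> * s) p + b * s) has_real_derivative
      a * (1 / (1 - k * (sin (\<phi> x))\<^sup>2) * \<Xi>) + b) (at (ellipticF p (\<phi> x) / \<Xi>))"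
    by (intro DERIV_add DERIV_cmult)
  moreover have "a * (1 / (1 - k * (sin (\<phi> x))\<^sup>2) * \<Xi>) + b
      = -1 * (Q x / (1 + (\<rho> x)\<^sup>2))"
    using ab[OF x] by (simp only: times_divide_eq_left times_divide_eq_right mult_1 mult_1_right mult_minus1)
  ultimately show "(\<psi> has_real_derivative -1 * (Q x / (1 + (\<rho> x)\<^sup>2)))
      (at (ellipticF p (\<phi> x) / \<Xi>))"
    unfolding \<psi> by (simp only:)
qed (use r in auto)

end


section \<open>Profiles given by Jacobi elliptic functions\<close>

text \<open>In each family \<open>R\<^sup>2\<close> is the absolute value of the zero, as a function of \<open>\<rho>\<^sup>2\<close>, of either
  \<open>P = (1 - K) \<rho>\<^sup>2 + C\<close> or \<open>Q = K \<rho>\<^sup>2 + 1 - C\<close>. The modulus \<open>p\<close> is obtained by solving the equation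
  between \<open>R\<close> and the coefficient of the Jacobi function in \<open>r\<close>, and \<open>\<Xi>\<close> then simplifies to the root
  of a polynomial in \<open>K\<close> and \<open>C\<close>. The substitutions by inverse trigonometric functions are recorded
  through the square of their derivative, which is all that the sign-free equation for \<open>\<phi>\<close> sees.\<close>

lemma square_less_one_bounds: "y\<^sup>2 < 1 \<Longrightarrow> - 1 < y" "y\<^sup>2 < 1 \<Longrightarrow> y < 1" for y :: real
  unfolding abs_square_less_1 by linarith+

lemma cos_arccos_square: "y\<^sup>2 < 1 \<Longrightarrow> cos (arccos y) = y"
  and sin_arcsin_square: "y\<^sup>2 < 1 \<Longrightarrow> sin (arcsin y) = y"
  and cos_arcsin_square: "y\<^sup>2 < 1 \<Longrightarrow> cos (arcsin y) = sqrt (1 - y\<^sup>2)"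
  using square_less_one_bounds[of y] by (simp_all add: cos_arcsin)

lemma combine_fractions:
  "X - Y * (t / (w + t)) = (X * w + (X - Y) * t) / (w + t)" if "w + t > 0" for X Y w t :: real
  using that by (simp add: divide_simps; simp add: algebra_simps)

lemma arccos_substitution:
  fixes u u' :: "real \<Rightarrow> real"
  assumes "\<And>x. x \<in> I \<Longrightarrow> (u x)\<^sup>2 < 1" "\<And>x. x \<in> I \<Longrightarrow> (u has_real_derivative u' x) (at x)"
    "continuous_on I u'"
  obtains \<phi>' where "\<And>x. x \<in> I \<Longrightarrow> ((\<lambda>x. arccos (u x)) has_real_derivative \<phi>' x) (at x)"
    "continuous_on I \<phi>'" "\<And>x. x \<in> I \<Longrightarrow> (\<phi>' x)\<^sup>2 = (u' x)\<^sup>2 / (1 - (u x)\<^sup>2)"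
proof
  have b: "- 1 < u x" "u x < 1" if "x \<in> I" for x
    using square_less_one_bounds[OF assms(1)[OF that]] by auto
  show "((\<lambda>x. arccos (u x)) has_real_derivative inverse (- sqrt (1 - (u x)\<^sup>2)) * u' x) (at x)" if "x \<in> I" for x
    by (rule DERIV_chain2[OF DERIV_arccos[OF b[OF that]] assms(2)[OF that]])
  have "continuous_on I u"
    using assms(2) by (meson continuous_at_imp_continuous_on DERIV_isCont)
  then show "continuous_on I (\<lambda>x. inverse (- sqrt (1 - (u x)\<^sup>2)) * u' x)"
    using assms(1,3) by (intro continuous_intros) force+
  show "(inverse (- sqrt (1 - (u x)\<^sup>2)) * u' x)\<^sup>2 = (u' x)\<^sup>2 / (1 - (u x)\<^sup>2)" if "x \<in> I" for x
    using assms(1)[OF that] by (simp add: power_mult_distrib power_inverse divide_inverse)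
qed

lemma arcsin_substitution:
  fixes u u' :: "real \<Rightarrow> real"
  assumes "\<And>x. x \<in> I \<Longrightarrow> (u x)\<^sup>2 < 1" "\<And>x. x \<in> I \<Longrightarrow> (u has_real_derivative u' x) (at x)"
    "continuous_on I u'"
  obtains \<phi>' where "\<And>x. x \<in> I \<Longrightarrow> ((\<lambda>x. arcsin (u x)) has_real_derivative \<phi>' x) (at x)"
    "continuous_on I \<phi>'" "\<And>x. x \<in> I \<Longrightarrow> (\<phi>' x)\<^sup>2 = (u' x)\<^sup>2 / (1 - (u x)\<^sup>2)"
proof
  have b: "- 1 < u x" "u x < 1" if "x \<in> I" for x
    using square_less_one_bounds[OF assms(1)[OF that]] by auto
  show "((\<lambda>x. arcsin (u x)) has_real_derivative inverse (sqrt (1 - (u x)\<^sup>2)) * u' x) (at x)" if "x \<in> I" for x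
    by (rule DERIV_chain2[OF DERIV_arcsin[OF b[OF that]] assms(2)[OF that]])
  have "continuous_on I u"
    using assms(2) by (meson continuous_at_imp_continuous_on DERIV_isCont)
  then show "continuous_on I (\<lambda>x. inverse (sqrt (1 - (u x)\<^sup>2)) * u' x)"
    using assms(1,3) by (intro continuous_intros) force+
  show "(inverse (sqrt (1 - (u x)\<^sup>2)) * u' x)\<^sup>2 = (u' x)\<^sup>2 / (1 - (u x)\<^sup>2)" if "x \<in> I" for x
    using assms(1)[OF that] by (simp add: power_mult_distrib power_inverse divide_inverse)
qed

lemma arctan_substitution:
  fixes u u' :: "real \<Rightarrow> real"
  assumes "\<And>x. x \<in> I \<Longrightarrow> (u has_real_derivative u' x) (at x)" "continuous_on I u'"
  obtains \<phi>' where "\<And>x. x \<in> I \<Longrightarrow> ((\<lambda>x. arctan (u x)) has_real_derivative \<phi>' x) (at x)"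
    "continuous_on I \<phi>'" "\<And>x. x \<in> I \<Longrightarrow> (\<phi>' x)\<^sup>2 = (u' x)\<^sup>2 / (1 + (u x)\<^sup>2)\<^sup>2"
proof
  show "((\<lambda>x. arctan (u x)) has_real_derivative inverse (1 + (u x)\<^sup>2) * u' x) (at x)" if "x \<in> I" for x
    by (rule DERIV_chain2[OF DERIV_arctan assms(1)[OF that]])
  have "continuous_on I u"
    using assms(1) by (meson continuous_at_imp_continuous_on DERIV_isCont)
  moreover have "1 + (u x)\<^sup>2 \<noteq> 0" for x by (simp add: add_nonneg_eq_0_iff)
  ultimately show "continuous_on I (\<lambda>x. inverse (1 + (u x)\<^sup>2) * u' x)"
    using assms(2) by (intro continuous_intros) auto
  show "(inverse (1 + (u x)\<^sup>2) * u' x)\<^sup>2 = (u' x)\<^sup>2 / (1 + (u x)\<^sup>2)\<^sup>2" for x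
    by (simp add: power_mult_distrib power_inverse divide_inverse)
qed

lemma sin_squared_arctan: "(sin (arctan y))\<^sup>2 = y\<^sup>2 / (1 + y\<^sup>2)"
  by (simp add: sin_arctan power_divide add_pos_nonneg)

context rotational_cgc
begin

lemma one_plus_\<rho>_sq: "1 + (\<rho> x)\<^sup>2 \<noteq> 0"
  by (simp add: add_nonneg_eq_0_iff)

text \<open>Here \<open>q\<close> has no zeros, so \<open>\<rho>\<close> is strictly monotone, and \<open>Q > 0\<close> bounds it by \<open>R\<close>: the angle is given by
  \<open>\<rho> = R cos \<phi>\<close>. The value \<open>C = 0\<close> has modulus \<open>1\<close>, so that it matters that \<open>\<phi>\<close> is less than \<open>pi/2\<close>.\<close>

lemma profile_neg_i:
  assumes "K < 0" "0 \<le> C" "C < 1"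
  shows "\<exists>r \<psi>. cgc_profile K r \<psi> \<and> given_by I f r \<psi>"
proof -
  define p where "p = sqrt ((1 - K) * (1 - C) / (1 - K - C))"
  define \<Xi> where "\<Xi> = sqrt (1 - K - C)"
  define R where "R = sqrt ((1 - C) / (- K))"
  have nz: "1 - K - C > 0" "1 - K > 0" using assms by auto
  have p2: "p\<^sup>2 = (1 - K) * (1 - C) / (1 - K - C)" and \<Xi>2: "\<Xi>\<^sup>2 = 1 - K - C" and R2: "R\<^sup>2 = (1 - C) / (- K)"
    using assms nz by (simp_all add: p_def \<Xi>_def R_def divide_nonneg_neg)
  have pos: "\<Xi> > 0" "R > 0" using assms by (simp_all add: \<Xi>_def R_def divide_pos_neg)
  have "(1 - K) * (1 - C) \<le> 1 - K - C"
    using mult_nonpos_nonneg[of K C] assms by (simp add: algebra_simps)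
  then have p: "0 \<le> p" "p \<le> 1" using nz assms by (simp_all add: p_def)
  have *: "1 - K - p\<^sup>2 = - K * (1 - K) / (1 - K - C)"
    using nz by (simp add: p2 divide_simps; simp add: algebra_simps)
  have "(- K) * (1 - K) / (1 - K - p\<^sup>2) = 1 - K - C"
    unfolding * using assms nz by (simp add: field_simps)
  then have \<Xi>_eq: "\<Xi> = sqrt ((- K) * (1 - K) / (1 - K - p\<^sup>2))" by (simp add: \<Xi>_def)
  have "p\<^sup>2 / (1 - K - p\<^sup>2) = (1 - C) / (- K)"
    unfolding * p2 using assms nz by (simp add: divide_simps; simp add: algebra_simps)
  then have R_eq: "sqrt (p\<^sup>2 / (1 - K - p\<^sup>2)) = R" by (simp add: R_def)
  let ?r = "\<lambda>s. R * jacobi_cn p (\<Xi> * s)"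
  let ?\<psi> = "\<lambda>s. K / \<Xi> * ellipticPi (p\<^sup>2 / (1 - K)) (\<Xi> * s) p - K * s"
  have "cgc_profile K ?r ?\<psi>"
    by (rule cgc_profile.neg_i[OF assms(1) _ \<Xi>_eq _ refl]) (use p R_eq in auto)
  moreover have "given_by I f ?r ?\<psi>"
  proof -
    have Q: "Q x = - K * (R\<^sup>2 - (\<rho> x)\<^sup>2)" for x
      using assms by (simp add: R2 field_simps)
    have b: "(\<rho> x / R)\<^sup>2 < 1" if "x \<in> I" for x
      using Q_pos[OF that] assms pos(2) unfolding Q
      by (simp add: power_divide mult_less_0_iff)
    have d: "((\<lambda>x. \<rho> x / R) has_real_derivative q x * v x / R) (at x)" if "x \<in> I" for x
      by (intro DERIV_cdivide \<rho>_deriv that)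
    have "continuous_on I (\<lambda>x. q x * v x / R)"
      using pos by (intro continuous_intros continuous_q continuous_v) auto
    from arccos_substitution[OF b d this]
    obtain \<phi>' where \<phi>': "\<And>x. x \<in> I \<Longrightarrow> ((\<lambda>x. arccos (\<rho> x / R)) has_real_derivative \<phi>' x) (at x)"
      "continuous_on I \<phi>'" "\<And>x. x \<in> I \<Longrightarrow> (\<phi>' x)\<^sup>2 = (q x * v x / R)\<^sup>2 / (1 - (\<rho> x / R)\<^sup>2)" by blast
    have u: "0 < \<rho> x / R" "\<rho> x / R < 1" if "x \<in> I" for x
      using b[OF that] \<rho>_pos[OF that] pos by (simp_all add: abs_square_less_1)
    have cos: "cos (arccos (\<rho> x / R)) = \<rho> x / R" if "x \<in> I" for x
      by (rule cos_arccos_square[OF b[OF that]])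
    then have sin2: "(sin (arccos (\<rho> x / R)))\<^sup>2 = 1 - (\<rho> x)\<^sup>2 / R\<^sup>2" if "x \<in> I" for x
      using that by (simp add: sin_squared_eq power_divide)
    show ?thesis
    proof (rule given_by_jacobi_profile[OF p pos(1) _ _ \<phi>'(1,2), where a = "K / \<Xi>" and b = "- K"])
      show "p\<^sup>2 / (1 - K) < 1" using assms nz by (simp add: p2)
      fix x assume x: "x \<in> I"
      show dom: "arccos (\<rho> x / R) \<in> amplitude_domain p"
      proof -
        have "arccos (\<rho> x / R) < arccos 0" "0 < arccos (\<rho> x / R)"
          using u[OF x] arccos_less_arccos[of 0 "\<rho> x / R"] arccos_lt_bounded[of "\<rho> x / R"] by linarith+
        then have "- (pi / 2) < arccos (\<rho> x / R)" "arccos (\<rho> x / R) < pi / 2"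
          using pi_gt_zero unfolding arccos_0 by linarith+
        then show ?thesis by (simp add: amplitude_domain_def)
      qed
      show "R * jacobi_cn p (\<Xi> * (ellipticF p (arccos (\<rho> x / R)) / \<Xi>)) = \<rho> x"
        using pos by (simp add: jacobi_functions_ellipticF[OF p dom] cos[OF x])
      have "R\<^sup>2 - (\<rho> x)\<^sup>2 > 0" "R\<^sup>2 > 0" using b[OF x] pos by (simp_all add: power_divide)
      then have "(\<phi>' x)\<^sup>2 * Q x = - K * (q x)\<^sup>2 * (v x)\<^sup>2"
        unfolding \<phi>'(3)[OF x] Q by (simp add: power_divide power_mult_distrib field_simps)
      also have "- K * (q x)\<^sup>2 = \<Xi>\<^sup>2 - \<Xi>\<^sup>2 * p\<^sup>2 + \<Xi>\<^sup>2 * p\<^sup>2 / R\<^sup>2 * (\<rho> x)\<^sup>2"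
        using assms nz by (simp add: q_sq[OF x] \<Xi>2 p2 R2 divide_simps; simp add: algebra_simps)
      finally show "(\<phi>' x)\<^sup>2 * Q x =
          \<Xi>\<^sup>2 * (1 - p\<^sup>2 * (sin (arccos (\<rho> x / R)))\<^sup>2) * (v x)\<^sup>2"
        by (simp add: sin2[OF x] algebra_simps)
      have D: "1 - p\<^sup>2 / (1 - K) * (1 - (\<rho> x)\<^sup>2 / R\<^sup>2) = - K * (1 + (\<rho> x)\<^sup>2) / (1 - K - C)"
        using assms nz by (simp add: p2 R2 divide_simps; simp add: algebra_simps)
      show "K / \<Xi> * \<Xi> / (1 - p\<^sup>2 / (1 - K) * (sin (arccos (\<rho> x / R)))\<^sup>2) + - K =
          - (Q x / (1 + (\<rho> x)\<^sup>2))"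
        unfolding sin2[OF x] D using assms nz pos by (simp add: divide_simps one_plus_\<rho>_sq; simp add: algebra_simps)
    qed auto
  qed
  ultimately show ?thesis by blast
qed


text \<open>The radius may pass through its minimum, where \<open>q\<close> changes sign, so \<open>\<phi>\<close> is defined by
  \<open>q = - W cos \<phi>\<close>; the bound \<open>W\<close> is the value of \<open>\<bar>q\<bar>\<close> at the zero \<open>R\<close> of \<open>Q\<close>.\<close>

lemma profile_neg_ii:
  assumes "K < 0" "C < 0"
  shows "\<exists>r \<psi>. cgc_profile K r \<psi> \<and> given_by I f r \<psi>"
proof -
  define p where "p = sqrt ((1 - K - C) / ((1 - C) * (1 - K)))"
  define \<Xi> where "\<Xi> = sqrt ((1 - K) * (1 - C))"
  define R where "R = sqrt ((1 - C) / (- K))"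
  define W where "W = sqrt ((1 - K - C) / (- K))"
  have nz: "1 - K - C > 0" "1 - K > 0" "1 - C > 0" using assms by auto
  have p2: "p\<^sup>2 = (1 - K - C) / ((1 - C) * (1 - K))" and \<Xi>2: "\<Xi>\<^sup>2 = (1 - K) * (1 - C)"
    and R2: "R\<^sup>2 = (1 - C) / (- K)" and W2: "W\<^sup>2 = (1 - K - C) / (- K)"
    using assms nz by (simp_all add: p_def \<Xi>_def R_def W_def divide_nonneg_neg)
  have pos: "\<Xi> > 0" "R > 0" "W > 0" "p > 0"
    using assms nz by (simp_all add: \<Xi>_def R_def W_def p_def divide_pos_neg)
  have "1 - K - C < (1 - C) * (1 - K)"
    using mult_neg_neg[of K C] assms by (simp add: algebra_simps)
  then have p_lt: "p < 1" using nz by (simp add: p_def)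
  then have p: "0 \<le> p" "p \<le> 1" using pos by auto
  have "sqrt (1 / (1 - K)) \<le> p"
    unfolding p_def real_sqrt_le_iff using assms nz by (simp add: divide_simps)
  then have p_range: "p \<in> {sqrt (1 / (1 - K))..1}" using p by simp
  have *: "(1 - K) * p\<^sup>2 - 1 = - K / (1 - C)"
    using nz by (simp add: p2 divide_simps)
  have "(- K) * (1 - K) / ((1 - K) * p\<^sup>2 - 1) = (1 - K) * (1 - C)"
    unfolding * using assms nz by (simp add: field_simps)
  then have \<Xi>_eq: "\<Xi> = sqrt ((- K) * (1 - K) / ((1 - K) * p\<^sup>2 - 1))" by (simp add: \<Xi>_def)
  have "1 / ((1 - K) * p\<^sup>2 - 1) = (1 - C) / (- K)"
    unfolding * using assms nz by (simp add: divide_simps)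
  then have R_eq: "sqrt (1 / ((1 - K) * p\<^sup>2 - 1)) = R" by (simp add: R_def)
  let ?r = "\<lambda>s. R * jacobi_dn p (\<Xi> * s)"
  let ?\<psi> = "\<lambda>s. K / \<Xi> * ellipticPi (1 / (1 - K)) (\<Xi> * s) p - K * s"
  have "cgc_profile K ?r ?\<psi>"
    by (rule cgc_profile.neg_ii[OF assms(1) p_range \<Xi>_eq _ refl]) (use R_eq in auto)
  moreover have "given_by I f ?r ?\<psi>"
  proof -
    have Q: "(1 - K) * Q x = - K * (W\<^sup>2 - (q x)\<^sup>2)" if "x \<in> I" for x
      using assms by (simp add: W2 q_sq[OF that] field_simps)
    have W: "W\<^sup>2 - (q x)\<^sup>2 > 0" if "x \<in> I" for x
    proof -
      have "- K * (W\<^sup>2 - (q x)\<^sup>2) > 0" unfolding Q[OF that, symmetric] using Q_pos[OF that] nz by simp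
      then show ?thesis using assms zero_less_mult_pos[of "- K" "W\<^sup>2 - (q x)\<^sup>2"] by simp
    qed
    have b: "(- (q x) / W)\<^sup>2 < 1" if "x \<in> I" for x
      using W[OF that] pos by (simp add: power_divide)
    have d: "((\<lambda>x. - (q x) / W) has_real_derivative - ((1 - K) * \<rho> x * v x) / W) (at x)" if "x \<in> I" for x
      by (intro DERIV_cdivide DERIV_minus q_deriv that)
    have "continuous_on I (\<lambda>x. - ((1 - K) * \<rho> x * v x) / W)"
      using pos by (intro continuous_intros continuous_\<rho> continuous_v) auto
    from arccos_substitution[OF b d this]
    obtain \<phi>' where \<phi>': "\<And>x. x \<in> I \<Longrightarrow> ((\<lambda>x. arccos (- (q x) / W)) has_real_derivative \<phi>' x) (at x)"
      "continuous_on I \<phi>'"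
      "\<And>x. x \<in> I \<Longrightarrow> (\<phi>' x)\<^sup>2 = (- ((1 - K) * \<rho> x * v x) / W)\<^sup>2 / (1 - (- (q x) / W)\<^sup>2)" by blast
    have sin2: "(sin (arccos (- (q x) / W)))\<^sup>2 = 1 - (q x)\<^sup>2 / W\<^sup>2" if "x \<in> I" for x
    proof -
      have "cos (arccos (- (q x) / W)) = - (q x) / W" by (rule cos_arccos_square[OF b[OF that]])
      then show ?thesis by (simp add: sin_squared_eq power_divide)
    qed
    have dn2: "1 - p\<^sup>2 * (1 - (q x)\<^sup>2 / W\<^sup>2) = (\<rho> x)\<^sup>2 / R\<^sup>2" if "x \<in> I" for x
    proof -
      have "p\<^sup>2 / W\<^sup>2 = - K / ((1 - K) * (1 - C))"
        using assms nz by (simp add: p2 W2 divide_simps)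
      moreover have "1 - p\<^sup>2 = C * K / ((1 - K) * (1 - C))"
        using assms nz by (simp add: p2 divide_simps; simp add: algebra_simps)
      moreover have "1 - p\<^sup>2 * (1 - (q x)\<^sup>2 / W\<^sup>2) = (1 - p\<^sup>2) + p\<^sup>2 / W\<^sup>2 * (q x)\<^sup>2"
        by (simp add: algebra_simps)
      ultimately have E: "1 - p\<^sup>2 * (1 - (q x)\<^sup>2 / W\<^sup>2) =
          C * K / ((1 - K) * (1 - C)) + - K / ((1 - K) * (1 - C)) * (q x)\<^sup>2"
        by (simp only:)
      show ?thesis unfolding E using assms nz by (simp add: q_sq[OF that] R2 divide_simps; simp add: algebra_simps)
    qed
    show ?thesis
    proof (rule given_by_jacobi_profile[OF p pos(1) _ _ \<phi>'(1,2), where a = "K / \<Xi>" and b = "- K"])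
      show "1 / (1 - K) < 1" using assms by simp
      fix x assume x: "x \<in> I"
      show dom: "arccos (- (q x) / W) \<in> amplitude_domain p" using p_lt by (simp add: amplitude_domain_def)
      have "R * sqrt ((\<rho> x)\<^sup>2 / R\<^sup>2) = \<rho> x" using pos \<rho>_pos[OF x] by (simp add: real_sqrt_divide)
      moreover have c: "\<Xi> * (ellipticF p (arccos (- (q x) / W)) / \<Xi>) = ellipticF p (arccos (- (q x) / W))" using pos by simp
      ultimately show "R * jacobi_dn p (\<Xi> * (ellipticF p (arccos (- (q x) / W)) / \<Xi>)) = \<rho> x"
        by (simp only: jacobi_functions_ellipticF(3)[OF p dom] sin2[OF x] dn2[OF x] c)
      have "(\<phi>' x)\<^sup>2 * ((1 - K) * Q x) = - K * (1 - K)\<^sup>2 * (\<rho> x)\<^sup>2 * (v x)\<^sup>2"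
        unfolding \<phi>'(3)[OF x] Q[OF x] using W[OF x] pos
        by (simp add: power_divide power_mult_distrib divide_simps)
      then have "(1 - K) * ((\<phi>' x)\<^sup>2 * Q x) = (1 - K) * (- K * (1 - K) * (\<rho> x)\<^sup>2 * (v x)\<^sup>2)"
        by (simp only: power2_eq_square[of "1 - K"] mult_ac)
      moreover have "1 - K \<noteq> 0" using nz by simp
      ultimately have "(\<phi>' x)\<^sup>2 * Q x = - K * (1 - K) * (\<rho> x)\<^sup>2 * (v x)\<^sup>2"
        using mult_left_cancel by blast
      also have "- K * (1 - K) * (\<rho> x)\<^sup>2 = \<Xi>\<^sup>2 * ((\<rho> x)\<^sup>2 / R\<^sup>2)"
        using assms nz by (simp add: \<Xi>2 R2 divide_simps)
      finally show "(\<phi>' x)\<^sup>2 * Q x =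
          \<Xi>\<^sup>2 * (1 - p\<^sup>2 * (sin (arccos (- (q x) / W)))\<^sup>2) * (v x)\<^sup>2"
        unfolding sin2[OF x] dn2[OF x] .
      have D: "1 - 1 / (1 - K) * (1 - (q x)\<^sup>2 / W\<^sup>2) = - K * (1 + (\<rho> x)\<^sup>2) / (1 - K - C)"
        using assms nz by (simp add: W2 q_sq[OF x] divide_simps; simp add: algebra_simps)
      show "K / \<Xi> * \<Xi> / (1 - 1 / (1 - K) * (sin (arccos (- (q x) / W)))\<^sup>2) + - K =
          - (Q x / (1 + (\<rho> x)\<^sup>2))"
        unfolding sin2[OF x] D using assms nz pos by (simp add: divide_simps one_plus_\<rho>_sq; simp add: algebra_simps)
    qed auto
  qed
  ultimately show ?thesis by blast
qed

text \<open>The radius may pass through its minimum \<open>R\<close>, the zero of \<open>P\<close>; the signed angle \<open>\<phi>\<close> with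
  \<open>q = S tan \<phi>\<close> satisfies \<open>\<rho> = R / cos \<phi>\<close>.\<close>

lemma profile_between_i:
  assumes "0 < K" "K < 1" "C < 0"
  shows "\<exists>r \<psi>. cgc_profile K r \<psi> \<and> given_by I f r \<psi>"
proof -
  define p where "p = sqrt ((1 - K) * (1 - C) / (1 - K - C))"
  define \<Xi> where "\<Xi> = sqrt (1 - K - C)"
  define R where "R = sqrt (- C / (1 - K))"
  define S where "S = sqrt (- C)"
  have nz: "1 - K - C > 0" "1 - K > 0" "1 - C > 0" using assms by auto
  have p2: "p\<^sup>2 = (1 - K) * (1 - C) / (1 - K - C)" and \<Xi>2: "\<Xi>\<^sup>2 = 1 - K - C"
    and R2: "R\<^sup>2 = - C / (1 - K)" and S2: "S\<^sup>2 = - C"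
    using assms nz by (simp_all add: p_def \<Xi>_def R_def S_def divide_nonpos_pos)
  have pos: "\<Xi> > 0" "R > 0" "S > 0" "p > 0"
    using assms nz by (simp_all add: \<Xi>_def R_def S_def p_def divide_neg_pos)
  have "(1 - K) * (1 - C) < 1 - K - C"
    using mult_pos_neg[of K C] assms by (simp add: algebra_simps)
  then have p_lt: "p < 1" using nz by (simp add: p_def)
  then have p: "0 \<le> p" "p \<le> 1" using pos by auto
  have "1 - K \<le> (1 - K) * (1 - C) / (1 - K - C)"
    using assms nz by (simp add: divide_simps)
  then have p_range: "p \<in> {sqrt (1 - K)..1}" using p by (simp add: p_def)
  have *: "K - 1 + p\<^sup>2 = K * (1 - K) / (1 - K - C)"
    using nz by (simp add: p2 divide_simps; simp add: algebra_simps)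
  have **: "1 - p\<^sup>2 = - C * K / (1 - K - C)"
    using nz by (simp add: p2 divide_simps; simp add: algebra_simps)
  have "K * (1 - K) / (K - 1 + p\<^sup>2) = 1 - K - C"
    unfolding * using assms nz by simp
  then have \<Xi>_eq: "\<Xi> = sqrt (K * (1 - K) / (K - 1 + p\<^sup>2))" by (simp add: \<Xi>_def)
  have "(1 - p\<^sup>2) / (K - 1 + p\<^sup>2) = - C / (1 - K)"
    unfolding * ** using assms nz by (simp add: divide_simps)
  then have R_eq: "sqrt ((1 - p\<^sup>2) / (K - 1 + p\<^sup>2)) = R" by (simp add: R_def)
  let ?r = "\<lambda>s. R * jacobi_nc p (\<Xi> * s)"
  let ?\<psi> = "\<lambda>s. \<Xi> * (1 - p\<^sup>2) / K * ellipticPi ((1 - K) / \<Xi>\<^sup>2) (\<Xi> * s) p - \<Xi>\<^sup>2 * p\<^sup>2 / (1 - K) * s"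
  have "cgc_profile K ?r ?\<psi>"
    by (rule cgc_profile.between_i[OF assms(1,2) p_range \<Xi>_eq _ refl]) (use R_eq in auto)
  moreover have "given_by I f ?r ?\<psi>"
  proof -
    have d: "((\<lambda>x. q x / S) has_real_derivative (1 - K) * \<rho> x * v x / S) (at x)" if "x \<in> I" for x
      by (intro DERIV_cdivide q_deriv that)
    have "continuous_on I (\<lambda>x. (1 - K) * \<rho> x * v x / S)"
      using pos by (intro continuous_intros continuous_\<rho> continuous_v) auto
    from arctan_substitution[OF d this]
    obtain \<phi>' where \<phi>': "\<And>x. x \<in> I \<Longrightarrow> ((\<lambda>x. arctan (q x / S)) has_real_derivative \<phi>' x) (at x)"
      "continuous_on I \<phi>'"
      "\<And>x. x \<in> I \<Longrightarrow> (\<phi>' x)\<^sup>2 = ((1 - K) * \<rho> x * v x / S)\<^sup>2 / (1 + (q x / S)\<^sup>2)\<^sup>2" by blast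
    have sec2: "1 + (q x / S)\<^sup>2 = (\<rho> x)\<^sup>2 / R\<^sup>2" if "x \<in> I" for x
      using assms nz by (simp add: power_divide S2 R2 q_sq[OF that] divide_simps; simp add: algebra_simps)
    have cos: "cos (arctan (q x / S)) = R / \<rho> x" if "x \<in> I" for x
      using pos \<rho>_pos[OF that] by (simp add: cos_arctan sec2[OF that] real_sqrt_divide)
    then have sin2: "(sin (arctan (q x / S)))\<^sup>2 = 1 - R\<^sup>2 / (\<rho> x)\<^sup>2" if "x \<in> I" for x
      using that by (simp add: sin_squared_eq power_divide)
    show ?thesis
    proof (rule given_by_jacobi_profile[OF p pos(1) _ _ \<phi>'(1,2), where a = "\<Xi> * (1 - p\<^sup>2) / K"
          and b = "- (\<Xi>\<^sup>2 * p\<^sup>2 / (1 - K))"])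
      show "(1 - K) / \<Xi>\<^sup>2 < 1" using assms nz by (simp add: \<Xi>2)
      fix x assume x: "x \<in> I"
      have \<rho>: "(\<rho> x)\<^sup>2 > 0" "R\<^sup>2 > 0" using \<rho>_pos[OF x] pos by auto
      show dom: "arctan (q x / S) \<in> amplitude_domain p" using p_lt by (simp add: amplitude_domain_def)
      show "R * jacobi_nc p (\<Xi> * (ellipticF p (arctan (q x / S)) / \<Xi>)) = \<rho> x"
        using pos \<rho>_pos[OF x] jacobi_functions_ellipticF(4)[OF p dom] by (simp add: cos[OF x])
      have "(\<phi>' x)\<^sup>2 = ((1 - K) * R\<^sup>2)\<^sup>2 / S\<^sup>2 / (\<rho> x)\<^sup>2 * (v x)\<^sup>2"
        unfolding \<phi>'(3)[OF x] sec2[OF x] using \<rho>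
        by (simp add: power_divide power_mult_distrib power2_eq_square divide_simps)
      also have "((1 - K) * R\<^sup>2)\<^sup>2 / S\<^sup>2 = - C"
        unfolding R2 S2 using assms nz by (simp add: power2_eq_square)
      finally have "(\<phi>' x)\<^sup>2 * Q x =
          (- C * Q x / (\<rho> x)\<^sup>2) * (v x)\<^sup>2" by simp
      also have "- C * Q x / (\<rho> x)\<^sup>2 = \<Xi>\<^sup>2 * (1 - p\<^sup>2 * (1 - R\<^sup>2 / (\<rho> x)\<^sup>2))"
        using assms nz \<rho> by (simp add: \<Xi>2 p2 R2 divide_simps; simp add: algebra_simps)
      finally show "(\<phi>' x)\<^sup>2 * Q x =
          \<Xi>\<^sup>2 * (1 - p\<^sup>2 * (sin (arctan (q x / S)))\<^sup>2) * (v x)\<^sup>2"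
        unfolding sin2[OF x] .
      have D: "1 - (1 - K) / \<Xi>\<^sup>2 * (1 - R\<^sup>2 / (\<rho> x)\<^sup>2) = - C * (1 + (\<rho> x)\<^sup>2) / ((\<rho> x)\<^sup>2 * (1 - K - C))"
        using assms nz \<rho> by (simp add: \<Xi>2 R2 divide_simps; simp add: algebra_simps)
      have "\<Xi> * (1 - p\<^sup>2) / K * \<Xi> = \<Xi>\<^sup>2 * (1 - p\<^sup>2) / K" by (simp add: power2_eq_square)
      moreover have "\<Xi>\<^sup>2 * (1 - p\<^sup>2) / K = - C" unfolding \<Xi>2 ** using assms nz by simp
      moreover have "\<Xi>\<^sup>2 * p\<^sup>2 / (1 - K) = 1 - C" unfolding \<Xi>2 p2 using assms nz by simp
      ultimately have E: "\<Xi> * (1 - p\<^sup>2) / K * \<Xi> = - C" "\<Xi>\<^sup>2 * p\<^sup>2 / (1 - K) = 1 - C" by simp_all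
      show "\<Xi> * (1 - p\<^sup>2) / K * \<Xi> / (1 - (1 - K) / \<Xi>\<^sup>2 * (sin (arctan (q x / S)))\<^sup>2)
          + - (\<Xi>\<^sup>2 * p\<^sup>2 / (1 - K)) = - (Q x / (1 + (\<rho> x)\<^sup>2))"
        unfolding sin2[OF x] D E using assms nz \<rho> by (simp add: divide_simps one_plus_\<rho>_sq; simp add: algebra_simps)
    qed auto
  qed
  ultimately show ?thesis by blast
qed

lemma arctan_radius_substitution:
  assumes "R > 0"
  obtains \<phi>' where "\<And>x. x \<in> I \<Longrightarrow> ((\<lambda>x. arctan (\<rho> x / R)) has_real_derivative \<phi>' x) (at x)"
    "continuous_on I \<phi>'"
    "\<And>x. x \<in> I \<Longrightarrow> (\<phi>' x)\<^sup>2 = R\<^sup>2 * (q x)\<^sup>2 / (R\<^sup>2 + (\<rho> x)\<^sup>2)\<^sup>2 * (v x)\<^sup>2"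
    "\<And>x. (sin (arctan (\<rho> x / R)))\<^sup>2 = (\<rho> x)\<^sup>2 / (R\<^sup>2 + (\<rho> x)\<^sup>2)"
proof -
  have d: "((\<lambda>x. \<rho> x / R) has_real_derivative q x * v x / R) (at x)" if "x \<in> I" for x
    by (intro DERIV_cdivide \<rho>_deriv that)
  have "continuous_on I (\<lambda>x. q x * v x / R)"
    using assms by (intro continuous_intros continuous_q continuous_v) auto
  from arctan_substitution[OF d this]
  obtain \<phi>' where \<phi>': "\<And>x. x \<in> I \<Longrightarrow> ((\<lambda>x. arctan (\<rho> x / R)) has_real_derivative \<phi>' x) (at x)"
    "continuous_on I \<phi>'"
    "\<And>x. x \<in> I \<Longrightarrow> (\<phi>' x)\<^sup>2 = (q x * v x / R)\<^sup>2 / (1 + (\<rho> x / R)\<^sup>2)\<^sup>2" by blast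
  have sec2: "1 + (\<rho> x / R)\<^sup>2 = (R\<^sup>2 + (\<rho> x)\<^sup>2) / R\<^sup>2" for x
    using assms by (simp add: power_divide divide_simps)
  show ?thesis
  proof (rule that[OF \<phi>'(1,2)])
    fix x
    show "(\<phi>' x)\<^sup>2 = R\<^sup>2 * (q x)\<^sup>2 / (R\<^sup>2 + (\<rho> x)\<^sup>2)\<^sup>2 * (v x)\<^sup>2" if "x \<in> I"
    proof -
      have "A * B / y / (z / y)\<^sup>2 = y * A / z\<^sup>2 * B" if "y \<noteq> 0" for A B y z :: real
        using that by (simp add: power2_eq_square)
      then show ?thesis
        unfolding \<phi>'(3)[OF that] sec2 power_divide[of "q x * v x"] power_mult_distrib using assms by simp
    qed
    show "(sin (arctan (\<rho> x / R)))\<^sup>2 = (\<rho> x)\<^sup>2 / (R\<^sup>2 + (\<rho> x)\<^sup>2)"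
      unfolding sin_squared_arctan sec2 unfolding power_divide using assms by simp
  qed
qed

text \<open>The radius is strictly monotone and its range is not bounded by zeros of \<open>P\<close> or \<open>Q\<close>. The
  substitution \<open>\<rho> = R tan \<phi>\<close> works because \<open>P\<close> is proportional to \<open>R\<^sup>2 + \<rho>\<^sup>2\<close>.\<close>

lemma profile_between_ii:
  assumes "0 < K" "K < 1" "0 < C" "C \<le> 1 - K"
  shows "\<exists>r \<psi>. cgc_profile K r \<psi> \<and> given_by I f r \<psi>"
proof -
  define p where "p = sqrt ((1 - K - C) / ((1 - K) * (1 - C)))"
  define \<Xi> where "\<Xi> = sqrt ((1 - K) * (1 - C))"
  define R where "R = sqrt (C / (1 - K))"
  have nz: "1 - K - C \<ge> 0" "1 - K > 0" "1 - C > 0" using assms by auto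
  have p2: "p\<^sup>2 = (1 - K - C) / ((1 - K) * (1 - C))" and \<Xi>2: "\<Xi>\<^sup>2 = (1 - K) * (1 - C)"
    and R2: "R\<^sup>2 = C / (1 - K)"
    using assms nz by (simp_all add: p_def \<Xi>_def R_def)
  have pos: "\<Xi> > 0" "R > 0" "p \<ge> 0" using assms nz by (simp_all add: \<Xi>_def R_def p_def)
  have "1 - K - C < (1 - K) * (1 - C)"
    using mult_pos_pos[of K C] assms by (simp add: algebra_simps)
  then have p_lt: "p < 1" using nz by (simp add: p_def)
  then have p: "0 \<le> p" "p \<le> 1" using pos by auto
  then have p_range: "p \<in> {0..1}" by simp
  have *: "1 + p\<^sup>2 * (K - 1) = K / (1 - C)"
    using nz by (simp add: p2 divide_simps; simp add: algebra_simps)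
  have **: "1 - p\<^sup>2 = C * K / ((1 - K) * (1 - C))"
    using nz by (simp add: p2 divide_simps; simp add: algebra_simps)
  have "K * (1 - K) / (1 + p\<^sup>2 * (K - 1)) = (1 - K) * (1 - C)"
    unfolding * using assms nz by simp
  then have \<Xi>_eq: "\<Xi> = sqrt (K * (1 - K) / (1 + p\<^sup>2 * (K - 1)))" by (simp add: \<Xi>_def)
  have "(1 - p\<^sup>2) / (1 + p\<^sup>2 * (K - 1)) = C / (1 - K)"
    unfolding * ** using assms nz by (simp add: divide_simps)
  then have R_eq: "sqrt ((1 - p\<^sup>2) / (1 + p\<^sup>2 * (K - 1))) = R" by (simp add: R_def)
  let ?r = "\<lambda>s. R * jacobi_sc p (\<Xi> * s)"
  let ?\<psi> = "\<lambda>s. \<Xi> * (1 - p\<^sup>2) / K * ellipticPi (\<Xi>\<^sup>2 * p\<^sup>2 / (1 - K)) (\<Xi> * s) p - s"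
  have "cgc_profile K ?r ?\<psi>"
    by (rule cgc_profile.between_ii[OF assms(1,2) p_range \<Xi>_eq _ refl]) (use R_eq in auto)
  moreover have "given_by I f ?r ?\<psi>"
  proof -
    from arctan_radius_substitution[OF pos(2)] obtain \<phi>' where
      \<phi>': "\<And>x. x \<in> I \<Longrightarrow> ((\<lambda>x. arctan (\<rho> x / R)) has_real_derivative \<phi>' x) (at x)" "continuous_on I \<phi>'"
      "\<And>x. x \<in> I \<Longrightarrow> (\<phi>' x)\<^sup>2 = R\<^sup>2 * (q x)\<^sup>2 / (R\<^sup>2 + (\<rho> x)\<^sup>2)\<^sup>2 * (v x)\<^sup>2"
      and sin2: "\<And>x. (sin (arctan (\<rho> x / R)))\<^sup>2 = (\<rho> x)\<^sup>2 / (R\<^sup>2 + (\<rho> x)\<^sup>2)" by blast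
    show ?thesis
    proof (rule given_by_jacobi_profile[OF p pos(1) _ _ \<phi>'(1,2), where a = "\<Xi> * (1 - p\<^sup>2) / K" and b = "- 1"])
      have k: "\<Xi>\<^sup>2 * p\<^sup>2 / (1 - K) = 1 - R\<^sup>2" using nz by (simp add: \<Xi>2 p2 R2 divide_simps)
      have R_pos: "R\<^sup>2 > 0" using pos by simp
      then show "\<Xi>\<^sup>2 * p\<^sup>2 / (1 - K) < 1" unfolding k by simp
      fix x assume x: "x \<in> I"
      have \<rho>: "(\<rho> x)\<^sup>2 > 0" using \<rho>_pos[OF x] by auto
      have s: "R\<^sup>2 + (\<rho> x)\<^sup>2 > 0" by (rule add_pos_pos[OF R_pos \<rho>])
      show dom: "arctan (\<rho> x / R) \<in> amplitude_domain p" using p_lt by (simp add: amplitude_domain_def)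
      show "R * jacobi_sc p (\<Xi> * (ellipticF p (arctan (\<rho> x / R)) / \<Xi>)) = \<rho> x"
        using pos jacobi_functions_ellipticF(5)[OF p dom] by (simp add: tan_arctan)
      have q2: "(q x)\<^sup>2 = (1 - K) * (R\<^sup>2 + (\<rho> x)\<^sup>2)"
        using nz by (simp add: q_sq[OF x] R2 distrib_left)
      have "(\<phi>' x)\<^sup>2 = (1 - K) * R\<^sup>2 / (R\<^sup>2 + (\<rho> x)\<^sup>2) * (v x)\<^sup>2"
        unfolding \<phi>'(3)[OF x] q2 using s by (simp add: power2_eq_square[of "R\<^sup>2 + (\<rho> x)\<^sup>2"])
      also have "(1 - K) * R\<^sup>2 = C" using nz by (simp add: R2)
      finally have "(\<phi>' x)\<^sup>2 * Q x =
          (C * Q x / (R\<^sup>2 + (\<rho> x)\<^sup>2)) * (v x)\<^sup>2" by simp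
      also have "C * Q x / (R\<^sup>2 + (\<rho> x)\<^sup>2)
          = \<Xi>\<^sup>2 - \<Xi>\<^sup>2 * p\<^sup>2 * ((\<rho> x)\<^sup>2 / (R\<^sup>2 + (\<rho> x)\<^sup>2))"
      proof -
        have A: "\<Xi>\<^sup>2 * p\<^sup>2 = 1 - K - C" using nz by (simp add: \<Xi>2 p2)
        have B: "\<Xi>\<^sup>2 * R\<^sup>2 = C * (1 - C)" using nz by (simp add: \<Xi>2 R2)
        have E: "\<Xi>\<^sup>2 - \<Xi>\<^sup>2 * p\<^sup>2 * ((\<rho> x)\<^sup>2 / (R\<^sup>2 + (\<rho> x)\<^sup>2))
            = (\<Xi>\<^sup>2 * R\<^sup>2 + (\<Xi>\<^sup>2 - \<Xi>\<^sup>2 * p\<^sup>2) * (\<rho> x)\<^sup>2) / (R\<^sup>2 + (\<rho> x)\<^sup>2)"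
          by (rule combine_fractions[OF s])
        show ?thesis unfolding E unfolding A B unfolding \<Xi>2 by (simp add: algebra_simps)
      qed
      finally show "(\<phi>' x)\<^sup>2 * Q x =
          \<Xi>\<^sup>2 * (1 - p\<^sup>2 * (sin (arctan (\<rho> x / R)))\<^sup>2) * (v x)\<^sup>2"
        unfolding sin2 by (simp add: algebra_simps)
      have D: "1 - (1 - R\<^sup>2) * ((\<rho> x)\<^sup>2 / (R\<^sup>2 + (\<rho> x)\<^sup>2)) = R\<^sup>2 * (1 + (\<rho> x)\<^sup>2) / (R\<^sup>2 + (\<rho> x)\<^sup>2)"
        unfolding combine_fractions[OF s] by (simp add: algebra_simps)
      have "\<Xi> * (1 - p\<^sup>2) / K * \<Xi> = \<Xi>\<^sup>2 * (1 - p\<^sup>2) / K" by (simp add: power2_eq_square)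
      also have "\<dots> = (1 - K) * R\<^sup>2" unfolding \<Xi>2 ** R2 using assms nz by simp
      finally have E: "\<Xi> * (1 - p\<^sup>2) / K * \<Xi> / (R\<^sup>2 * (1 + (\<rho> x)\<^sup>2) / (R\<^sup>2 + (\<rho> x)\<^sup>2))
          = (1 - K) * (R\<^sup>2 + (\<rho> x)\<^sup>2) / (1 + (\<rho> x)\<^sup>2)"
        using R_pos by simp
      show "\<Xi> * (1 - p\<^sup>2) / K * \<Xi> / (1 - \<Xi>\<^sup>2 * p\<^sup>2 / (1 - K) * (sin (arctan (\<rho> x / R)))\<^sup>2)
          + - 1 = - (Q x / (1 + (\<rho> x)\<^sup>2))"
        unfolding sin2 k D E unfolding q2[symmetric] by (simp add: q_sq[OF x] divide_simps one_plus_\<rho>_sq; simp add: algebra_simps)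
    qed auto
  qed
  ultimately show ?thesis by blast
qed

text \<open>As in the previous family, but with \<open>R\<close> chosen such that \<open>Q\<close> instead of \<open>P\<close> is proportional to
  \<open>R\<^sup>2 + \<rho>\<^sup>2\<close>. The two families meet at \<open>C = 1 - K\<close>, where \<open>p = 0\<close> in both.\<close>

lemma profile_between_iii:
  assumes "0 < K" "K < 1" "1 - K \<le> C" "C < 1"
  shows "\<exists>r \<psi>. cgc_profile K r \<psi> \<and> given_by I f r \<psi>"
proof -
  define p where "p = sqrt ((C - (1 - K)) / (K * C))"
  define \<Xi> where "\<Xi> = sqrt (K * C)"
  define R where "R = sqrt ((1 - C) / K)"
  have nz: "C - (1 - K) \<ge> 0" "C > 0" "1 - C > 0" using assms by auto
  have p2: "p\<^sup>2 = (C - (1 - K)) / (K * C)" and \<Xi>2: "\<Xi>\<^sup>2 = K * C" and R2: "R\<^sup>2 = (1 - C) / K"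
    using assms nz by (simp_all add: p_def \<Xi>_def R_def)
  have pos: "\<Xi> > 0" "R > 0" "p \<ge> 0" using assms nz by (simp_all add: \<Xi>_def R_def p_def)
  have "0 < (1 - K) * (1 - C)" using assms by simp
  then have "C - (1 - K) < K * C" by (simp add: algebra_simps)
  then have p_lt: "p < 1" using nz assms by (simp add: p_def)
  then have p: "0 \<le> p" "p \<le> 1" using pos by auto
  then have p_range: "p \<in> {0..1}" by simp
  have *: "1 - K * p\<^sup>2 = (1 - K) / C"
    using assms nz by (simp add: p2 divide_simps)
  have **: "1 - p\<^sup>2 = (1 - K) * (1 - C) / (K * C)"
    using assms nz by (simp add: p2 divide_simps; simp add: algebra_simps)
  have "K * (1 - K) / (1 - K * p\<^sup>2) = K * C"
    unfolding * using assms nz by simp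
  then have \<Xi>_eq: "\<Xi> = sqrt (K * (1 - K) / (1 - K * p\<^sup>2))" by (simp add: \<Xi>_def)
  have "(1 - p\<^sup>2) / (1 - K * p\<^sup>2) = (1 - C) / K"
    unfolding * ** using assms nz by (simp add: divide_simps)
  then have R_eq: "sqrt ((1 - p\<^sup>2) / (1 - K * p\<^sup>2)) = R" by (simp add: R_def)
  let ?r = "\<lambda>s. R * jacobi_sc p (\<Xi> * s)"
  let ?\<psi> = "\<lambda>s. \<Xi> * (1 - p\<^sup>2) / (K - 1) * ellipticPi (\<Xi>\<^sup>2 * p\<^sup>2 / K) (\<Xi> * s) p"
  have "cgc_profile K ?r ?\<psi>"
    by (rule cgc_profile.between_iii[OF assms(1,2) p_range \<Xi>_eq _ refl]) (use R_eq in auto)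
  moreover have "given_by I f ?r ?\<psi>"
  proof -
    from arctan_radius_substitution[OF pos(2)] obtain \<phi>' where
      \<phi>': "\<And>x. x \<in> I \<Longrightarrow> ((\<lambda>x. arctan (\<rho> x / R)) has_real_derivative \<phi>' x) (at x)" "continuous_on I \<phi>'"
      "\<And>x. x \<in> I \<Longrightarrow> (\<phi>' x)\<^sup>2 = R\<^sup>2 * (q x)\<^sup>2 / (R\<^sup>2 + (\<rho> x)\<^sup>2)\<^sup>2 * (v x)\<^sup>2"
      and sin2: "\<And>x. (sin (arctan (\<rho> x / R)))\<^sup>2 = (\<rho> x)\<^sup>2 / (R\<^sup>2 + (\<rho> x)\<^sup>2)" by blast
    show ?thesis
    proof (rule given_by_jacobi_profile[OF p pos(1) _ _ \<phi>'(1,2), where a = "\<Xi> * (1 - p\<^sup>2) / (K - 1)" and b = 0])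
      have k: "\<Xi>\<^sup>2 * p\<^sup>2 / K = 1 - R\<^sup>2" using assms nz by (simp add: \<Xi>2 p2 R2 divide_simps)
      have R_pos: "R\<^sup>2 > 0" using pos by simp
      then show "\<Xi>\<^sup>2 * p\<^sup>2 / K < 1" unfolding k by simp
      fix x assume x: "x \<in> I"
      have \<rho>: "(\<rho> x)\<^sup>2 > 0" using \<rho>_pos[OF x] by auto
      have s: "R\<^sup>2 + (\<rho> x)\<^sup>2 > 0" by (rule add_pos_pos[OF R_pos \<rho>])
      show dom: "arctan (\<rho> x / R) \<in> amplitude_domain p" using p_lt by (simp add: amplitude_domain_def)
      show "R * jacobi_sc p (\<Xi> * (ellipticF p (arctan (\<rho> x / R)) / \<Xi>)) = \<rho> x"
        using pos jacobi_functions_ellipticF(5)[OF p dom] by (simp add: tan_arctan)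
      have Q: "Q x = K * (R\<^sup>2 + (\<rho> x)\<^sup>2)"
        using assms by (simp add: R2 distrib_left)
      have "(\<phi>' x)\<^sup>2 * Q x = K * R\<^sup>2 * (q x)\<^sup>2 / (R\<^sup>2 + (\<rho> x)\<^sup>2) * (v x)\<^sup>2"
        unfolding \<phi>'(3)[OF x] Q using s by (simp add: power2_eq_square[of "R\<^sup>2 + (\<rho> x)\<^sup>2"])
      also have "K * R\<^sup>2 = 1 - C" using assms by (simp add: R2)
      also have "(1 - C) * (q x)\<^sup>2 / (R\<^sup>2 + (\<rho> x)\<^sup>2) = \<Xi>\<^sup>2 - \<Xi>\<^sup>2 * p\<^sup>2 * ((\<rho> x)\<^sup>2 / (R\<^sup>2 + (\<rho> x)\<^sup>2))"
      proof -
        have A: "\<Xi>\<^sup>2 * p\<^sup>2 = C - (1 - K)" using assms nz by (simp add: \<Xi>2 p2)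
        have B: "\<Xi>\<^sup>2 * R\<^sup>2 = C * (1 - C)" using assms nz by (simp add: \<Xi>2 R2)
        have E: "\<Xi>\<^sup>2 - \<Xi>\<^sup>2 * p\<^sup>2 * ((\<rho> x)\<^sup>2 / (R\<^sup>2 + (\<rho> x)\<^sup>2))
            = (\<Xi>\<^sup>2 * R\<^sup>2 + (\<Xi>\<^sup>2 - \<Xi>\<^sup>2 * p\<^sup>2) * (\<rho> x)\<^sup>2) / (R\<^sup>2 + (\<rho> x)\<^sup>2)"
          by (rule combine_fractions[OF s])
        show ?thesis unfolding E unfolding A B unfolding \<Xi>2 q_sq[OF x] by (simp add: algebra_simps)
      qed
      finally show "(\<phi>' x)\<^sup>2 * Q x =
          \<Xi>\<^sup>2 * (1 - p\<^sup>2 * (sin (arctan (\<rho> x / R)))\<^sup>2) * (v x)\<^sup>2"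
        unfolding sin2 by (simp add: algebra_simps)
      have D: "1 - (1 - R\<^sup>2) * ((\<rho> x)\<^sup>2 / (R\<^sup>2 + (\<rho> x)\<^sup>2)) = R\<^sup>2 * (1 + (\<rho> x)\<^sup>2) / (R\<^sup>2 + (\<rho> x)\<^sup>2)"
        unfolding combine_fractions[OF s] by (simp add: algebra_simps)
      have "\<Xi> * (1 - p\<^sup>2) / (K - 1) * \<Xi> = \<Xi>\<^sup>2 * (1 - p\<^sup>2) / (K - 1)" by (simp add: power2_eq_square)
      also have "\<dots> = - K * R\<^sup>2"
        using assms nz by (simp add: ** R2 \<Xi>2 divide_simps; simp add: algebra_simps)
      finally have E: "\<Xi> * (1 - p\<^sup>2) / (K - 1) * \<Xi> / (R\<^sup>2 * (1 + (\<rho> x)\<^sup>2) / (R\<^sup>2 + (\<rho> x)\<^sup>2))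
          = - (K * (R\<^sup>2 + (\<rho> x)\<^sup>2) / (1 + (\<rho> x)\<^sup>2))"
        using R_pos by simp
      show "\<Xi> * (1 - p\<^sup>2) / (K - 1) * \<Xi> / (1 - \<Xi>\<^sup>2 * p\<^sup>2 / K * (sin (arctan (\<rho> x / R)))\<^sup>2)
          + 0 = - (Q x / (1 + (\<rho> x)\<^sup>2))"
        unfolding sin2 k D E Q by simp
    qed auto
  qed
  ultimately show ?thesis by blast
qed

text \<open>Positivity of \<open>Q\<close> keeps the radius above its zero \<open>R\<close>, and \<open>q\<close> has no zeros, so that
  \<open>\<rho> = R / cos \<phi>\<close> with \<open>\<phi> > 0\<close>.\<close>

lemma profile_between_iv:
  assumes "0 < K" "K < 1" "1 < C"
  shows "\<exists>r \<psi>. cgc_profile K r \<psi> \<and> given_by I f r \<psi>"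
proof -
  define p where "p = sqrt (K * C / (C - (1 - K)))"
  define \<Xi> where "\<Xi> = sqrt (C - (1 - K))"
  define R where "R = sqrt ((C - 1) / K)"
  have nz: "C - (1 - K) > 0" "1 - K > 0" "C > 0" using assms by auto
  have p2: "p\<^sup>2 = K * C / (C - (1 - K))" and \<Xi>2: "\<Xi>\<^sup>2 = C - (1 - K)" and R2: "R\<^sup>2 = (C - 1) / K"
    using assms nz by (simp_all add: p_def \<Xi>_def R_def)
  have pos: "\<Xi> > 0" "R > 0" "p > 0" using assms nz by (simp_all add: \<Xi>_def R_def p_def)
  have "0 < (1 - K) * (C - 1)" using assms by simp
  then have "K * C < C - (1 - K)" by (simp add: algebra_simps)
  then have p_lt: "p < 1" using nz by (simp add: p_def)
  then have p: "0 \<le> p" "p \<le> 1" using pos by auto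
  have "K \<le> K * C / (C - (1 - K))" using assms nz by (simp add: divide_simps)
  then have p_range: "p \<in> {sqrt K..1}" using p by (simp add: p_def)
  have *: "p\<^sup>2 - K = K * (1 - K) / (C - (1 - K))"
    using nz by (simp add: p2 divide_simps; simp add: algebra_simps)
  have **: "1 - p\<^sup>2 = (1 - K) * (C - 1) / (C - (1 - K))"
    using nz by (simp add: p2 divide_simps; simp add: algebra_simps)
  have "K * (1 - K) / (p\<^sup>2 - K) = C - (1 - K)"
    unfolding * using assms nz by simp
  then have \<Xi>_eq: "\<Xi> = sqrt (K * (1 - K) / (p\<^sup>2 - K))" by (simp add: \<Xi>_def)
  have "(1 - p\<^sup>2) / (p\<^sup>2 - K) = (C - 1) / K"
    unfolding * ** using assms nz by (simp add: divide_simps)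
  then have R_eq: "sqrt ((1 - p\<^sup>2) / (p\<^sup>2 - K)) = R" by (simp add: R_def)
  let ?r = "\<lambda>s. R * jacobi_nc p (\<Xi> * s)"
  let ?\<psi> = "\<lambda>s. \<Xi> * (1 - p\<^sup>2) / (K - 1) * ellipticPi (K / \<Xi>\<^sup>2) (\<Xi> * s) p + \<Xi>\<^sup>2 * (1 - p\<^sup>2) / (1 - K) * s"
  have "cgc_profile K ?r ?\<psi>"
    by (rule cgc_profile.between_iv[OF assms(1,2) p_range \<Xi>_eq _ refl]) (use R_eq in auto)
  moreover have "given_by I f ?r ?\<psi>"
  proof -
    have Q: "Q x = K * ((\<rho> x)\<^sup>2 - R\<^sup>2)" for x
    proof -
      have "K * R\<^sup>2 = C - 1" using assms by (simp add: R2)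
      then show ?thesis by (simp add: algebra_simps)
    qed
    have gt: "(\<rho> x)\<^sup>2 > R\<^sup>2" if "x \<in> I" for x
      using Q_pos[OF that] assms unfolding Q by (simp add: zero_less_mult_iff)
    have b: "(R / \<rho> x)\<^sup>2 < 1" if "x \<in> I" for x
      using gt[OF that] \<rho>_pos[OF that] by (simp add: power_divide)
    have d: "((\<lambda>x. R / \<rho> x) has_real_derivative - (R * (q x * v x)) / (\<rho> x)\<^sup>2) (at x)" if "x \<in> I" for x
      using \<rho>_pos[OF that]
      by (auto intro!: derivative_eq_intros \<rho>_deriv[OF that] simp: power2_eq_square)
    have "continuous_on I (\<lambda>x. - (R * (q x * v x)) / (\<rho> x)\<^sup>2)"
      using \<rho>_pos by (intro continuous_intros continuous_\<rho> continuous_q continuous_v) force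
    from arccos_substitution[OF b d this]
    obtain \<phi>' where \<phi>': "\<And>x. x \<in> I \<Longrightarrow> ((\<lambda>x. arccos (R / \<rho> x)) has_real_derivative \<phi>' x) (at x)"
      "continuous_on I \<phi>'"
      "\<And>x. x \<in> I \<Longrightarrow> (\<phi>' x)\<^sup>2 = (- (R * (q x * v x)) / (\<rho> x)\<^sup>2)\<^sup>2 / (1 - (R / \<rho> x)\<^sup>2)" by blast
    have cos: "cos (arccos (R / \<rho> x)) = R / \<rho> x" if "x \<in> I" for x
      by (rule cos_arccos_square[OF b[OF that]])
    then have sin2: "(sin (arccos (R / \<rho> x)))\<^sup>2 = 1 - R\<^sup>2 / (\<rho> x)\<^sup>2" if "x \<in> I" for x
      using that by (simp add: sin_squared_eq power_divide)
    show ?thesis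
    proof (rule given_by_jacobi_profile[OF p pos(1) _ _ \<phi>'(1,2), where a = "\<Xi> * (1 - p\<^sup>2) / (K - 1)"
          and b = "\<Xi>\<^sup>2 * (1 - p\<^sup>2) / (1 - K)"])
      show "K / \<Xi>\<^sup>2 < 1" using assms nz by (simp add: \<Xi>2)
      fix x assume x: "x \<in> I"
      have \<rho>: "(\<rho> x)\<^sup>2 > 0" using \<rho>_pos[OF x] by auto
      show dom: "arccos (R / \<rho> x) \<in> amplitude_domain p" using p_lt by (simp add: amplitude_domain_def)
      show "R * jacobi_nc p (\<Xi> * (ellipticF p (arccos (R / \<rho> x)) / \<Xi>)) = \<rho> x"
        using pos \<rho>_pos[OF x] jacobi_functions_ellipticF(4)[OF p dom] by (simp add: cos[OF x])
      have "(\<phi>' x)\<^sup>2 * Q x = K * R\<^sup>2 * (q x)\<^sup>2 / (\<rho> x)\<^sup>2 * (v x)\<^sup>2"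
        unfolding \<phi>'(3)[OF x] Q power_divide power2_minus power_mult_distrib using gt[OF x] \<rho>
        by (simp add: power2_eq_square[of "(\<rho> x)\<^sup>2"] divide_simps)
      also have "K * R\<^sup>2 = C - 1" using assms by (simp add: R2)
      also have "(C - 1) * (q x)\<^sup>2 / (\<rho> x)\<^sup>2 = \<Xi>\<^sup>2 * (1 - p\<^sup>2 * (1 - R\<^sup>2 / (\<rho> x)\<^sup>2))"
        using assms nz \<rho> by (simp add: q_sq[OF x] \<Xi>2 p2 R2 divide_simps; simp add: algebra_simps)
      finally show "(\<phi>' x)\<^sup>2 * Q x =
          \<Xi>\<^sup>2 * (1 - p\<^sup>2 * (sin (arccos (R / \<rho> x)))\<^sup>2) * (v x)\<^sup>2"
        unfolding sin2[OF x] .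
      have D: "1 - K / \<Xi>\<^sup>2 * (1 - R\<^sup>2 / (\<rho> x)\<^sup>2) = (C - 1) * (1 + (\<rho> x)\<^sup>2) / ((\<rho> x)\<^sup>2 * (C - (1 - K)))"
        using assms nz \<rho> by (simp add: \<Xi>2 R2 divide_simps; simp add: algebra_simps)
      have "\<Xi> * (1 - p\<^sup>2) / (K - 1) * \<Xi> = \<Xi>\<^sup>2 * (1 - p\<^sup>2) / (K - 1)" by (simp add: power2_eq_square)
      moreover have "\<Xi>\<^sup>2 * (1 - p\<^sup>2) = (1 - K) * (C - 1)" unfolding \<Xi>2 ** using nz by simp
      ultimately have E: "\<Xi> * (1 - p\<^sup>2) / (K - 1) * \<Xi> = (1 - K) * (C - 1) / (K - 1)"
        "\<Xi>\<^sup>2 * (1 - p\<^sup>2) / (1 - K) = (1 - K) * (C - 1) / (1 - K)" by (simp_all only:)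
      show "\<Xi> * (1 - p\<^sup>2) / (K - 1) * \<Xi> / (1 - K / \<Xi>\<^sup>2 * (sin (arccos (R / \<rho> x)))\<^sup>2)
          + \<Xi>\<^sup>2 * (1 - p\<^sup>2) / (1 - K) = - (Q x / (1 + (\<rho> x)\<^sup>2))"
        unfolding sin2[OF x] D E using assms nz \<rho> by (simp add: divide_simps one_plus_\<rho>_sq; simp add: algebra_simps)
    qed auto
  qed
  ultimately show ?thesis by blast
qed

text \<open>The radius may pass through its maximum \<open>R\<close>, the zero of \<open>P\<close>, where \<open>q = S sin \<phi>\<close> changes sign.
  Here \<open>Q\<close> is positive for all radii, and \<open>\<rho> = R cos \<phi>\<close>.\<close>

lemma profile_above_i:
  assumes "1 < K" "0 < C" "C < 1"
  shows "\<exists>r \<psi>. cgc_profile K r \<psi> \<and> given_by I f r \<psi>"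
proof -
  define p where "p = sqrt (C * K / (K - 1 + C))"
  define \<Xi> where "\<Xi> = sqrt (K - 1 + C)"
  define R where "R = sqrt (C / (K - 1))"
  define S where "S = sqrt C"
  have nz: "K - 1 + C > 0" "K - 1 > 0" "K > 0" using assms by auto
  have p2: "p\<^sup>2 = C * K / (K - 1 + C)" and \<Xi>2: "\<Xi>\<^sup>2 = K - 1 + C" and R2: "R\<^sup>2 = C / (K - 1)" and S2: "S\<^sup>2 = C"
    using assms nz by (simp_all add: p_def \<Xi>_def R_def S_def)
  have pos: "\<Xi> > 0" "R > 0" "p > 0" "S > 0" using assms nz by (simp_all add: \<Xi>_def R_def p_def S_def)
  have "0 < (K - 1) * (1 - C)" using assms by simp
  then have "C * K < K - 1 + C" by (simp add: algebra_simps)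
  then have p_lt: "p < 1" using nz by (simp add: p_def)
  then have p: "0 \<le> p" "p \<le> 1" using pos by auto
  then have p_range: "p \<in> {0..1}" by simp
  have *: "K - p\<^sup>2 = K * (K - 1) / (K - 1 + C)"
    using nz by (simp add: p2 divide_simps; simp add: algebra_simps)
  have "K * (K - 1) / (K - p\<^sup>2) = K - 1 + C"
    unfolding * using assms nz by simp
  then have \<Xi>_eq: "\<Xi> = sqrt (K * (K - 1) / (K - p\<^sup>2))" by (simp add: \<Xi>_def)
  have "p\<^sup>2 / (K - p\<^sup>2) = C / (K - 1)"
    unfolding * unfolding p2 using assms nz by (simp add: divide_simps)
  then have R_eq: "sqrt (p\<^sup>2 / (K - p\<^sup>2)) = R" by (simp add: R_def)
  let ?r = "\<lambda>s. R * jacobi_cn p (\<Xi> * s)"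
  let ?\<psi> = "\<lambda>s. (K - 1) / \<Xi> * ellipticPi (p\<^sup>2 / K) (\<Xi> * s) p - K * s"
  have "cgc_profile K ?r ?\<psi>"
    by (rule cgc_profile.above_i[OF assms(1) p_range \<Xi>_eq _ refl]) (use R_eq in auto)
  moreover have "given_by I f ?r ?\<psi>"
  proof -
    have cq: "1 - (q x / S)\<^sup>2 = (\<rho> x)\<^sup>2 / R\<^sup>2" if "x \<in> I" for x
      using assms nz by (simp add: power_divide S2 R2 q_sq[OF that] divide_simps; simp add: algebra_simps)
    have b: "(q x / S)\<^sup>2 < 1" if "x \<in> I" for x
    proof -
      have "(\<rho> x)\<^sup>2 / R\<^sup>2 > 0" using \<rho>_pos[OF that] pos by simp
      then show ?thesis using cq[OF that] by simp
    qed
    have d: "((\<lambda>x. q x / S) has_real_derivative (1 - K) * \<rho> x * v x / S) (at x)" if "x \<in> I" for x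
      by (intro DERIV_cdivide q_deriv that)
    have "continuous_on I (\<lambda>x. (1 - K) * \<rho> x * v x / S)"
      using pos by (intro continuous_intros continuous_\<rho> continuous_v) auto
    from arcsin_substitution[OF b d this]
    obtain \<phi>' where \<phi>': "\<And>x. x \<in> I \<Longrightarrow> ((\<lambda>x. arcsin (q x / S)) has_real_derivative \<phi>' x) (at x)"
      "continuous_on I \<phi>'"
      "\<And>x. x \<in> I \<Longrightarrow> (\<phi>' x)\<^sup>2 = ((1 - K) * \<rho> x * v x / S)\<^sup>2 / (1 - (q x / S)\<^sup>2)" by blast
    have cos: "cos (arcsin (q x / S)) = \<rho> x / R" if "x \<in> I" for x
      using pos \<rho>_pos[OF that] by (simp add: cos_arcsin_square[OF b[OF that]] cq[OF that] real_sqrt_divide)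
    have sin2: "(sin (arcsin (q x / S)))\<^sup>2 = (q x)\<^sup>2 / C" if "x \<in> I" for x
      using sin_arcsin_square[OF b[OF that]] by (simp add: power_divide S2)
    show ?thesis
    proof (rule given_by_jacobi_profile[OF p pos(1) _ _ \<phi>'(1,2), where a = "(K - 1) / \<Xi>" and b = "- K"])
      show "p\<^sup>2 / K < 1" using assms nz by (simp add: p2)
      fix x assume x: "x \<in> I"
      have \<rho>: "(\<rho> x)\<^sup>2 > 0" "R\<^sup>2 > 0" using \<rho>_pos[OF x] pos by auto
      show dom: "arcsin (q x / S) \<in> amplitude_domain p" using p_lt by (simp add: amplitude_domain_def)
      show "R * jacobi_cn p (\<Xi> * (ellipticF p (arcsin (q x / S)) / \<Xi>)) = \<rho> x"
        using pos jacobi_functions_ellipticF(2)[OF p dom] by (simp add: cos[OF x])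
      have "(\<phi>' x)\<^sup>2 = (K - 1)\<^sup>2 * R\<^sup>2 / S\<^sup>2 * (v x)\<^sup>2"
        unfolding \<phi>'(3)[OF x] cq[OF x]
        unfolding power_divide power_mult_distrib power2_commute[of 1 K] using \<rho>
        by (simp add: divide_simps)
      also have "(K - 1)\<^sup>2 * R\<^sup>2 / S\<^sup>2 = K - 1"
        unfolding R2 S2 using assms nz by (simp add: power2_eq_square)
      finally have "(\<phi>' x)\<^sup>2 * Q x =
          ((K - 1) * Q x) * (v x)\<^sup>2" by simp
      also have "(K - 1) * Q x = \<Xi>\<^sup>2 * (1 - p\<^sup>2 * ((q x)\<^sup>2 / C))"
        using assms nz by (simp add: q_sq[OF x] \<Xi>2 p2 divide_simps; simp add: algebra_simps)
      finally show "(\<phi>' x)\<^sup>2 * Q x =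
          \<Xi>\<^sup>2 * (1 - p\<^sup>2 * (sin (arcsin (q x / S)))\<^sup>2) * (v x)\<^sup>2"
        unfolding sin2[OF x] .
      have D: "1 - p\<^sup>2 / K * ((q x)\<^sup>2 / C) = (K - 1) * (1 + (\<rho> x)\<^sup>2) / (K - 1 + C)"
        using assms nz by (simp add: q_sq[OF x] p2 divide_simps; simp add: algebra_simps)
      show "(K - 1) / \<Xi> * \<Xi> / (1 - p\<^sup>2 / K * (sin (arcsin (q x / S)))\<^sup>2) + - K =
          - (Q x / (1 + (\<rho> x)\<^sup>2))"
        unfolding sin2[OF x] D using assms nz pos by (simp add: divide_simps one_plus_\<rho>_sq; simp add: algebra_simps)
    qed auto
  qed
  ultimately show ?thesis by blast
qed

text \<open>The radius may again pass through its maximum \<open>R\<close>, but it is now bounded below by the zero of \<open>Q\<close>,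
  at which \<open>\<bar>q\<bar>\<close> takes the value \<open>W\<close>; therefore \<open>q = W sin \<phi>\<close>.\<close>

lemma profile_above_ii:
  assumes "1 < K" "1 < C"
  shows "\<exists>r \<psi>. cgc_profile K r \<psi> \<and> given_by I f r \<psi>"
proof -
  define p where "p = sqrt ((K - 1 + C) / (K * C))"
  define \<Xi> where "\<Xi> = sqrt (K * C)"
  define R where "R = sqrt (C / (K - 1))"
  define W where "W = sqrt ((K - 1 + C) / K)"
  have nz: "K - 1 + C > 0" "K - 1 > 0" "K > 0" "C > 0" using assms by auto
  have p2: "p\<^sup>2 = (K - 1 + C) / (K * C)" and \<Xi>2: "\<Xi>\<^sup>2 = K * C" and R2: "R\<^sup>2 = C / (K - 1)"
    and W2: "W\<^sup>2 = (K - 1 + C) / K"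
    using assms nz by (simp_all add: p_def \<Xi>_def R_def W_def)
  have pos: "\<Xi> > 0" "R > 0" "p > 0" "W > 0" using assms nz by (simp_all add: \<Xi>_def R_def p_def W_def)
  have "0 < (K - 1) * (C - 1)" using assms by simp
  then have "K - 1 + C < K * C" by (simp add: algebra_simps)
  then have p_lt: "p < 1" using nz by (simp add: p_def)
  then have p: "0 \<le> p" "p \<le> 1" using pos by auto
  have "1 / K \<le> (K - 1 + C) / (K * C)" using assms nz by (simp add: divide_simps)
  then have p_range: "p \<in> {sqrt (1 / K)..1}" unfolding p_def using p(2)[unfolded p_def] by simp
  have *: "K * p\<^sup>2 - 1 = (K - 1) / C"
    using nz by (simp add: p2 divide_simps)
  have "K * (K - 1) / (K * p\<^sup>2 - 1) = K * C"
    unfolding * using assms nz by simp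
  then have \<Xi>_eq: "\<Xi> = sqrt (K * (K - 1) / (K * p\<^sup>2 - 1))" by (simp add: \<Xi>_def)
  have "1 / (K * p\<^sup>2 - 1) = C / (K - 1)" unfolding * by simp
  then have R_eq: "sqrt (1 / (K * p\<^sup>2 - 1)) = R" by (simp add: R_def)
  let ?r = "\<lambda>s. R * jacobi_dn p (\<Xi> * s)"
  let ?\<psi> = "\<lambda>s. (K - 1) / \<Xi> * ellipticPi (1 / K) (\<Xi> * s) p - K * s"
  have "cgc_profile K ?r ?\<psi>"
    by (rule cgc_profile.above_ii[OF assms(1) p_range \<Xi>_eq _ refl]) (use R_eq in auto)
  moreover have "given_by I f ?r ?\<psi>"
  proof -
    have Q: "(K - 1) * Q x = K * (W\<^sup>2 - (q x)\<^sup>2)" if "x \<in> I" for x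
      using nz by (simp add: W2 q_sq[OF that] divide_simps; simp add: algebra_simps)
    have W: "W\<^sup>2 - (q x)\<^sup>2 > 0" if "x \<in> I" for x
    proof -
      have "K * (W\<^sup>2 - (q x)\<^sup>2) > 0" unfolding Q[OF that, symmetric] using Q_pos[OF that] nz by simp
      then show ?thesis using nz zero_less_mult_pos[of K "W\<^sup>2 - (q x)\<^sup>2"] by simp
    qed
    have b: "(q x / W)\<^sup>2 < 1" if "x \<in> I" for x
      using W[OF that] pos by (simp add: power_divide)
    have d: "((\<lambda>x. q x / W) has_real_derivative (1 - K) * \<rho> x * v x / W) (at x)" if "x \<in> I" for x
      by (intro DERIV_cdivide q_deriv that)
    have "continuous_on I (\<lambda>x. (1 - K) * \<rho> x * v x / W)"
      using pos by (intro continuous_intros continuous_\<rho> continuous_v) auto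
    from arcsin_substitution[OF b d this]
    obtain \<phi>' where \<phi>': "\<And>x. x \<in> I \<Longrightarrow> ((\<lambda>x. arcsin (q x / W)) has_real_derivative \<phi>' x) (at x)"
      "continuous_on I \<phi>'"
      "\<And>x. x \<in> I \<Longrightarrow> (\<phi>' x)\<^sup>2 = ((1 - K) * \<rho> x * v x / W)\<^sup>2 / (1 - (q x / W)\<^sup>2)" by blast
    have sin2: "(sin (arcsin (q x / W)))\<^sup>2 = (q x)\<^sup>2 / W\<^sup>2" if "x \<in> I" for x
    proof -
      have "sin (arcsin (q x / W)) = q x / W" by (rule sin_arcsin_square[OF b[OF that]])
      then show ?thesis by (simp add: power_divide)
    qed
    have dn2: "1 - p\<^sup>2 * ((q x)\<^sup>2 / W\<^sup>2) = (\<rho> x)\<^sup>2 / R\<^sup>2" if "x \<in> I" for x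
      using assms nz by (simp add: p2 W2 R2 q_sq[OF that] divide_simps; simp add: algebra_simps)
    show ?thesis
    proof (rule given_by_jacobi_profile[OF p pos(1) _ _ \<phi>'(1,2), where a = "(K - 1) / \<Xi>" and b = "- K"])
      show "1 / K < 1" using assms by simp
      fix x assume x: "x \<in> I"
      show dom: "arcsin (q x / W) \<in> amplitude_domain p" using p_lt by (simp add: amplitude_domain_def)
      have "R * sqrt ((\<rho> x)\<^sup>2 / R\<^sup>2) = \<rho> x" using pos \<rho>_pos[OF x] by (simp add: real_sqrt_divide)
      moreover have c: "\<Xi> * (ellipticF p (arcsin (q x / W)) / \<Xi>) = ellipticF p (arcsin (q x / W))" using pos by simp
      ultimately show "R * jacobi_dn p (\<Xi> * (ellipticF p (arcsin (q x / W)) / \<Xi>)) = \<rho> x"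
        by (simp only: jacobi_functions_ellipticF(3)[OF p dom] sin2[OF x] dn2[OF x] c)
      have "(\<phi>' x)\<^sup>2 * ((K - 1) * Q x) = K * (K - 1)\<^sup>2 * (\<rho> x)\<^sup>2 * (v x)\<^sup>2"
        unfolding \<phi>'(3)[OF x] Q[OF x] power2_commute[of K 1] using W[OF x] pos
        by (simp add: power_divide power_mult_distrib divide_simps)
      then have "(K - 1) * ((\<phi>' x)\<^sup>2 * Q x) = (K - 1) * (K * (K - 1) * (\<rho> x)\<^sup>2 * (v x)\<^sup>2)"
        by (simp only: power2_eq_square[of "K - 1"] mult_ac)
      moreover have "K - 1 \<noteq> 0" using nz by simp
      ultimately have "(\<phi>' x)\<^sup>2 * Q x = K * (K - 1) * (\<rho> x)\<^sup>2 * (v x)\<^sup>2"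
        using mult_left_cancel by blast
      also have "K * (K - 1) * (\<rho> x)\<^sup>2 = \<Xi>\<^sup>2 * ((\<rho> x)\<^sup>2 / R\<^sup>2)"
        using assms nz by (simp add: \<Xi>2 R2 divide_simps)
      finally show "(\<phi>' x)\<^sup>2 * Q x =
          \<Xi>\<^sup>2 * (1 - p\<^sup>2 * (sin (arcsin (q x / W)))\<^sup>2) * (v x)\<^sup>2"
        unfolding sin2[OF x] dn2[OF x] .
      have D: "1 - 1 / K * ((q x)\<^sup>2 / W\<^sup>2) = (K - 1) * (1 + (\<rho> x)\<^sup>2) / (K - 1 + C)"
        using assms nz by (simp add: W2 q_sq[OF x] divide_simps; simp add: algebra_simps)
      show "(K - 1) / \<Xi> * \<Xi> / (1 - 1 / K * (sin (arcsin (q x / W)))\<^sup>2) + - K =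
          - (Q x / (1 + (\<rho> x)\<^sup>2))"
        unfolding sin2[OF x] D using assms nz pos by (simp add: divide_simps one_plus_\<rho>_sq; simp add: algebra_simps)
    qed auto
  qed
  ultimately show ?thesis by blast
qed

end


section \<open>Profiles given by hyperbolic functions\<close>

lemma abs_mult_tanh_less_one:
  fixes p y :: real
  assumes "0 < p" "p < 1"
  shows "\<bar>p * tanh y\<bar> < 1"
proof -
  have "\<bar>tanh y\<bar> < 1" using tanh_real_lt_1[of y] tanh_real_gt_neg1[of y] by linarith
  then have "p * \<bar>tanh y\<bar> < 1 * 1" using assms by (intro mult_strict_mono) auto
  then show ?thesis using assms by (simp add: abs_mult)
qed

context rotational_cgc
begin

text \<open>For \<open>C = 0\<close> the equation \<open>(dr/ds)\<^sup>2 = P(r) Q(r)\<close> is elementary, since \<open>1 / r\<close> is proportional to a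
  hyperbolic sine.\<close>

lemma profile_between_limit:
  assumes "0 < K" "K < 1" "C = 0"
  shows "\<exists>r \<psi>. limit_profile K r \<psi> \<and> given_by I f r \<psi>"
proof -
  let ?r = "\<lambda>s. 1 / (sqrt K * sinh (sqrt (1 - K) * s))"
  let ?\<psi> = "\<lambda>s. s - artanh (sqrt (1 - K) * tanh (sqrt (1 - K) * s))"
  define a where "a = sqrt K"
  define m where "m = sqrt (1 - K)"
  have am: "a > 0" "m > 0" "m < 1" "a\<^sup>2 = K" "m\<^sup>2 = 1 - K" using assms by (simp_all add: a_def m_def)
  have "given_by I f ?r ?\<psi>"
  proof (rule given_by_profile[where \<tau> = "\<lambda>x. arsinh (1 / (a * \<rho> x)) / m" and \<kappa> = 1
        and \<tau>' = "\<lambda>x. 1 / sqrt ((1 / (a * \<rho> x))\<^sup>2 + 1) * (- (q x * v x) / (a * (\<rho> x)\<^sup>2)) / m"])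
    have "(1 / (a * \<rho> x))\<^sup>2 + 1 > 0" for x by (simp add: add_nonneg_pos)
    then have "sqrt ((1 / (a * \<rho> x))\<^sup>2 + 1) \<noteq> 0" for x by (metis real_sqrt_gt_zero less_irrefl)
    moreover have "a * (\<rho> x)\<^sup>2 \<noteq> 0" "a * \<rho> x \<noteq> 0" if "x \<in> I" for x
      using am \<rho>_pos[OF that] by auto
    ultimately show "continuous_on I (\<lambda>x. 1 / sqrt ((1 / (a * \<rho> x))\<^sup>2 + 1) * (- (q x * v x) / (a * (\<rho> x)\<^sup>2)) / m)"
      using am by (intro continuous_intros continuous_q continuous_v continuous_\<rho>) auto
    fix x assume x: "x \<in> I"
    have \<rho>: "\<rho> x > 0" by (rule \<rho>_pos[OF x])
    have d: "((\<lambda>x. 1 / (a * \<rho> x)) has_real_derivative - (q x * v x) / (a * (\<rho> x)\<^sup>2)) (at x)"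
      using \<rho> am by (auto intro!: derivative_eq_intros \<rho>_deriv[OF x] simp: power2_eq_square)
    show "((\<lambda>x. arsinh (1 / (a * \<rho> x)) / m) has_real_derivative
        1 / sqrt ((1 / (a * \<rho> x))\<^sup>2 + 1) * (- (q x * v x) / (a * (\<rho> x)\<^sup>2)) / m) (at x)"
      by (intro DERIV_cdivide DERIV_chain2[OF arsinh_real_has_field_derivative d])
    have Q: "K * (\<rho> x)\<^sup>2 + 1 > 0" using assms by (simp add: add_nonneg_pos)
    have S: "(1 / (a * \<rho> x))\<^sup>2 + 1 = (K * (\<rho> x)\<^sup>2 + 1) / (K * (\<rho> x)\<^sup>2)"
      using am \<rho> assms by (simp add: power_divide power_mult_distrib divide_simps)
    have "(1 / sqrt ((1 / (a * \<rho> x))\<^sup>2 + 1) * (- (q x * v x) / (a * (\<rho> x)\<^sup>2)) / m)\<^sup>2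
        = (v x)\<^sup>2 / (K * (\<rho> x)\<^sup>2 + 1)"
      unfolding S using Q assms \<rho>
      by (simp add: power_divide power_mult_distrib am(4,5) q_sq[OF x]; simp add: power4_eq_xxxx power2_eq_square)
    then show "(1 / sqrt ((1 / (a * \<rho> x))\<^sup>2 + 1) * (- (q x * v x) / (a * (\<rho> x)\<^sup>2)) / m)\<^sup>2
        * Q x = (v x)\<^sup>2"
      using Q assms by simp
    let ?s = "arsinh (1 / (a * \<rho> x)) / m"
    have ms: "m * ?s = arsinh (1 / (a * \<rho> x))" using am by simp
    have sinh: "sinh (m * ?s) = 1 / (a * \<rho> x)" unfolding ms by (rule sinh_arsinh_real)
    then show "1 / (sqrt K * sinh (sqrt (1 - K) * ?s)) = \<rho> x"
      using am \<rho> by (simp flip: a_def m_def)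
    have cosh2: "(cosh (m * ?s))\<^sup>2 = (K * (\<rho> x)\<^sup>2 + 1) / (K * (\<rho> x)\<^sup>2)"
      unfolding cosh_square_eq sinh S ..
    have tanh2: "(tanh (m * ?s))\<^sup>2 = 1 / (K * (\<rho> x)\<^sup>2 + 1)"
      unfolding tanh_def power_divide cosh2 sinh using am Q \<rho> assms
      by (simp add: power_mult_distrib power_divide)
    have t: "\<bar>m * tanh (m * ?s)\<bar> < 1"
      using am by (intro abs_mult_tanh_less_one)
    have "((\<lambda>s. s - artanh (m * tanh (m * s))) has_real_derivative
        1 - 1 / (1 - (m * tanh (m * ?s))\<^sup>2) * (m * ((1 - (tanh (m * ?s))\<^sup>2) * m))) (at ?s)"
      using t by (auto intro!: derivative_eq_intros DERIV_chain2[OF artanh_real_has_field_derivative])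
    moreover have "1 - 1 / (1 - (m * tanh (m * ?s))\<^sup>2) * (m * ((1 - (tanh (m * ?s))\<^sup>2) * m))
        = Q x / (1 + (\<rho> x)\<^sup>2)"
    proof -
      have "1 - 1 / (1 - (m * tanh (m * ?s))\<^sup>2) * (m * ((1 - (tanh (m * ?s))\<^sup>2) * m))
          = 1 - m\<^sup>2 * (1 - (tanh (m * ?s))\<^sup>2) / (1 - m\<^sup>2 * (tanh (m * ?s))\<^sup>2)"
        by (simp add: power2_eq_square mult_ac)
      also have "\<dots> = 1 - m\<^sup>2 * (K * (\<rho> x)\<^sup>2 / (K * (\<rho> x)\<^sup>2 + 1)) / (K * (1 + (\<rho> x)\<^sup>2) / (K * (\<rho> x)\<^sup>2 + 1))"
      proof -
        have "1 - (tanh (m * ?s))\<^sup>2 = K * (\<rho> x)\<^sup>2 / (K * (\<rho> x)\<^sup>2 + 1)"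
          unfolding tanh2 using Q by (simp add: divide_simps)
        moreover have "1 - m\<^sup>2 * (tanh (m * ?s))\<^sup>2 = K * (1 + (\<rho> x)\<^sup>2) / (K * (\<rho> x)\<^sup>2 + 1)"
          unfolding tanh2 am(5) using Q by (simp add: divide_simps; simp add: algebra_simps)
        ultimately show ?thesis by (simp only:)
      qed
      also have "\<dots> = 1 - (1 - K) * (\<rho> x)\<^sup>2 / (1 + (\<rho> x)\<^sup>2)"
        unfolding am(5) using Q assms by simp
      also have "\<dots> = Q x / (1 + (\<rho> x)\<^sup>2)"
      proof -
        have "1 + (\<rho> x)\<^sup>2 > 0" by (simp add: add_pos_nonneg)
        then show ?thesis using assms by (simp add: divide_simps; simp add: algebra_simps)
      qed
      finally show ?thesis .
    qed
    ultimately show "(?\<psi> has_real_derivative 1 * (Q x / (1 + (\<rho> x)\<^sup>2))) (at ?s)"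
      unfolding m_def[symmetric] by (simp only: mult_1)
  qed simp
  moreover have "limit_profile K ?r ?\<psi>"
    by (rule limit_profile.between_limit[OF assms(1,2) refl refl])
  ultimately show ?thesis by blast
qed

text \<open>For \<open>K = 1\<close> the function \<open>q\<close> is constant, and \<open>C > 1\<close> keeps the radius above the zero \<open>R\<close> of \<open>Q\<close>.\<close>

lemma profile_one_i:
  assumes "K = 1" "1 < C"
  shows "\<exists>r \<psi>. cgc_profile K r \<psi> \<and> given_by I f r \<psi>"
proof -
  define p where "p = 1 / sqrt C"
  define R where "R = sqrt (C - 1)"
  have p: "0 < p" "p < 1" and p2: "p\<^sup>2 = 1 / C" and R: "R > 0" and R2: "R\<^sup>2 = C - 1"
    using assms by (simp_all add: p_def R_def power_divide)
  have "(1 - p\<^sup>2) / p\<^sup>2 = C - 1" using assms by (simp add: p2 divide_simps)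
  then have R_eq: "sqrt ((1 - p\<^sup>2) / p\<^sup>2) = R" by (simp add: R_def)
  let ?r = "\<lambda>s. R * cosh (s / p)"
  let ?\<psi> = "\<lambda>s. s - artanh (p * tanh (s / p))"
  have "cgc_profile K ?r ?\<psi>"
    by (rule cgc_profile.one_i_snowman[OF assms(1) _ _ refl, of p]) (use p R_eq in auto)
  moreover have "given_by I f ?r ?\<psi>"
  proof (rule given_by_profile[where \<tau> = "\<lambda>x. p * arcosh (\<rho> x / R)" and \<kappa> = 1
        and \<tau>' = "\<lambda>x. p * (1 / sqrt ((\<rho> x / R)\<^sup>2 - 1) * (q x * v x / R))"])
    have gt: "(\<rho> x)\<^sup>2 > R\<^sup>2" if "x \<in> I" for x using Q_pos[OF that] assms by (simp add: R2)
    have u: "\<rho> x / R > 1" if "x \<in> I" for x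
      using power2_less_imp_less[OF gt[OF that]] R \<rho>_pos[OF that] by simp
    have D: "(\<rho> x / R)\<^sup>2 - 1 = ((\<rho> x)\<^sup>2 - R\<^sup>2) / R\<^sup>2" for x
      using R by (simp add: power_divide divide_simps)
    have "sqrt ((\<rho> x / R)\<^sup>2 - 1) \<noteq> 0" if "x \<in> I" for x
      unfolding D using gt[OF that] R by simp
    then show "continuous_on I (\<lambda>x. p * (1 / sqrt ((\<rho> x / R)\<^sup>2 - 1) * (q x * v x / R)))"
      using R by (intro continuous_intros continuous_q continuous_v continuous_\<rho>) auto
    fix x assume x: "x \<in> I"
    have \<rho>: "\<rho> x > 0" by (rule \<rho>_pos[OF x])
    show "((\<lambda>x. p * arcosh (\<rho> x / R)) has_real_derivative
        p * (1 / sqrt ((\<rho> x / R)\<^sup>2 - 1) * (q x * v x / R))) (at x)"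
      by (intro DERIV_cmult DERIV_chain2[OF arcosh_real_has_field_derivative] DERIV_cdivide \<rho>_deriv x u)
    have q2: "(q x)\<^sup>2 = C" using q_sq[OF x] assms by simp
    have "(p * (1 / sqrt ((\<rho> x / R)\<^sup>2 - 1) * (q x * v x / R)))\<^sup>2 = (v x)\<^sup>2 / ((\<rho> x)\<^sup>2 - R\<^sup>2)"
      unfolding D using gt[OF x] R assms by (simp add: power_mult_distrib power_divide p2 q2)
    moreover have "Q x = (\<rho> x)\<^sup>2 - R\<^sup>2" using assms by (simp add: R2)
    moreover have "(\<rho> x)\<^sup>2 - R\<^sup>2 \<noteq> 0" using gt[OF x] by simp
    ultimately show "(p * (1 / sqrt ((\<rho> x / R)\<^sup>2 - 1) * (q x * v x / R)))\<^sup>2 * Q x = (v x)\<^sup>2"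
      by (metis nonzero_eq_divide_eq)
    let ?s = "p * arcosh (\<rho> x / R)"
    have sp: "?s / p = arcosh (\<rho> x / R)" using p by simp
    have cosh: "cosh (?s / p) = \<rho> x / R" unfolding sp using u[OF x] by (intro cosh_arcosh_real) simp
    then show "R * cosh (?s / p) = \<rho> x" using R by simp
    have tanh2: "(tanh (?s / p))\<^sup>2 = 1 - R\<^sup>2 / (\<rho> x)\<^sup>2"
      unfolding tanh_def power_divide sinh_square_eq cosh using R \<rho> by (simp add: power_divide divide_simps)
    have t: "\<bar>p * tanh (?s / p)\<bar> < 1"
      using p by (intro abs_mult_tanh_less_one)
    have "(?\<psi> has_real_derivative
        1 - 1 / (1 - (p * tanh (?s / p))\<^sup>2) * (p * ((1 - (tanh (?s / p))\<^sup>2) * (1 / p)))) (at ?s)"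
      using t p by (auto intro!: derivative_eq_intros DERIV_chain2[OF artanh_real_has_field_derivative])
    moreover have "1 - 1 / (1 - (p * tanh (?s / p))\<^sup>2) * (p * ((1 - (tanh (?s / p))\<^sup>2) * (1 / p)))
        = 1 * (Q x / (1 + (\<rho> x)\<^sup>2))"
    proof -
      have w: "1 + (\<rho> x)\<^sup>2 > 0" by (simp add: add_pos_nonneg)
      have "1 - 1 / (1 - (p * tanh (?s / p))\<^sup>2) * (p * ((1 - (tanh (?s / p))\<^sup>2) * (1 / p)))
          = 1 - (1 - (tanh (?s / p))\<^sup>2) / (1 - p\<^sup>2 * (tanh (?s / p))\<^sup>2)"
        using p(1) by (simp add: power_mult_distrib)
      also have "\<dots> = 1 - R\<^sup>2 / (\<rho> x)\<^sup>2 / (R\<^sup>2 * (1 + (\<rho> x)\<^sup>2) / (C * (\<rho> x)\<^sup>2))"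
      proof -
        have "1 - (tanh (?s / p))\<^sup>2 = R\<^sup>2 / (\<rho> x)\<^sup>2" unfolding tanh2 by simp
        moreover have "1 - p\<^sup>2 * (tanh (?s / p))\<^sup>2 = R\<^sup>2 * (1 + (\<rho> x)\<^sup>2) / (C * (\<rho> x)\<^sup>2)"
          unfolding tanh2 p2 R2 using assms \<rho> by (simp add: divide_simps; simp add: algebra_simps)
        ultimately show ?thesis by (simp only:)
      qed
      also have "\<dots> = 1 - C / (1 + (\<rho> x)\<^sup>2)" using R \<rho> assms by simp
      also have "\<dots> = 1 * (Q x / (1 + (\<rho> x)\<^sup>2))"
        using w assms by (simp add: divide_simps)
      finally show ?thesis .
    qed
    ultimately show "(?\<psi> has_real_derivative 1 * (Q x / (1 + (\<rho> x)\<^sup>2))) (at ?s)"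
      by (simp only:)
  qed simp
  ultimately show ?thesis by blast
qed

lemma profile_one_ii:
  assumes "K = 1" "0 < C" "C < 1"
  shows "\<exists>r \<psi>. cgc_profile K r \<psi> \<and> given_by I f r \<psi>"
proof -
  define p where "p = sqrt C"
  define R where "R = sqrt (1 - C)"
  have p: "0 < p" "p < 1" and p2: "p\<^sup>2 = C" and R: "R > 0" and R2: "R\<^sup>2 = 1 - C"
    using assms by (simp_all add: p_def R_def)
  have R_eq: "sqrt (1 - p\<^sup>2) = R" by (simp add: R_def p2)
  let ?r = "\<lambda>s. R * sinh (p * s)"
  let ?\<psi> = "\<lambda>s. s - artanh (p * tanh (p * s))"
  have "cgc_profile K ?r ?\<psi>"
    by (rule cgc_profile.one_ii_hourglass[OF assms(1) _ _ refl, of p]) (use p R_eq in auto)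
  moreover have "given_by I f ?r ?\<psi>"
  proof (rule given_by_profile[where \<tau> = "\<lambda>x. arsinh (\<rho> x / R) / p" and \<kappa> = 1
        and \<tau>' = "\<lambda>x. 1 / sqrt ((\<rho> x / R)\<^sup>2 + 1) * (q x * v x / R) / p"])
    have Q: "(\<rho> x)\<^sup>2 + R\<^sup>2 > 0" for x using R by (simp add: add_nonneg_pos)
    have D: "(\<rho> x / R)\<^sup>2 + 1 = ((\<rho> x)\<^sup>2 + R\<^sup>2) / R\<^sup>2" for x
      using R by (simp add: power_divide divide_simps)
    have "sqrt ((\<rho> x / R)\<^sup>2 + 1) \<noteq> 0" for x
      unfolding D real_sqrt_eq_zero_cancel_iff using Q[of x] R by (metis divide_eq_0_iff less_irrefl power_not_zero)
    then show "continuous_on I (\<lambda>x. 1 / sqrt ((\<rho> x / R)\<^sup>2 + 1) * (q x * v x / R) / p)"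
      using R p by (intro continuous_intros continuous_q continuous_v continuous_\<rho>) auto
    fix x assume x: "x \<in> I"
    have \<rho>: "\<rho> x > 0" by (rule \<rho>_pos[OF x])
    show "((\<lambda>x. arsinh (\<rho> x / R) / p) has_real_derivative
        1 / sqrt ((\<rho> x / R)\<^sup>2 + 1) * (q x * v x / R) / p) (at x)"
      by (intro DERIV_cdivide DERIV_chain2[OF arsinh_real_has_field_derivative] \<rho>_deriv x)
    have q2: "(q x)\<^sup>2 = C" using q_sq[OF x] assms by simp
    have "(1 / sqrt ((\<rho> x / R)\<^sup>2 + 1) * (q x * v x / R) / p)\<^sup>2 = (v x)\<^sup>2 / ((\<rho> x)\<^sup>2 + R\<^sup>2)"
      unfolding D unfolding power_mult_distrib power_divide real_sqrt_divide q2 p2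
      using Q[of x] R assms by simp
    moreover have "Q x = (\<rho> x)\<^sup>2 + R\<^sup>2" using assms by (simp add: R2)
    ultimately show "(1 / sqrt ((\<rho> x / R)\<^sup>2 + 1) * (q x * v x / R) / p)\<^sup>2 * Q x = (v x)\<^sup>2"
      using Q[of x] by (metis less_irrefl nonzero_divide_eq_eq)
    let ?s = "arsinh (\<rho> x / R) / p"
    have ps: "p * ?s = arsinh (\<rho> x / R)" using p by simp
    have sinh: "sinh (p * ?s) = \<rho> x / R" unfolding ps by (rule sinh_arsinh_real)
    then show "R * sinh (p * ?s) = \<rho> x" using R by simp
    have tanh2: "(tanh (p * ?s))\<^sup>2 = (\<rho> x)\<^sup>2 / ((\<rho> x)\<^sup>2 + R\<^sup>2)"
      unfolding tanh_def power_divide unfolding cosh_square_eq sinh unfolding D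
      using R by (simp add: power_divide)
    have t: "\<bar>p * tanh (p * ?s)\<bar> < 1"
      using p by (intro abs_mult_tanh_less_one)
    have "(?\<psi> has_real_derivative
        1 - 1 / (1 - (p * tanh (p * ?s))\<^sup>2) * (p * ((1 - (tanh (p * ?s))\<^sup>2) * p))) (at ?s)"
      using t p by (auto intro!: derivative_eq_intros DERIV_chain2[OF artanh_real_has_field_derivative])
    moreover have "1 - 1 / (1 - (p * tanh (p * ?s))\<^sup>2) * (p * ((1 - (tanh (p * ?s))\<^sup>2) * p))
        = 1 * (Q x / (1 + (\<rho> x)\<^sup>2))"
    proof -
      define d where "d = (\<rho> x)\<^sup>2 + R\<^sup>2"
      have d: "d > 0" "(\<rho> x)\<^sup>2 = d - R\<^sup>2" using Q[of x] by (simp_all add: d_def)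
      have w: "1 + (\<rho> x)\<^sup>2 > 0" by (simp add: add_pos_nonneg)
      have "1 - 1 / (1 - (p * tanh (p * ?s))\<^sup>2) * (p * ((1 - (tanh (p * ?s))\<^sup>2) * p))
          = 1 - p\<^sup>2 * (1 - (tanh (p * ?s))\<^sup>2) / (1 - p\<^sup>2 * (tanh (p * ?s))\<^sup>2)"
        by (simp add: power2_eq_square mult_ac)
      also have "\<dots> = 1 - p\<^sup>2 * (R\<^sup>2 / d) / (R\<^sup>2 * (1 + (\<rho> x)\<^sup>2) / d)"
      proof -
        have "1 - (tanh (p * ?s))\<^sup>2 = R\<^sup>2 / d"
          unfolding tanh2 d_def[symmetric] using d by (simp add: divide_simps)
        moreover have "1 - p\<^sup>2 * (tanh (p * ?s))\<^sup>2 = R\<^sup>2 * (1 + (\<rho> x)\<^sup>2) / d"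
          unfolding tanh2 d_def[symmetric] p2 using d(1)
          by (simp add: divide_simps; simp add: d_def R2 algebra_simps)
        ultimately show ?thesis by (simp only:)
      qed
      also have "\<dots> = 1 - C / (1 + (\<rho> x)\<^sup>2)"
        unfolding p2 using d(1) R by simp
      also have "\<dots> = 1 * (Q x / (1 + (\<rho> x)\<^sup>2))"
        using w assms by (simp add: divide_simps)
      finally show ?thesis .
    qed
    ultimately show "(?\<psi> has_real_derivative 1 * (Q x / (1 + (\<rho> x)\<^sup>2))) (at ?s)"
      by (simp only:)
  qed simp
  ultimately show ?thesis by blast
qed

end


section \<open>Vectors in a rotated frame\<close>

text \<open>The coordinates refer to the frame boosted by \<open>\<eta>\<close> and rotated by \<open>\<theta>\<close>. At a point of a rotational
  surface with \<open>\<eta> = h\<close>, the coordinate \<open>d\<close> belongs to the direction of the circles of rotation, and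
  \<open>a\<close>, \<open>b\<close>, \<open>c\<close> to the three-dimensional span of the position vector, the meridian and the normal.\<close>

definition adapted :: "(4 \<Rightarrow> real^4) \<Rightarrow> real \<Rightarrow> real \<Rightarrow> real \<Rightarrow> real \<Rightarrow> real \<Rightarrow> real \<Rightarrow> real^4" where
  "adapted e \<eta> \<theta> a b c d =
     (a * cosh \<eta> + b * sinh \<eta>) *\<^sub>R e 0 + (a * sinh \<eta> + b * cosh \<eta>) *\<^sub>R e 1
     + (c * cos \<theta> - d * sin \<theta>) *\<^sub>R e 2 + (c * sin \<theta> + d * cos \<theta>) *\<^sub>R e 3"

lemma rotation_param_adapted:
  "rotation_param e r h (x, \<theta>) = adapted e (h x) \<theta> (sqrt (1 + (r x)\<^sup>2)) 0 (r x) 0"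
  by (simp add: rotation_param_def adapted_def)

lemma scaleR_adapted: "s *\<^sub>R adapted e \<eta> \<theta> a b c d = adapted e \<eta> \<theta> (s * a) (s * b) (s * c) (s * d)"
  by (simp add: adapted_def algebra_simps)

lemma mink_combination:
  assumes "orthonormal_basis e"
  shows "mink (a0 *\<^sub>R e 0 + a1 *\<^sub>R e 1 + a2 *\<^sub>R e 2 + a3 *\<^sub>R e 3)
      (b0 *\<^sub>R e 0 + b1 *\<^sub>R e 1 + b2 *\<^sub>R e 2 + b3 *\<^sub>R e 3) = - a0 * b0 + a1 * b1 + a2 * b2 + a3 * b3"
proof -
  have o: "mink (e i) (e j) = (if i \<noteq> j then 0 else if i = 0 then -1 else 1)" for i j
    using assms by (simp add: orthonormal_basis_def)
  show ?thesis by (simp add: mink_simps o)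
qed

lemma mink_adapted:
  assumes "orthonormal_basis e"
  shows "mink (adapted e \<eta> \<theta> a b c d) (adapted e \<eta> \<theta> a' b' c' d') = - a * a' + b * b' + c * c' + d * d'"
proof -
  have "cosh \<eta> * cosh \<eta> = 1 + sinh \<eta> * sinh \<eta>" "sin \<theta> * sin \<theta> = 1 - cos \<theta> * cos \<theta>"
    using cosh_square_eq[of \<eta>] sin_squared_eq[of \<theta>] by (simp_all add: power2_eq_square)
  then show ?thesis
    unfolding adapted_def mink_combination[OF assms] by algebra
qed

lemma adapted_eq_iff:
  assumes "orthonormal_basis e"
  shows "adapted e \<eta> \<theta> a b c d = adapted e \<eta> \<theta> a' b' c' d' \<longleftrightarrow> a = a' \<and> b = b' \<and> c = c' \<and> d = d'"
proof
  assume *: "adapted e \<eta> \<theta> a b c d = adapted e \<eta> \<theta> a' b' c' d'"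
  have "mink (adapted e \<eta> \<theta> a b c d) (adapted e \<eta> \<theta> x y z w) = mink (adapted e \<eta> \<theta> a' b' c' d') (adapted e \<eta> \<theta> x y z w)"
    for x y z w using * by simp
  from this[of 1 0 0 0] this[of 0 1 0 0] this[of 0 0 1 0] this[of 0 0 0 1]
  show "a = a' \<and> b = b' \<and> c = c' \<and> d = d'" by (simp add: mink_adapted[OF assms])
qed simp

lemma adapted_surj:
  assumes "orthonormal_basis e"
  obtains a b c d where "w = adapted e \<eta> \<theta> a b c d"
proof
  have *: "cosh \<eta> * cosh \<eta> = 1 + sinh \<eta> * sinh \<eta>" "sin \<theta> * sin \<theta> = 1 - cos \<theta> * cos \<theta>"
    using cosh_square_eq[of \<eta>] sin_squared_eq[of \<theta>] by (simp_all add: power2_eq_square)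
  define w0 w1 w2 w3 where "w0 = - mink w (e 0)" "w1 = mink w (e 1)" "w2 = mink w (e 2)" "w3 = mink w (e 3)"
  have "(w0 * cosh \<eta> - w1 * sinh \<eta>) * cosh \<eta> + (w1 * cosh \<eta> - w0 * sinh \<eta>) * sinh \<eta> = w0"
    "(w0 * cosh \<eta> - w1 * sinh \<eta>) * sinh \<eta> + (w1 * cosh \<eta> - w0 * sinh \<eta>) * cosh \<eta> = w1"
    "(w2 * cos \<theta> + w3 * sin \<theta>) * cos \<theta> - (w3 * cos \<theta> - w2 * sin \<theta>) * sin \<theta> = w2"
    "(w2 * cos \<theta> + w3 * sin \<theta>) * sin \<theta> + (w3 * cos \<theta> - w2 * sin \<theta>) * cos \<theta> = w3"
    using * by algebra+
  then show "w = adapted e \<eta> \<theta> (w0 * cosh \<eta> - w1 * sinh \<eta>) (w1 * cosh \<eta> - w0 * sinh \<eta>)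
      (w2 * cos \<theta> + w3 * sin \<theta>) (w3 * cos \<theta> - w2 * sin \<theta>)"
    unfolding adapted_def using orthonormal_expansion[OF assms, of w] by (simp add: w0_w1_w2_w3_def)
qed

text \<open>The parametrisation and its unit normal field are both of this form.\<close>

lemma has_derivative_adapted:
  assumes "(\<eta> has_real_derivative \<eta>') (at x)" "(\<phi> has_real_derivative \<phi>') (at x)"
    and "(a has_real_derivative a') (at x)" "(b has_real_derivative b') (at x)" "(c has_real_derivative c') (at x)"
  shows "((\<lambda>(x, \<theta>). adapted e (\<eta> x) (\<theta> + \<phi> x) (a x) (b x) (c x) 0) has_derivative
    (\<lambda>(s, t). adapted e (\<eta> x) (\<theta> + \<phi> x) (s * (a' + b x * \<eta>')) (s * (a x * \<eta>' + b')) (s * c')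
      (c x * (s * \<phi>' + t)))) (at (x, \<theta>))"
proof -
  let ?u = "(x, \<theta>)"
  have A: "((\<lambda>u. a (fst u) * cosh (\<eta> (fst u)) + b (fst u) * sinh (\<eta> (fst u))) has_derivative
      (\<lambda>h. ((a' + b x * \<eta>') * cosh (\<eta> x) + (a x * \<eta>' + b') * sinh (\<eta> x)) * fst h)) (at ?u)"
    by (rule has_derivative_first_coordinate)
      (auto intro!: derivative_eq_intros assms[THEN DERIV_cong] simp: algebra_simps)
  have B: "((\<lambda>u. a (fst u) * sinh (\<eta> (fst u)) + b (fst u) * cosh (\<eta> (fst u))) has_derivative
      (\<lambda>h. ((a' + b x * \<eta>') * sinh (\<eta> x) + (a x * \<eta>' + b') * cosh (\<eta> x)) * fst h)) (at ?u)"
    by (rule has_derivative_first_coordinate)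
      (auto intro!: derivative_eq_intros assms[THEN DERIV_cong] simp: algebra_simps)
  have t: "((\<lambda>u. snd u + \<phi> (fst u)) has_derivative (\<lambda>h. snd h + \<phi>' * fst h)) (at ?u)"
    by (intro has_derivative_add has_derivative_snd has_derivative_ident has_derivative_first_coordinate)
      (use assms in simp)
  have c: "((\<lambda>u. c (fst u)) has_derivative (\<lambda>h. c' * fst h)) (at ?u)"
    by (rule has_derivative_first_coordinate) (use assms in simp)
  have C: "((\<lambda>u. c (fst u) * cos (snd u + \<phi> (fst u))) has_derivative
      (\<lambda>h. c x * (- sin (\<theta> + \<phi> x) * (snd h + \<phi>' * fst h)) + c' * fst h * cos (\<theta> + \<phi> x))) (at ?u)"
    using has_derivative_mult[OF c DERIV_compose_FDERIV[OF DERIV_cos t]] by (simp add: mult_ac)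
  have D: "((\<lambda>u. c (fst u) * sin (snd u + \<phi> (fst u))) has_derivative
      (\<lambda>h. c x * (cos (\<theta> + \<phi> x) * (snd h + \<phi>' * fst h)) + c' * fst h * sin (\<theta> + \<phi> x))) (at ?u)"
    using has_derivative_mult[OF c DERIV_compose_FDERIV[OF DERIV_sin t]] by (simp add: mult_ac)
  let ?F = "\<lambda>u. (a (fst u) * cosh (\<eta> (fst u)) + b (fst u) * sinh (\<eta> (fst u))) *\<^sub>R e 0
      + (a (fst u) * sinh (\<eta> (fst u)) + b (fst u) * cosh (\<eta> (fst u))) *\<^sub>R e 1
      + (c (fst u) * cos (snd u + \<phi> (fst u))) *\<^sub>R e 2
      + (c (fst u) * sin (snd u + \<phi> (fst u))) *\<^sub>R e 3"
  let ?D = "\<lambda>h. (((a' + b x * \<eta>') * cosh (\<eta> x) + (a x * \<eta>' + b') * sinh (\<eta> x)) * fst h) *\<^sub>R e 0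
      + (((a' + b x * \<eta>') * sinh (\<eta> x) + (a x * \<eta>' + b') * cosh (\<eta> x)) * fst h) *\<^sub>R e 1
      + (c x * (- sin (\<theta> + \<phi> x) * (snd h + \<phi>' * fst h)) + c' * fst h * cos (\<theta> + \<phi> x)) *\<^sub>R e 2
      + (c x * (cos (\<theta> + \<phi> x) * (snd h + \<phi>' * fst h)) + c' * fst h * sin (\<theta> + \<phi> x)) *\<^sub>R e 3"
  have "(?F has_derivative ?D) (at ?u)"
    by (intro has_derivative_add has_derivative_scaleR_left A B C D)
  moreover have "?F = (\<lambda>(x, \<theta>). adapted e (\<eta> x) (\<theta> + \<phi> x) (a x) (b x) (c x) 0)"
    by (simp add: fun_eq_iff adapted_def)
  moreover have "?D = (\<lambda>(s, t). adapted e (\<eta> x) (\<theta> + \<phi> x) (s * (a' + b x * \<eta>')) (s * (a x * \<eta>' + b'))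
      (s * c') (c x * (s * \<phi>' + t)))"
    by (simp add: fun_eq_iff adapted_def algebra_simps)
  ultimately show ?thesis by (simp only:)
qed

section \<open>Rotational surfaces in polar form\<close>

lemma rotating_component_constant:
  fixes \<alpha> \<beta> \<phi> :: "real \<Rightarrow> real"
  assumes d: "(\<alpha> has_real_derivative a) (at x)" "(\<beta> has_real_derivative b) (at x)" "(\<phi> has_real_derivative \<omega>) (at x)"
    and pos: "(\<alpha> x)\<^sup>2 + (\<beta> x)\<^sup>2 > 0" and \<omega>: "\<omega> * ((\<alpha> x)\<^sup>2 + (\<beta> x)\<^sup>2) = \<alpha> x * b - \<beta> x * a"
  shows "((\<lambda>x. (\<alpha> x * cos (\<phi> x) + \<beta> x * sin (\<phi> x)) / sqrt ((\<alpha> x)\<^sup>2 + (\<beta> x)\<^sup>2)) has_real_derivative 0) (at x)"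
proof -
  define n where "n x = sqrt ((\<alpha> x)\<^sup>2 + (\<beta> x)\<^sup>2)" for x
  have n: "n x > 0" "(n x)\<^sup>2 = (\<alpha> x)\<^sup>2 + (\<beta> x)\<^sup>2" using pos by (simp_all add: n_def)
  have n': "(n has_real_derivative (\<alpha> x * a + \<beta> x * b) / n x) (at x)"
    unfolding n_def using pos by (auto intro!: derivative_eq_intros d simp: divide_simps)
  let ?u = "\<alpha> x * cos (\<phi> x) + \<beta> x * sin (\<phi> x)"
  let ?u' = "a * cos (\<phi> x) + b * sin (\<phi> x) + \<omega> * (\<beta> x * cos (\<phi> x) - \<alpha> x * sin (\<phi> x))"
  have "((\<lambda>x. (\<alpha> x * cos (\<phi> x) + \<beta> x * sin (\<phi> x)) / n x) has_real_derivative
      (?u' * n x - ?u * ((\<alpha> x * a + \<beta> x * b) / n x)) / (n x * n x)) (at x)"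
    using n(1) by (intro DERIV_divide n') (auto intro!: derivative_eq_intros d simp: algebra_simps)
  moreover have "?u' * (n x)\<^sup>2 = ?u * (\<alpha> x * a + \<beta> x * b)"
    using \<omega> n(2) by algebra
  then have "?u' * n x = ?u * ((\<alpha> x * a + \<beta> x * b) / n x)"
    using n(1) by (simp add: power2_eq_square eq_divide_eq mult.assoc)
  ultimately show ?thesis by (simp add: n_def)
qed

text \<open>The angle is an integral of the angular velocity \<open>(\<alpha> \<beta>' - \<beta> \<alpha>') / (\<alpha>\<^sup>2 + \<beta>\<^sup>2)\<close>: turning the unit
  vector in direction \<open>(\<alpha>, \<beta>)\<close> back by it gives a vector \<open>(U, V)\<close> with zero derivative.\<close>

lemma smooth_polar_angle:
  fixes \<alpha> \<beta> :: "real \<Rightarrow> real"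
  assumes "open I" "is_interval I" "Cinf_on \<alpha> I" "Cinf_on \<beta> I"
    and pos: "\<And>x. x \<in> I \<Longrightarrow> (\<alpha> x)\<^sup>2 + (\<beta> x)\<^sup>2 > 0"
  shows "\<exists>\<phi>. Cinf_on \<phi> I \<and> (\<forall>x\<in>I. \<alpha> x = sqrt ((\<alpha> x)\<^sup>2 + (\<beta> x)\<^sup>2) * cos (\<phi> x)
    \<and> \<beta> x = sqrt ((\<alpha> x)\<^sup>2 + (\<beta> x)\<^sup>2) * sin (\<phi> x))"
proof (cases "I = {}")
  case True
  then show ?thesis using Cinf_on_const by auto
next
  case False
  then obtain x0 where x0: "x0 \<in> I" by blast
  obtain \<alpha>' where \<alpha>': "\<And>x. x \<in> I \<Longrightarrow> (\<alpha> has_real_derivative \<alpha>' x) (at x)" "Cinf_on \<alpha>' I"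
    using Cinf_on_derivative[OF assms(3,1)] by blast
  obtain \<beta>' where \<beta>': "\<And>x. x \<in> I \<Longrightarrow> (\<beta> has_real_derivative \<beta>' x) (at x)" "Cinf_on \<beta>' I"
    using Cinf_on_derivative[OF assms(4,1)] by blast
  define n where "n x = sqrt ((\<alpha> x)\<^sup>2 + (\<beta> x)\<^sup>2)" for x
  have n: "n x > 0" "(n x)\<^sup>2 = (\<alpha> x)\<^sup>2 + (\<beta> x)\<^sup>2" if "x \<in> I" for x
    using pos[OF that] by (simp_all add: n_def)
  define \<omega> where "\<omega> x = (\<alpha> x * \<beta>' x - \<beta> x * \<alpha>' x) / ((\<alpha> x)\<^sup>2 + (\<beta> x)\<^sup>2)" for x
  have \<omega>: "Cinf_on \<omega> I"
    unfolding \<omega>_def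
    by (intro Cinf_on_divide Cinf_on_diff Cinf_on_mult Cinf_on_add Cinf_on_power2 assms(3,4) \<alpha>'(2) \<beta>'(2))
      (use pos in force)
  have "(\<alpha> x0 / n x0)\<^sup>2 + (\<beta> x0 / n x0)\<^sup>2 = 1"
    unfolding power_divide add_divide_distrib[symmetric] n(2)[OF x0, symmetric] using n(1)[OF x0] by simp
  then obtain t where t: "\<alpha> x0 / n x0 = cos t" "\<beta> x0 / n x0 = sin t"
    using sincos_total_2pi by metis
  define \<phi> where "\<phi> x = t + (LBINT y=ereal x0..ereal x. \<omega> y)" for x
  have \<phi>': "(\<phi> has_real_derivative \<omega> x) (at x)" if "x \<in> I" for x
    unfolding \<phi>_def
    using interval_integral_has_derivative[OF assms(1,2) x0 that Cinf_on_continuous[OF \<omega>]]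
    by (auto intro!: derivative_eq_intros)
  have \<phi>0: "\<phi> x0 = t" by (simp add: \<phi>_def)
  define U where "U x = (\<alpha> x * cos (\<phi> x) + \<beta> x * sin (\<phi> x)) / n x" for x
  define V where "V x = (\<beta> x * cos (\<phi> x) - \<alpha> x * sin (\<phi> x)) / n x" for x
  have W: "\<omega> x * ((\<alpha> x)\<^sup>2 + (\<beta> x)\<^sup>2) = \<alpha> x * \<beta>' x - \<beta> x * \<alpha>' x" if "x \<in> I" for x
    using pos[OF that] by (simp add: \<omega>_def)
  have U': "(U has_real_derivative 0) (at x)" if "x \<in> I" for x
    unfolding U_def n_def
    by (rule rotating_component_constant[OF \<alpha>'(1) \<beta>'(1) \<phi>' pos W, OF that that that that that])
  have V': "(V has_real_derivative 0) (at x)" if "x \<in> I" for x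
    using rotating_component_constant[OF \<beta>'(1) DERIV_minus[OF \<alpha>'(1)] \<phi>', OF that that that] pos[OF that] W[OF that]
    by (simp add: V_def[abs_def] n_def add.commute algebra_simps)
  have \<alpha>\<beta>0: "\<alpha> x0 = n x0 * cos t" "\<beta> x0 = n x0 * sin t"
    using t n(1)[OF x0] by (simp_all add: field_simps)
  have U0: "U x0 = 1"
  proof -
    have "n x0 * cos t * cos t + n x0 * sin t * sin t = n x0"
      using sin_cos_squared_add[of t] by algebra
    then show ?thesis unfolding U_def \<phi>0 \<alpha>\<beta>0 using n(1)[OF x0] by simp
  qed
  have V0: "V x0 = 0" unfolding V_def \<phi>0 \<alpha>\<beta>0 by simp
  have UV: "U x = 1" "V x = 0" if "x \<in> I" for x
    using zero_derivative_imp_constant[OF assms(2) U'] zero_derivative_imp_constant[OF assms(2) V']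
      that x0 U0 V0 by metis+
  have u: "\<alpha> x * cos (\<phi> x) + \<beta> x * sin (\<phi> x) = n x" "\<beta> x * cos (\<phi> x) - \<alpha> x * sin (\<phi> x) = 0" if "x \<in> I" for x
    using UV[OF that] n(1)[OF that] by (simp_all add: U_def V_def divide_eq_1_iff)
  have sc: "cos y * cos y + sin y * sin y = 1" for y :: real
    using sin_cos_squared_add2[of y] by (simp add: power2_eq_square)
  show ?thesis
  proof (intro exI[of _ \<phi>] conjI ballI)
    show "Cinf_on \<phi> I" by (rule Cinf_on_antiderivative[OF \<phi>' \<omega>])
    fix x assume x: "x \<in> I"
    have "n x * cos (\<phi> x) = (\<alpha> x * cos (\<phi> x) + \<beta> x * sin (\<phi> x)) * cos (\<phi> x)
        - (\<beta> x * cos (\<phi> x) - \<alpha> x * sin (\<phi> x)) * sin (\<phi> x)" unfolding u[OF x] by simp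
    also have "\<dots> = \<alpha> x * (cos (\<phi> x) * cos (\<phi> x) + sin (\<phi> x) * sin (\<phi> x))"
      by (simp only: algebra_simps)
    finally show "\<alpha> x = sqrt ((\<alpha> x)\<^sup>2 + (\<beta> x)\<^sup>2) * cos (\<phi> x)" unfolding sc n_def by simp
    have "n x * sin (\<phi> x) = (\<alpha> x * cos (\<phi> x) + \<beta> x * sin (\<phi> x)) * sin (\<phi> x)
        + (\<beta> x * cos (\<phi> x) - \<alpha> x * sin (\<phi> x)) * cos (\<phi> x)" unfolding u[OF x] by simp
    also have "\<dots> = \<beta> x * (cos (\<phi> x) * cos (\<phi> x) + sin (\<phi> x) * sin (\<phi> x))"
      by (simp only: algebra_simps)
    finally show "\<beta> x = sqrt ((\<alpha> x)\<^sup>2 + (\<beta> x)\<^sup>2) * sin (\<phi> x)" unfolding sc n_def by simp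
  qed
qed


text \<open>By equivariance the surface is determined by the curve \<open>x \<mapsto> f (x, 0)\<close>. Its component in the plane of
  rotation has no zeros, as \<open>f\<close> is an immersion; the polar coordinates of this component give \<open>\<rho>\<close> and
  \<open>\<phi>\<close>, and \<open>h\<close> is the hyperbolic polar angle of the complementary component.\<close>

lemma elliptic_rotation_normal_form:
  assumes "open I" "is_interval I" "elliptic_rotation_surface I f"
  obtains e \<rho> h \<phi> where "orthonormal_basis e" "Cinf_on \<rho> I" "Cinf_on h I" "Cinf_on \<phi> I"
    "\<And>x. x \<in> I \<Longrightarrow> \<rho> x > 0"
    "\<And>x \<theta>. x \<in> I \<Longrightarrow> f (x, \<theta>) = rotation_param e \<rho> h (x, \<theta> + \<phi> x)"
proof -
  have surf: "surface_in_hyp3 (I \<times> UNIV) f" using assms(3) by (simp add: elliptic_rotation_surface_def)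
  then obtain x0 where x0: "x0 \<in> I" by (auto simp: surface_in_hyp3_def)
  have hyp: "f (x, \<theta>) \<in> hyp3" if "x \<in> I" for x \<theta>
    using surf that by (auto simp: surface_in_hyp3_def)
  obtain R a b where R: "mink a a = 1" "mink b b = 1" "mink a b = 0" "\<And>t. linear (R t)"
    "\<And>t. R t a = cos t *\<^sub>R a + sin t *\<^sub>R b" "\<And>t. R t b = - sin t *\<^sub>R a + cos t *\<^sub>R b"
    "\<And>t w. mink w a = 0 \<Longrightarrow> mink w b = 0 \<Longrightarrow> R t w = w"
    and equi: "\<And>x \<theta> t. x \<in> I \<Longrightarrow> f (x, \<theta> + t) = R t (f (x, \<theta>))"
    using assms(3) unfolding elliptic_rotation_surface_def elliptic_rotation_group_def by blast
  obtain e where e: "orthonormal_basis e" "e 2 = a" "e 3 = b" "e 0 $ 0 > 0"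
    by (rule extend_to_orthonormal_basis[OF R(1-3) hyp[OF x0]])
  have eo: "mink (e 0) (e 0) = -1" "mink (e 0) a = 0" "mink (e 0) b = 0" "mink (e 1) a = 0" "mink (e 1) b = 0"
    using e(1) unfolding orthonormal_basis_iff by (auto simp: e(2,3))
  define A B \<alpha> \<beta> where "A x = - mink (f (x, 0)) (e 0)" "B x = mink (f (x, 0)) (e 1)"
    "\<alpha> x = mink (f (x, 0)) a" "\<beta> x = mink (f (x, 0)) b" for x
  note defs = A_B_\<alpha>_\<beta>_def
  have smooth: "Cinf_on (\<lambda>x. mink (f (x, 0)) y) I" for y
    unfolding Cinf_on_def
    using Ck_on_imp_Cn_on_slice[OF bounded_linear_mink] surf by (simp add: surface_in_hyp3_def smooth_on_def)
  have "B = (\<lambda>x. mink (f (x, 0)) (e 1))" "\<alpha> = (\<lambda>x. mink (f (x, 0)) a)" "\<beta> = (\<lambda>x. mink (f (x, 0)) b)"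
    by (simp_all add: fun_eq_iff defs)
  then have smooth_comp: "Cinf_on B I" "Cinf_on \<alpha> I" "Cinf_on \<beta> I" using smooth by simp_all
  have f0: "f (x, 0) = A x *\<^sub>R e 0 + B x *\<^sub>R e 1 + \<alpha> x *\<^sub>R a + \<beta> x *\<^sub>R b" for x
    using orthonormal_expansion[OF e(1), of "f (x, 0)"] by (simp add: defs e(2,3))
  have f\<theta>: "f (x, \<theta>) = A x *\<^sub>R e 0 + B x *\<^sub>R e 1 + (\<alpha> x * cos \<theta> - \<beta> x * sin \<theta>) *\<^sub>R a
      + (\<alpha> x * sin \<theta> + \<beta> x * cos \<theta>) *\<^sub>R b" if "x \<in> I" for x \<theta>
  proof -
    have "f (x, \<theta>) = R \<theta> (f (x, 0))" using equi[OF that, of 0 \<theta>] by simp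
    also have "\<dots> = A x *\<^sub>R R \<theta> (e 0) + B x *\<^sub>R R \<theta> (e 1) + \<alpha> x *\<^sub>R R \<theta> a + \<beta> x *\<^sub>R R \<theta> b"
      unfolding f0 by (simp add: linear_add[OF R(4)] linear_cmul[OF R(4)])
    also have "\<dots> = A x *\<^sub>R e 0 + B x *\<^sub>R e 1 + \<alpha> x *\<^sub>R (cos \<theta> *\<^sub>R a + sin \<theta> *\<^sub>R b)
        + \<beta> x *\<^sub>R (- sin \<theta> *\<^sub>R a + cos \<theta> *\<^sub>R b)"
      by (simp only: R(5,6) R(7)[OF eo(2,3)] R(7)[OF eo(4,5)])
    finally show ?thesis by (simp add: algebra_simps)
  qed
  have norm: "(A x)\<^sup>2 = 1 + (B x)\<^sup>2 + ((\<alpha> x)\<^sup>2 + (\<beta> x)\<^sup>2)" if "x \<in> I" for x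
  proof -
    have "mink (f (x, 0)) (f (x, 0)) = - A x * A x + B x * B x + \<alpha> x * \<alpha> x + \<beta> x * \<beta> x"
      unfolding f0 e(2,3)[symmetric] by (rule mink_combination[OF e(1)])
    moreover have "mink (f (x, 0)) (f (x, 0)) = -1" using hyp[OF that] by (simp add: hyp3_def)
    ultimately show ?thesis by (simp add: power2_eq_square)
  qed
  have A_pos: "A x > 0" if "x \<in> I" for x
  proof -
    have "mink (f (x, 0)) (f (x, 0)) = -1" "f (x, 0) $ 0 > 0"
      using hyp[OF that, of 0] by (auto simp: hyp3_def)
    then show ?thesis using mink_timelike_neg_iff[OF _ eo(1), of "f (x, 0)"] e(4) by (simp add: defs)
  qed
  have pos: "(\<alpha> x)\<^sup>2 + (\<beta> x)\<^sup>2 > 0" if "x \<in> I" for x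
  proof (rule ccontr)
    assume "\<not> (\<alpha> x)\<^sup>2 + (\<beta> x)\<^sup>2 > 0"
    then have z: "\<alpha> x = 0" "\<beta> x = 0" by (auto simp: sum_power2_gt_zero_iff)
    let ?D = "frechet_derivative f (at (x, 0))"
    have D: "(f has_derivative ?D) (at (x, 0))" and inj: "inj ?D"
      using surf that unfolding surface_in_hyp3_def smooth_on_def
      by (auto simp: frechet_derivative_works[symmetric] dest: spec[of _ "Suc 0"])
    have "((\<lambda>t. (x, t)) has_derivative (\<lambda>t. (0, t))) (at 0)"
      by (auto intro!: derivative_eq_intros)
    from has_derivative_compose[OF this D]
    have "((\<lambda>t. f (x, t)) has_derivative (\<lambda>t. ?D (0, t))) (at 0)" .
    moreover have "((\<lambda>t. f (x, t)) has_derivative (\<lambda>t. 0)) (at 0)"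
      unfolding f\<theta>[OF that] z by simp
    ultimately have "(\<lambda>t. ?D (0, t)) = (\<lambda>t. 0)" by (rule has_derivative_unique)
    from fun_cong[OF this, of 1] fun_cong[OF this, of 0] have "?D (0, 1) = ?D (0, 0)" by simp
    then show False using inj by (auto dest: injD)
  qed
  obtain \<phi> where \<phi>: "Cinf_on \<phi> I"
    "\<And>x. x \<in> I \<Longrightarrow> \<alpha> x = sqrt ((\<alpha> x)\<^sup>2 + (\<beta> x)\<^sup>2) * cos (\<phi> x)"
    "\<And>x. x \<in> I \<Longrightarrow> \<beta> x = sqrt ((\<alpha> x)\<^sup>2 + (\<beta> x)\<^sup>2) * sin (\<phi> x)"
    using smooth_polar_angle[OF assms(1,2) smooth_comp(2,3) pos] by blast
  define \<rho> where "\<rho> x = sqrt ((\<alpha> x)\<^sup>2 + (\<beta> x)\<^sup>2)" for x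
  define h where "h x = arsinh (B x / sqrt (1 + (\<rho> x)\<^sup>2))" for x
  have \<rho>_pos: "\<rho> x > 0" if "x \<in> I" for x using pos[OF that] by (simp add: \<rho>_def)
  have w: "1 + (\<rho> x)\<^sup>2 > 0" for x by (simp add: add_pos_nonneg)
  have smooth_\<rho>: "Cinf_on \<rho> I"
    unfolding \<rho>_def using pos
    by (intro Cinf_on_sqrt Cinf_on_add Cinf_on_power2 smooth_comp)
  have "sqrt (1 + (\<rho> x)\<^sup>2) \<noteq> 0" for x using w[of x] by simp
  then have smooth_h: "Cinf_on h I"
    unfolding h_def using w
    by (intro Cinf_on_arsinh Cinf_on_divide Cinf_on_sqrt Cinf_on_add Cinf_on_const Cinf_on_power2
        smooth_\<rho> smooth_comp)
  have "f (x, \<theta>) = rotation_param e \<rho> h (x, \<theta> + \<phi> x)" if x: "x \<in> I" for x \<theta>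
  proof -
    have sinh: "sqrt (1 + (\<rho> x)\<^sup>2) * sinh (h x) = B x"
      using w[of x] by (simp add: h_def)
    have "(sqrt (1 + (\<rho> x)\<^sup>2) * cosh (h x))\<^sup>2 = (1 + (\<rho> x)\<^sup>2) + (sqrt (1 + (\<rho> x)\<^sup>2) * sinh (h x))\<^sup>2"
      using w[of x] by (simp add: power_mult_distrib cosh_square_eq algebra_simps)
    also have "\<dots> = (A x)\<^sup>2" unfolding sinh norm[OF x] by (simp add: \<rho>_def)
    finally have cosh: "sqrt (1 + (\<rho> x)\<^sup>2) * cosh (h x) = A x"
      by (rule power2_eq_imp_eq) (use A_pos[OF x] w[of x] in auto)
    have "\<rho> x * cos (\<theta> + \<phi> x) = \<alpha> x * cos \<theta> - \<beta> x * sin \<theta>"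
      "\<rho> x * sin (\<theta> + \<phi> x) = \<alpha> x * sin \<theta> + \<beta> x * cos \<theta>"
      using \<phi>(2,3)[OF x] unfolding \<rho>_def[symmetric] cos_add sin_add by algebra+
    then show ?thesis
      unfolding rotation_param_def case_prod_conv cosh sinh f\<theta>[OF x] e(2,3) by simp
  qed
  then show ?thesis using that e(1) smooth_\<rho> smooth_h \<phi>(1) \<rho>_pos by blast
qed

section \<open>The curvature equation\<close>

lemma principal_curvatures_commute:
  "principal_curvatures f n u k1 k2 \<Longrightarrow> principal_curvatures f n u k2 k1"
proof -
  assume "principal_curvatures f n u k1 k2"
  then obtain v1 v2 where "v1 \<noteq> v2" "independent {v1, v2}"
    "frechet_derivative n (at u) v1 = - k1 *\<^sub>R frechet_derivative f (at u) v1"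
    "frechet_derivative n (at u) v2 = - k2 *\<^sub>R frechet_derivative f (at u) v2"
    unfolding principal_curvatures_def by blast
  then show ?thesis
    unfolding principal_curvatures_def by (intro exI[of _ v2] exI[of _ v1]) (auto simp: insert_commute)
qed

text \<open>For equal principal curvatures the eigenvectors need not point along meridian and circle; only
  the nonvanishing determinant of the two is available.\<close>

lemma independent_pair_det:
  fixes v1 v2 :: "real \<times> real"
  assumes "v1 \<noteq> v2" "independent {v1, v2}"
  shows "fst v1 * snd v2 - fst v2 * snd v1 \<noteq> 0"
proof
  assume det: "fst v1 * snd v2 - fst v2 * snd v1 = 0"
  have coeff: "a = 0 \<and> b = 0" if "a *\<^sub>R v1 + b *\<^sub>R v2 = 0" for a b
  proof -
    have "(\<Sum>v\<in>{v1, v2}. (if v = v1 then a else b) *\<^sub>R v) = 0"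
      using that assms(1) by auto
    from independentD[OF assms(2) _ _ this, of v1] independentD[OF assms(2) _ _ this, of v2]
    show ?thesis using assms(1) by auto
  qed
  have "snd v2 *\<^sub>R v1 + (- snd v1) *\<^sub>R v2 = 0" "fst v2 *\<^sub>R v1 + (- fst v1) *\<^sub>R v2 = 0"
    using det by (simp_all add: prod_eq_iff algebra_simps)
  from coeff[OF this(1)] coeff[OF this(2)] have "v1 = v2" by (auto simp: prod_eq_iff)
  then show False using assms(1) by simp
qed


text \<open>The unit normal has coordinates \<open>(\<rho> g / w, - q / w, g, 0)\<close> with \<open>w\<^sup>2 = 1 + \<rho>\<^sup>2\<close> in the adapted frame,
  up to a sign that is constant by connectedness. Its derivative along the circles is \<open>g / \<rho>\<close> times
  that of \<open>f\<close>, which gives one principal curvature; comparing the \<open>b\<close>-coordinates of the derivatives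
  along the meridian gives the other one. The product of the two is a linear equation for \<open>q'\<close>.\<close>

lemma rotational_curvature:
  assumes I: "open I" "is_interval I"
    and e: "orthonormal_basis e"
    and smooth: "Cinf_on \<rho> I" "Cinf_on h I" "Cinf_on \<phi> I"
    and \<rho>_pos: "\<And>x. x \<in> I \<Longrightarrow> \<rho> x > 0"
    and f_eq: "\<And>x \<theta>. x \<in> I \<Longrightarrow> f (x, \<theta>) = rotation_param e \<rho> h (x, \<theta> + \<phi> x)"
    and surf: "surface_in_hyp3 (I \<times> UNIV) f"
    and n: "unit_normal_field (I \<times> UNIV) f n"
    and curv: "\<And>u. u \<in> I \<times> UNIV \<Longrightarrow> \<exists>k1 k2. principal_curvatures f n u k1 k2 \<and> k1 * k2 = K"
    and K: "K \<noteq> 0"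
  obtains q g v \<delta> where "Cinf_on v I" "continuous_on I g"
    "\<And>x. x \<in> I \<Longrightarrow> v x > 0" "\<And>x. x \<in> I \<Longrightarrow> g x \<noteq> 0"
    "\<And>x. x \<in> I \<Longrightarrow> (\<rho> has_real_derivative q x * v x) (at x)"
    "\<And>x. x \<in> I \<Longrightarrow> (h has_real_derivative g x * v x / (1 + (\<rho> x)\<^sup>2)) (at x)"
    "\<And>x. x \<in> I \<Longrightarrow> (q has_real_derivative (1 - K) * \<rho> x * v x) (at x)"
    "\<And>x. x \<in> I \<Longrightarrow> (g x)\<^sup>2 + (q x)\<^sup>2 = 1 + (\<rho> x)\<^sup>2"
    "\<And>x \<theta>. x \<in> I \<Longrightarrow> \<exists>k. principal_curvatures f n (x, \<theta>) (\<delta> * (g x / \<rho> x)) k"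
proof -
  have open_D: "open (I \<times> (UNIV :: real set))" using I(1) by (simp add: open_Times)
  have conn_D: "connected (I \<times> (UNIV :: real set))"
    using I(2) by (intro connected_Times) (auto simp: is_interval_connected_1)
  obtain \<rho>' where \<rho>': "\<And>x. x \<in> I \<Longrightarrow> (\<rho> has_real_derivative \<rho>' x) (at x)" "Cinf_on \<rho>' I"
    using Cinf_on_derivative[OF smooth(1) I(1)] by blast
  obtain h' where h': "\<And>x. x \<in> I \<Longrightarrow> (h has_real_derivative h' x) (at x)" "Cinf_on h' I"
    using Cinf_on_derivative[OF smooth(2) I(1)] by blast
  obtain \<phi>' where \<phi>': "\<And>x. x \<in> I \<Longrightarrow> (\<phi> has_real_derivative \<phi>' x) (at x)"
    using Cinf_on_derivative[OF smooth(3) I(1)] by blast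
  define W where "W x = 1 + (\<rho> x)\<^sup>2" for x
  define w where "w x = sqrt (W x)" for x
  have W: "W x > 0" for x by (simp add: W_def add_pos_nonneg)
  have w: "w x > 0" "(w x)\<^sup>2 = W x" for x using W[of x] by (simp_all add: w_def)
  have smooth_W: "Cinf_on W I"
    unfolding W_def by (intro Cinf_on_add Cinf_on_const Cinf_on_power2 smooth)
  have smooth_w: "Cinf_on w I" unfolding w_def by (intro Cinf_on_sqrt smooth_W W)
  have w': "(w has_real_derivative \<rho> x * \<rho>' x / w x) (at x)" if "x \<in> I" for x
    unfolding w_def W_def using W[of x, unfolded W_def]
    by (auto intro!: derivative_eq_intros \<rho>'(1)[OF that] simp: divide_simps)
  have df: "(f has_derivative (\<lambda>(s, t). adapted e (h x) (\<theta> + \<phi> x) (s * (\<rho> x * \<rho>' x / w x))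
      (s * (w x * h' x)) (s * \<rho>' x) (\<rho> x * (s * \<phi>' x + t)))) (at (x, \<theta>))" if "x \<in> I" for x \<theta>
  proof (rule has_derivative_transform_within_open[OF _ open_D])
    show "((\<lambda>(x, \<theta>). adapted e (h x) (\<theta> + \<phi> x) (w x) 0 (\<rho> x) 0) has_derivative
        (\<lambda>(s, t). adapted e (h x) (\<theta> + \<phi> x) (s * (\<rho> x * \<rho>' x / w x))
      (s * (w x * h' x)) (s * \<rho>' x) (\<rho> x * (s * \<phi>' x + t)))) (at (x, \<theta>))"
      using has_derivative_adapted[OF h'(1)[OF that] \<phi>'[OF that] w'[OF that] DERIV_const[of 0] \<rho>'(1)[OF that]]
      by simp
  qed (use that in \<open>auto simp: f_eq rotation_param_adapted w_def W_def\<close>)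
  note fd = frechet_derivative_at[OF df, symmetric]
  \<comment> \<open>The speed in the metric \<open>d\<rho>\<^sup>2 / (1 + \<rho>\<^sup>2) + (1 + \<rho>\<^sup>2) dh\<^sup>2\<close> of the hyperbolic plane.\<close>
  define v where "v x = sqrt ((\<rho>' x)\<^sup>2 / W x + W x * (h' x)\<^sup>2)" for x
  have speed: "(\<rho>' x)\<^sup>2 / W x + W x * (h' x)\<^sup>2 > 0" if "x \<in> I" for x
  proof (rule ccontr)
    assume "\<not> ?thesis"
    moreover have "(\<rho>' x)\<^sup>2 / W x \<ge> 0" "W x * (h' x)\<^sup>2 \<ge> 0" using W[of x] by auto
    ultimately have "(\<rho>' x)\<^sup>2 / W x = 0" "W x * (h' x)\<^sup>2 = 0" by linarith+
    then have z: "\<rho>' x = 0" "h' x = 0" using W[of x] by auto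
    have "frechet_derivative f (at (x, 0)) (1, - \<phi>' x) = frechet_derivative f (at (x, 0)) (0, 0)"
      unfolding fd[OF that] by (simp add: z)
    moreover have "inj (frechet_derivative f (at (x, 0)))"
      using surf that by (simp add: surface_in_hyp3_def)
    ultimately have "(1::real, - \<phi>' x) = (0, 0)" by (meson injD)
    then show False by simp
  qed
  have v: "v x > 0" "(v x)\<^sup>2 = (\<rho>' x)\<^sup>2 / W x + W x * (h' x)\<^sup>2" if "x \<in> I" for x
    using speed[OF that] by (simp_all add: v_def)
  have smooth_v: "Cinf_on v I"
    unfolding v_def
    by (intro Cinf_on_sqrt Cinf_on_add Cinf_on_mult Cinf_on_divide Cinf_on_power2 \<rho>'(2) h'(2) smooth_W speed)
      (use W less_irrefl in metis)
  define q where "q x = \<rho>' x / v x" for x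
  define g where "g x = W x * h' x / v x" for x
  have vnz: "v x \<noteq> 0" if "x \<in> I" for x using v(1)[OF that] by simp
  have smooth_q: "Cinf_on q I" unfolding q_def by (intro Cinf_on_divide \<rho>'(2) smooth_v vnz)
  have smooth_g: "Cinf_on g I" unfolding g_def by (intro Cinf_on_divide Cinf_on_mult h'(2) smooth_W smooth_v vnz)
  have \<rho>'_eq: "\<rho>' x = q x * v x" and h'_eq: "h' x = g x * v x / W x" if "x \<in> I" for x
    using vnz[OF that] W[of x] by (simp_all add: q_def g_def)
  have gq: "(g x)\<^sup>2 + (q x)\<^sup>2 = W x" if "x \<in> I" for x
  proof -
    have "((g x)\<^sup>2 + (q x)\<^sup>2) * (v x)\<^sup>2 = W x * (v x)\<^sup>2"
      unfolding v(2)[OF that] using v(2)[OF that] vnz[OF that] W[of x]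
      by (simp add: g_def q_def power_divide power_mult_distrib add_divide_distrib[symmetric];
          simp add: power2_eq_square algebra_simps)
    then show ?thesis using vnz[OF that] by simp
  qed
  obtain q' where q': "\<And>x. x \<in> I \<Longrightarrow> (q has_real_derivative q' x) (at x)"
    using Cinf_on_derivative[OF smooth_q I(1)] by blast
  obtain g' where g': "\<And>x. x \<in> I \<Longrightarrow> (g has_real_derivative g' x) (at x)"
    using Cinf_on_derivative[OF smooth_g I(1)] by blast
  have wnz: "w x \<noteq> 0" for x using w(1)[of x] by simp
  define a where "a x = \<rho> x * g x / w x" for x
  define b where "b x = - (q x) / w x" for x
  have "Cinf_on a I" unfolding a_def by (intro Cinf_on_divide Cinf_on_mult smooth smooth_g smooth_w wnz)
  then obtain a' where a': "\<And>x. x \<in> I \<Longrightarrow> (a has_real_derivative a' x) (at x)"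
    using Cinf_on_derivative[OF _ I(1)] by blast
  define b' where "b' x = (- q' x * w x - - (q x) * (\<rho> x * \<rho>' x / w x)) / (w x * w x)" for x
  have b': "(b has_real_derivative b' x) (at x)" if "x \<in> I" for x
    unfolding b_def b'_def by (intro DERIV_divide DERIV_minus q' w' that wnz)
  define N where "N = (\<lambda>(x, \<theta>). adapted e (h x) (\<theta> + \<phi> x) (a x) (b x) (g x) 0)"
  have dN: "(N has_derivative (\<lambda>(s, t). adapted e (h x) (\<theta> + \<phi> x) (s * (a' x + b x * h' x))
      (s * (a x * h' x + b' x)) (s * g' x) (g x * (s * \<phi>' x + t)))) (at (x, \<theta>))" if "x \<in> I" for x \<theta>
    unfolding N_def by (rule has_derivative_adapted[OF h'(1) \<phi>' a' b' g', OF that that that that that])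
  define \<epsilon> where "\<epsilon> u = mink (n u) (N u)" for u
  have n_eq: "(\<epsilon> (x, \<theta>))\<^sup>2 = 1" "n (x, \<theta>) = \<epsilon> (x, \<theta>) *\<^sub>R N (x, \<theta>)" if x: "x \<in> I" for x \<theta>
  proof -
    have nu: "mink (n (x, \<theta>)) (n (x, \<theta>)) = 1" "mink (n (x, \<theta>)) (f (x, \<theta>)) = 0"
      "\<And>y. mink (n (x, \<theta>)) (frechet_derivative f (at (x, \<theta>)) y) = 0"
      using n x unfolding unit_normal_field_def by auto
    obtain A B C D where ABCD: "n (x, \<theta>) = adapted e (h x) (\<theta> + \<phi> x) A B C D"
      using adapted_surj[OF e] by blast
    have "f (x, \<theta>) = adapted e (h x) (\<theta> + \<phi> x) (w x) 0 (\<rho> x) 0"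
      by (simp add: f_eq[OF x] rotation_param_adapted w_def W_def)
    then have 1: "C * \<rho> x = A * w x" using nu(2) by (simp add: ABCD mink_adapted[OF e])
    have D: "D = 0"
      using nu(3)[of "(0, 1)"] \<rho>_pos[OF x] unfolding fd[OF x] by (simp add: ABCD mink_adapted[OF e])
    have 2: "- A * (\<rho> x * \<rho>' x / w x) + B * (w x * h' x) + C * \<rho>' x = 0"
      using nu(3)[of "(1, 0)"] unfolding fd[OF x] by (simp add: ABCD D mink_adapted[OF e])
    have 3: "- A * A + B * B + C * C = 1" using nu(1) by (simp add: ABCD D mink_adapted[OF e])
    have A: "A = \<rho> x * C / w x" using 1 wnz[of x] by (simp add: field_simps)
    define r where "r = w x"
    have r: "r \<noteq> 0" "r * r = W x" "r\<^sup>2 = 1 + (\<rho> x)\<^sup>2" using wnz[of x] w(2)[of x] by (simp_all add: r_def power2_eq_square W_def)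
    have \<rho>2: "\<rho> x * \<rho> x = r * r - 1" using r(3) by (simp add: power2_eq_square)
    have g2: "g x * g x + q x * q x = r * r" using gq[OF x] r(2) by (simp add: power2_eq_square)
    have "v x * (C * q x + B * r * g x) = 0"
    proof -
      have "0 = (- A * (\<rho> x * \<rho>' x / w x) + B * (w x * h' x) + C * \<rho>' x) * (r * r)" using 2 by simp
      also have "\<dots> = - (\<rho> x)\<^sup>2 * C * \<rho>' x + B * r * r * r * h' x + C * \<rho>' x * (r * r)"
        unfolding A r_def[symmetric] using r(1) by (simp add: power2_eq_square; simp add: algebra_simps)
      also have "\<dots> = C * \<rho>' x + B * r * (W x * h' x)"
        unfolding r(2)[symmetric] power2_eq_square \<rho>2 by (simp add: algebra_simps)
      also have "\<dots> = v x * (C * q x + B * r * g x)"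
        unfolding \<rho>'_eq[OF x] h'_eq[OF x] using W[of x] by (simp add: algebra_simps)
      finally show ?thesis by simp
    qed
    then have 4: "C * q x = - (B * r * g x)" using vnz[OF x] by simp
    have 5: "C * C + B * B * (r * r) = r * r"
    proof -
      have "(- A * A + B * B + C * C) * (r * r) = - ((\<rho> x)\<^sup>2 * C * C) + B * B * (r * r) + C * C * (r * r)"
        unfolding A r_def[symmetric] using r(1) by (simp add: power2_eq_square; simp add: algebra_simps)
      then show ?thesis unfolding 3 power2_eq_square \<rho>2 by (simp add: algebra_simps)
    qed
    define E where "E = \<epsilon> (x, \<theta>)"
    have E: "E = - A * a x + B * b x + C * g x"
      unfolding E_def \<epsilon>_def N_def ABCD case_prod_conv D by (simp add: mink_adapted[OF e])
    have "E * (r * r) = - (\<rho> x * \<rho> x * C * g x) - B * q x * r + C * g x * (r * r)"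
      unfolding E A a_def b_def r_def[symmetric] using r(1) by (simp add: field_simps)
    then have 6: "E * (r * r) = C * g x - B * q x * r" unfolding \<rho>2 by (simp add: algebra_simps)
    have "E * g x * (r * r) = C * (r * r)" using 6 4 g2 by algebra
    then have C: "C = E * g x" using r(1) by simp
    have "E * q x * (r * r) = - B * r * (r * r)" using 6 4 g2 by algebra
    moreover have "r * r \<noteq> 0" using r(1) by simp
    ultimately have B: "E * q x = - B * r" using mult_right_cancel by blast
    have "E * E * (r * r) = r * r" using 5 C B g2 by algebra
    then show "(\<epsilon> (x, \<theta>))\<^sup>2 = 1" using r(1) by (simp add: E_def power2_eq_square)
    have "B = E * b x" unfolding b_def r_def[symmetric] using B r(1) by (simp add: field_simps)
    moreover have "A = E * a x" unfolding a_def r_def[symmetric] A C by simp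
    ultimately show "n (x, \<theta>) = \<epsilon> (x, \<theta>) *\<^sub>R N (x, \<theta>)"
      unfolding E_def[symmetric] ABCD N_def case_prod_conv scaleR_adapted D C by simp
  qed
  obtain \<delta> where \<delta>: "\<delta>\<^sup>2 = 1" "\<And>u. u \<in> I \<times> UNIV \<Longrightarrow> \<epsilon> u = \<delta> * 1"
  proof (rule equal_squares_imp_constant_sign[OF conn_D, of \<epsilon> "\<lambda>_. 1"])
    have "continuous_on (I \<times> UNIV) n"
      using n unfolding unit_normal_field_def smooth_on_def by (metis Ck_on.simps(1))
    moreover have "continuous_on (I \<times> UNIV) N"
      using dN by (intro continuous_at_imp_continuous_on) (auto intro: has_derivative_continuous)
    ultimately show "continuous_on (I \<times> UNIV) \<epsilon>"
      unfolding \<epsilon>_def mink_def by (intro continuous_intros)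
  qed (use n_eq in auto)
  have \<delta>\<delta>: "\<delta> * \<delta> = 1" using \<delta>(1) by (simp add: power2_eq_square)
  have dn: "(n has_derivative (\<lambda>(s, t). adapted e (h x) (\<theta> + \<phi> x) (\<delta> * (s * (a' x + b x * h' x)))
      (\<delta> * (s * (a x * h' x + b' x))) (\<delta> * (s * g' x)) (\<delta> * (g x * (s * \<phi>' x + t))))) (at (x, \<theta>))"
    if "x \<in> I" for x \<theta>
  proof (rule has_derivative_transform_within_open[OF _ open_D])
    show "((\<lambda>u. \<delta> *\<^sub>R N u) has_derivative (\<lambda>(s, t). adapted e (h x) (\<theta> + \<phi> x) (\<delta> * (s * (a' x + b x * h' x)))
      (\<delta> * (s * (a x * h' x + b' x))) (\<delta> * (s * g' x)) (\<delta> * (g x * (s * \<phi>' x + t))))) (at (x, \<theta>))"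
      using has_derivative_scaleR_right[OF dN[OF that], of \<delta>] by (simp add: case_prod_beta' scaleR_adapted)
  qed (use that n_eq \<delta>(2) in auto)
  note nd = frechet_derivative_at[OF dn, symmetric]
  have key: "\<exists>k k'. k * k' = K \<and> principal_curvatures f n (x, \<theta>) k' k
      \<and> \<delta> * (a x * h' x + b' x) = - k * (w x * h' x) \<and> \<delta> * g x = - k' * \<rho> x" if x: "x \<in> I" for x \<theta>
  proof -
    obtain k1 k2 where pc: "principal_curvatures f n (x, \<theta>) k1 k2" and kk: "k1 * k2 = K"
      using curv[of "(x, \<theta>)"] x by auto
    then obtain v1 v2 where v12: "v1 \<noteq> v2" "independent {v1, v2}"
      and d1: "frechet_derivative n (at (x, \<theta>)) v1 = - k1 *\<^sub>R frechet_derivative f (at (x, \<theta>)) v1"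
      and d2: "frechet_derivative n (at (x, \<theta>)) v2 = - k2 *\<^sub>R frechet_derivative f (at (x, \<theta>)) v2"
      unfolding principal_curvatures_def by blast
    obtain s1 t1 s2 t2 where st: "v1 = (s1, t1)" "v2 = (s2, t2)" by fastforce
    have comp: "s * (\<delta> * (a x * h' x + b' x)) = s * (- k * (w x * h' x))"
      "(s * \<phi>' x + t) * (\<delta> * g x) = (s * \<phi>' x + t) * (- k * \<rho> x)"
      if "frechet_derivative n (at (x, \<theta>)) (s, t) = - k *\<^sub>R frechet_derivative f (at (x, \<theta>)) (s, t)" for s t k
      using that unfolding nd[OF x] fd[OF x] case_prod_conv scaleR_adapted adapted_eq_iff[OF e]
      by (simp_all add: mult_ac)
    have det: "s1 * (s2 * \<phi>' x + t2) - s2 * (s1 * \<phi>' x + t1) \<noteq> 0"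
      using independent_pair_det[OF v12] by (simp add: st algebra_simps)
    \<comment> \<open>One of the eigenvectors has a meridian component and the other one a circle component.\<close>
    show ?thesis
    proof (cases "s1 \<noteq> 0 \<and> s2 * \<phi>' x + t2 \<noteq> 0")
      case True
      then have "\<delta> * (a x * h' x + b' x) = - k1 * (w x * h' x)" "\<delta> * g x = - k2 * \<rho> x"
        using comp(1)[OF d1[unfolded st]] comp(2)[OF d2[unfolded st]] mult_left_cancel by blast+
      then show ?thesis using kk principal_curvatures_commute[OF pc] by blast
    next
      case False
      then have "s2 \<noteq> 0" "s1 * \<phi>' x + t1 \<noteq> 0" using det by auto
      then have "\<delta> * (a x * h' x + b' x) = - k2 * (w x * h' x)" "\<delta> * g x = - k1 * \<rho> x"
        using comp(1)[OF d2[unfolded st]] comp(2)[OF d1[unfolded st]] mult_left_cancel by blast+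
      then show ?thesis using kk pc by (metis mult.commute)
    qed
  qed
  have g_nz: "g x \<noteq> 0" if x: "x \<in> I" for x
    using key[OF x, of 0] K \<rho>_pos[OF x] by auto
  have q'_eq: "q' x = (1 - K) * \<rho> x * v x" if x: "x \<in> I" for x
  proof -
    obtain k k' where k: "k * k' = K" "\<delta> * (a x * h' x + b' x) = - k * (w x * h' x)" "\<delta> * g x = - k' * \<rho> x"
      using key[OF x, of 0] by blast
    have "\<delta> * (a x * h' x + b' x) * (\<delta> * g x) = K * (w x * h' x) * \<rho> x"
      unfolding k(2,3) k(1)[symmetric] by (simp add: algebra_simps)
    then have eq: "(a x * h' x + b' x) * g x = K * (w x * h' x) * \<rho> x" using \<delta>\<delta> by algebra
    define r where "r = w x"
    have r: "r \<noteq> 0" "W x = r * r" using wnz[of x] w(2)[of x] by (simp_all add: r_def power2_eq_square)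
    have g2: "(g x)\<^sup>2 + (q x)\<^sup>2 = r * r" using gq[OF x] r(2) by simp
    have "a x * h' x + b' x = (\<rho> x * v x * ((g x)\<^sup>2 + (q x)\<^sup>2) - q' x * (r * r)) / (r * r * r)"
      unfolding a_def b'_def \<rho>'_eq[OF x] h'_eq[OF x] r(2) r_def[symmetric]
      using r(1) by (simp add: divide_simps power2_eq_square; simp add: algebra_simps)
    also have "\<dots> = (\<rho> x * v x - q' x) / r" unfolding g2 using r(1) by (simp add: divide_simps; simp add: algebra_simps)
    finally have "(\<rho> x * v x - q' x) / r * g x = K * (r * (g x * v x / (r * r))) * \<rho> x"
      using eq unfolding h'_eq[OF x] r(2) r_def[symmetric] by simp
    then have "(\<rho> x * v x - q' x) * g x = K * v x * \<rho> x * g x"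
      using r(1) by (simp add: divide_simps; simp add: algebra_simps)
    then have "\<rho> x * v x - q' x = K * v x * \<rho> x" using g_nz[OF x] by simp
    then show ?thesis by (simp add: algebra_simps)
  qed
  show ?thesis
  proof (rule that[of v g q "- \<delta>"])
    show "Cinf_on v I" "continuous_on I g" by (rule smooth_v Cinf_on_continuous[OF smooth_g])+
    fix x assume x: "x \<in> I"
    show "v x > 0" "g x \<noteq> 0" by (rule v(1)[OF x] g_nz[OF x])+
    show "(\<rho> has_real_derivative q x * v x) (at x)" using \<rho>'(1)[OF x] \<rho>'_eq[OF x] by simp
    show "(h has_real_derivative g x * v x / (1 + (\<rho> x)\<^sup>2)) (at x)"
      using h'(1)[OF x] h'_eq[OF x] by (simp add: W_def)
    show "(q has_real_derivative (1 - K) * \<rho> x * v x) (at x)" using q'[OF x] q'_eq[OF x] by simp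
    show "(g x)\<^sup>2 + (q x)\<^sup>2 = 1 + (\<rho> x)\<^sup>2" using gq[OF x] by (simp add: W_def)
    fix \<theta>
    obtain k k' where "principal_curvatures f n (x, \<theta>) k' k" "\<delta> * g x = - k' * \<rho> x"
      using key[OF x] by blast
    moreover from this have "k' = - \<delta> * (g x / \<rho> x)" using \<rho>_pos[OF x] by (simp add: field_simps)
    ultimately show "\<exists>k. principal_curvatures f n (x, \<theta>) (- \<delta> * (g x / \<rho> x)) k" by blast
  qed
qed


section \<open>The classification\<close>

theorem theorem6p3:
  fixes K :: real and I :: "real set" and f :: "real \<times> real \<Rightarrow> real^4"
  assumes "open I" and "is_interval I"
    and "K \<noteq> 0"
    and "elliptic_rotation_surface I f"
    and "constant_Gauss_curvature (I \<times> UNIV) f K"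
    and "\<not> tubular (I \<times> UNIV) f"
  shows "\<exists>r \<psi>. (cgc_profile K r \<psi> \<or> limit_profile K r \<psi>) \<and> given_by I f r \<psi>"
proof -
  have surf: "surface_in_hyp3 (I \<times> UNIV) f"
    using assms(4) by (simp add: elliptic_rotation_surface_def)
  then obtain x0 where x0: "x0 \<in> I" by (auto simp: surface_in_hyp3_def)
  have conn: "connected I" using assms(2) by (simp add: is_interval_connected_1)
  obtain e \<rho> h \<phi> where e: "orthonormal_basis e"
    and smooth: "Cinf_on \<rho> I" "Cinf_on h I" "Cinf_on \<phi> I"
    and \<rho>_pos: "\<And>x. x \<in> I \<Longrightarrow> \<rho> x > 0"
    and f_eq: "\<And>x \<theta>. x \<in> I \<Longrightarrow> f (x, \<theta>) = rotation_param e \<rho> h (x, \<theta> + \<phi> x)"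
    by (rule elliptic_rotation_normal_form[OF assms(1,2,4)]) blast
  obtain n where n: "unit_normal_field (I \<times> UNIV) f n"
    and curv: "\<And>u. u \<in> I \<times> UNIV \<Longrightarrow> \<exists>k1 k2. principal_curvatures f n u k1 k2 \<and> k1 * k2 = K"
    using assms(5) unfolding constant_Gauss_curvature_def by blast
  obtain q g v \<delta> where v: "Cinf_on v I" and g: "continuous_on I g"
    and v_pos: "\<And>x. x \<in> I \<Longrightarrow> v x > 0" and g_nz: "\<And>x. x \<in> I \<Longrightarrow> g x \<noteq> 0"
    and \<rho>': "\<And>x. x \<in> I \<Longrightarrow> (\<rho> has_real_derivative q x * v x) (at x)"
    and h': "\<And>x. x \<in> I \<Longrightarrow> (h has_real_derivative g x * v x / (1 + (\<rho> x)\<^sup>2)) (at x)"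
    and q': "\<And>x. x \<in> I \<Longrightarrow> (q has_real_derivative (1 - K) * \<rho> x * v x) (at x)"
    and gq: "\<And>x. x \<in> I \<Longrightarrow> (g x)\<^sup>2 + (q x)\<^sup>2 = 1 + (\<rho> x)\<^sup>2"
    and pc: "\<And>x \<theta>. x \<in> I \<Longrightarrow> \<exists>k. principal_curvatures f n (x, \<theta>) (\<delta> * (g x / \<rho> x)) k"
    by (rule rotational_curvature[OF assms(1,2) e smooth \<rho>_pos f_eq surf n curv assms(3)]) blast+
  have "((\<lambda>x. (q x)\<^sup>2 - (1 - K) * (\<rho> x)\<^sup>2) has_real_derivative 0) (at x)" if "x \<in> I" for x
    by (auto intro!: derivative_eq_intros q'[OF that] \<rho>'[OF that])
  \<comment> \<open>The first integral of the curvature equation.\<close>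
  from zero_derivative_imp_constant[OF assms(2) this]
  obtain C where C: "\<And>x. x \<in> I \<Longrightarrow> (q x)\<^sup>2 - (1 - K) * (\<rho> x)\<^sup>2 = C" by blast
  have q_sq: "(q x)\<^sup>2 = (1 - K) * (\<rho> x)\<^sup>2 + C" if "x \<in> I" for x using C[OF that] by simp
  have g_sq: "(g x)\<^sup>2 = K * (\<rho> x)\<^sup>2 + 1 - C" if "x \<in> I" for x
    using gq[OF that] q_sq[OF that] by (simp add: algebra_simps)
  interpret rotational_cgc I f e \<rho> h \<phi> q g v K C
    by unfold_locales (use assms(1,2) x0 in \<open>auto simp: g_nz intro: e f_eq smooth v \<rho>_pos v_pos \<rho>' q' h' g q_sq g_sq\<close>)
  \<comment> \<open>The surface is not tubular, so the principal curvature along the circles varies.\<close>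
  have not_const: False if "\<And>x. x \<in> I \<Longrightarrow> g x / \<rho> x = c" for c
  proof -
    have "\<exists>k. principal_curvatures f n u (\<delta> * c) k" if "u \<in> I \<times> UNIV" for u
      using pc[of "fst u" "snd u"] \<open>\<And>x. x \<in> I \<Longrightarrow> g x / \<rho> x = c\<close>[of "fst u"] that by auto
    then have "tubular (I \<times> UNIV) f" unfolding tubular_def using n by blast
    then show False using assms(6) by simp
  qed
  have C_ne_1: "C \<noteq> 1"
  proof
    assume "C = 1"
    then have g2: "(g x)\<^sup>2 = K * (\<rho> x)\<^sup>2" if "x \<in> I" for x using g_sq[OF that] by simp
    have "0 < (g x0)\<^sup>2" using g_nz[OF x0] by simp
    then have K: "K > 0" unfolding g2[OF x0] using \<rho>_pos[OF x0] by (simp add: zero_less_mult_iff)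
    have cont: "continuous_on I (\<lambda>x. sqrt K * \<rho> x)" by (intro continuous_intros continuous_\<rho>)
    have "(g x)\<^sup>2 = (sqrt K * \<rho> x)\<^sup>2" "sqrt K * \<rho> x \<noteq> 0" if "x \<in> I" for x
      using g2[OF that] K \<rho>_pos[OF that] by (simp_all add: power_mult_distrib)
    from equal_squares_imp_constant_sign[OF conn g cont this]
    obtain \<sigma> where "\<And>x. x \<in> I \<Longrightarrow> g x = \<sigma> * (sqrt K * \<rho> x)" by blast
    then have "g x / \<rho> x = \<sigma> * sqrt K" if "x \<in> I" for x using that \<rho>_pos[OF that] by simp
    then show False by (rule not_const)
  qed
  have not_cylinder: False if "K = 1" "C = 0"
  proof -
    have "q x = 0" if "x \<in> I" for x using q_sq[OF that] \<open>K = 1\<close> \<open>C = 0\<close> by simp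
    then have "(\<rho> has_real_derivative 0) (at x)" if "x \<in> I" for x using \<rho>'[OF that] that by simp
    from zero_derivative_imp_constant[OF assms(2) this]
    obtain R where R: "\<And>x. x \<in> I \<Longrightarrow> \<rho> x = R" by blast
    have pos: "R\<^sup>2 + 1 > 0" by (simp add: add_nonneg_pos)
    have "\<exists>\<sigma>. \<forall>x\<in>I. g x = \<sigma> * sqrt (R\<^sup>2 + 1)"
    proof (rule equal_squares_imp_constant_sign[OF conn g, of "\<lambda>_. sqrt (R\<^sup>2 + 1)"])
      fix x assume x: "x \<in> I"
      show "(g x)\<^sup>2 = (sqrt (R\<^sup>2 + 1))\<^sup>2" "sqrt (R\<^sup>2 + 1) \<noteq> 0"
        using g_sq[OF x] R[OF x] pos \<open>K = 1\<close> \<open>C = 0\<close> by simp_all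
    qed auto
    then obtain \<sigma> where "\<And>x. x \<in> I \<Longrightarrow> g x = \<sigma> * sqrt (R\<^sup>2 + 1)" by blast
    then have "g x / \<rho> x = \<sigma> * sqrt (R\<^sup>2 + 1) / R" if "x \<in> I" for x using R that by simp
    then show False by (rule not_const)
  qed
  \<comment> \<open>Positivity of \<open>g\<^sup>2\<close> and nonnegativity of \<open>q\<^sup>2\<close> at one point restrict the possible values of \<open>C\<close>.\<close>
  have Q0: "K * (\<rho> x0)\<^sup>2 + 1 - C > 0" by (rule Q_pos[OF x0])
  have \<rho>0: "(\<rho> x0)\<^sup>2 > 0" using \<rho>_pos[OF x0] by simp
  have P0: "(1 - K) * (\<rho> x0)\<^sup>2 + C \<ge> 0" using q_sq[OF x0] zero_le_power2[of "q x0"] by simp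
  consider "K < 0" | "0 < K" "K < 1" | "K = 1" | "1 < K" using assms(3) by linarith
  then show ?thesis
  proof cases
    case 1
    then have "K * (\<rho> x0)\<^sup>2 < 0" using \<rho>0 by (simp add: mult_neg_pos)
    then have "C < 1" using Q0 by linarith
    then show ?thesis using profile_neg_i[OF 1] profile_neg_ii[OF 1] by (cases "0 \<le> C") auto
  next
    case 2
    consider "C < 0" | "C = 0" | "0 < C" "C \<le> 1 - K" | "1 - K \<le> C" "C < 1" | "1 < C"
      using C_ne_1 by linarith
    then show ?thesis
      using profile_between_i[OF 2] profile_between_limit[OF 2] profile_between_ii[OF 2]
        profile_between_iii[OF 2] profile_between_iv[OF 2] by cases blast+
  next
    case 3
    then have "C \<ge> 0" using P0 by simp
    moreover have "C \<noteq> 0" using not_cylinder[OF 3] by blast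
    ultimately have "0 < C \<and> C < 1 \<or> 1 < C" using C_ne_1 by linarith
    then show ?thesis using profile_one_i[OF 3] profile_one_ii[OF 3] by blast
  next
    case 4
    then have "(1 - K) * (\<rho> x0)\<^sup>2 < 0" using \<rho>0 by (simp add: mult_neg_pos)
    then have "0 < C" using P0 by linarith
    then have "0 < C \<and> C < 1 \<or> 1 < C" using C_ne_1 by linarith
    then show ?thesis using profile_above_i[OF 4] profile_above_ii[OF 4] by blast
  qed
qed

end
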